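(* Let $f=(f_1,\ldots,f_n)$ be an $n$-tuple of formal power series with the model property and let $(M_{Z_1},\ldots,M_{Z_n})$ be the universal model associated with the noncommutative domain $\mathbb B_f$. Let $J_c$ be the WOT-closed two-sided ideal of the Hardy algebra $H^\infty(\mathbb B_f)$ generated by the commutators $M_{Z_i}M_{Z_j}-M_{Z_j}M_{Z_i}$, $i,j=1,\ldots,n$. Then the following statements hold. (i) $\mathbb H_s^2(f)=\overline{\operatorname{span}}\{\Gamma_\lambda:\lambda\in\mathbb B_f^<(\mathbb C)\}=\mathcal N_{J_c}:=\mathbb H^2(f)\ominus\overline{J_c(1)}$. (ii) The symmetric Hardy space $\mathbb H_s^2(f)$ can be identified with the Hilbert space $H^2(\mathbb B_f^<(\mathbb C))$ of all holomorphic functions $\psi:\mathbb B_f^<(\mathbb C)\to\mathbb C$ which admit a series representation $\psi(\lambda)=\sum_{\mathbf k\in\mathbb N_0^n}c_{\mathbf k}f(\lambda)^{\mathbf k}$ with $$\|\psi\|_2^2=\sum_{\mathbf k\in\mathbb N_0^n}|c_{\mathbf k}|^2\frac1{\gamma_{\mathbf k}}<\infty.$$ More precisely, every element $\psi=\sum_{\mathbf k\in\mathbb N_0^n}c_{\mathbf k}\omega^{(\mathbf k)}$ in $\mathbb H_s^2(f)$ has a functional representation on $\mathbb B_f^<(\mathbb C)$ given by $$\psi(\lambda):=\langle\psi,\Omega_\lambda\rangle=\sum_{\mathbf k\in\mathbb N_0^n}c_{\mathbf k}f(\lambda)^{\mathbf k},\qquad\lambda\in\mathbb B_f^<(\mathbb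 C),$$ where $\Omega_\lambda:=\big(1-\sum_{i=1}^n|f_i(\lambda)|^2\big)^{-1/2}\Gamma_\lambda$, and $$|\psi(\lambda)|\le\frac{\|\psi\|_2}{\sqrt{1-\sum_{i=1}^n|f_i(\lambda)|^2}},\qquad\lambda\in\mathbb B_f^<(\mathbb C).$$ (iii) The mapping $\Lambda_f:\mathbb B_f^<(\mathbb C)\times\mathbb B_f^<(\mathbb C)\to\mathbb C$ defined by $$\Lambda_f(\mu,\lambda):=\langle\Omega_\lambda,\Omega_\mu\rangle=\frac1{1-\sum_{i=1}^nf_i(\mu)\overline{f_i(\lambda)}},\qquad\lambda,\mu\in\mathbb B_f^<(\mathbb C),$$ is positive definite.
   Context: Notation. $\mathbb F_n^+$ is the free semigroup on $g_1,\ldots,g_n$ with identity $g_0$ and length $|\cdot|$. For an $n$-tuple $X$ of elements of a unital algebra, $X_\alpha=X_{i_1}\cdots X_{i_k}$ if $\alpha=g_{i_1}\cdots g_{i_k}$, $X_{g_0}=I$; $[f(X)]_\alpha$ is the corresponding product of $f_1(X),\ldots,f_n(X)$, and $[\overline{f(\lambda)}]_\alpha$ that of the complex conjugates $\overline{f_i(\lambda)}$. A tuple $X\in B(\mathcal H)^n$ is viewed as a row operator, so $\|X\|=\|\sum X_iX_i^*\|^{1/2}$; $[B(\mathcal H)^n]_\gamma=\{X:\|X\|<\gamma\}$. A free holomorphic function on $[B(\mathcal H)^n]_\gamma$ is a formal power series $\sum a_\alpha Z_\alpha$ in noncommuting indeterminates (complex coefficients) with radius of convergence $r$, $r^{-1}=\limsup_k(\sum_{|\alpha|=k}|a_\alpha|^2)^{1/2k}$,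 at least $\gamma$, identified with the map $X\mapsto\sum_k\sum_{|\alpha|=k}a_\alpha X_\alpha$ (norm convergence; $\mathcal H$ separable infinite-dimensional). $H^2_{\bf ball}$ is the Hilbert space of series with $\sum|a_\alpha|^2<\infty$ (the $Z_\alpha$ being orthonormal). Convergence sets. For an $n$-tuple $f$ of formal power series $f_j=\sum c^{(j)}_\alpha Z_\alpha$ and a Hilbert space $\mathcal H$: $\mathcal C_f^{SOT}(\mathcal H)$ is the set of $X\in B(\mathcal H)^n$ such that each series $f_j(X):=\sum_k\sum_{|\alpha|=k}c^{(j)}_\alpha X_\alpha$ is SOT-convergent; $\mathcal C_f^{rad}(\mathcal H)$ is the set of $X$ such that for some $\delta\in(0,1)$ these series converge in norm at $rX$ for all $r\in(\delta,1)$ and $f_j(X):=\text{SOT-}\lim_{r\to1}f_j(rX)$ exists for each $j$. Model property. $f=(f_1,\ldots,f_n)$ has the model property if one of the following holds. (A) $f$ is an $n$-tuple of noncommutative polynomials for which there is an $n$-tuple $g$ of noncommutative polynomials with $f\circ g=g\circ f=\mathrm{id}$. Then $\{f_\alpha\}$ is a linear basis of $\mathbb C[Z_1,\ldots,Z_n]$ and $\mathbb H^2(f)$ is the completion of $\mathbb C[Z_1,\ldots,Z_n]$ for the inner product $\langle f_\alpha,f_\beta\rangle=\delta_{\alpha\beta}$. (S) $f$ is an $n$-tuple of formal power series with $f(0)=0$, nonzero radius of convergence and $\det J_f(0)\neq0$ ($J_f(0)_{ij}$ is the coefficient of $Z_j$ in $f_i$); $\mathbb H^2(f)$ is the Hilbert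 space of formal power series $\sum a_\alpha f_\alpha$, $\sum|a_\alpha|^2<\infty$, with $\{f_\alpha\}$ orthonormal; $Z_1,\ldots,Z_n\in\mathbb H^2(f)$; left multiplication $M_{Z_i}$ by $Z_i$ is bounded on $\mathbb H^2(f)$; and $M_Z=(M_{Z_1},\ldots,M_{Z_n})$ belongs to $\mathcal C_f^{SOT}(\mathbb H^2(f))$ or $\mathcal C_f^{rad}(\mathbb H^2(f))$ with $f_j(M_Z)=M_{f_j}$ (left multiplication by $f_j$), $j=1,\ldots,n$. (F) $f$ is an $n$-tuple of free holomorphic functions on some $[B(\mathcal H)^n]_\gamma$, $\gamma>0$, with range in $[B(\mathcal H)^n]_1$, such that $G\circ f\not\equiv0$ for every nonzero free holomorphic $G$ on $[B(\mathcal H)^n]_1$; $\mathbb H^2(f)=\{G\circ f:G\in H^2_{\bf ball}\}$ with $\langle F\circ f,G\circ f\rangle=\langle F,G\rangle$; the coordinate functions $Z_1,\ldots,Z_n$ lie in $\mathbb H^2(f)$, left multiplications $M_{Z_i}$ by them are bounded on $\mathbb H^2(f)$, and $M_Z$ is in $\mathcal C_f^{SOT}(\mathbb H^2(f))$ or $\mathcal C_f^{rad}(\mathbb H^2(f))$ with $f_j(M_Z)=M_{f_j}$ for all $j$. In all cases $\{f_\alpha\}_{\alpha\in\mathbb F_n^+}$ is an orthonormal basis of $\mathbb H^2(f)$ (with $f_{g_0}=1$), and $M_Z$ is called the universal model. Writing $Z_i=\sum_\alpha a^{(i)}_\alpha f_\alpha$ in $\mathbb H^2(f)$, one has $M_{Z_i}f_\beta=\sum_\alpha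 a^{(i)}_\alpha f_{\alpha\beta}$, and $g_i:=\sum_\alpha a^{(i)}_\alpha Z_\alpha$ defines the inverse $g=(g_1,\ldots,g_n)$ of $f$ with respect to composition. Domain. $X\in B(\mathcal H)^n$ satisfies $g(f(X))=X$ if $X\in\mathcal C_f^{SOT}(\mathcal H)\cup\mathcal C_f^{rad}(\mathcal H)$ and either (for all $i$) $X_i=\sum_k\sum_{|\alpha|=k}a^{(i)}_\alpha[f(X)]_\alpha$ in the SOT, or (for all $i$) $X_i=\text{SOT-}\lim_{r\to1}\sum_k\sum_{|\alpha|=k}a^{(i)}_\alpha r^{|\alpha|}[f(X)]_\alpha$ (automatic in case (A)). Then $\mathbb B_f^<(\mathcal H):=\{X\in B(\mathcal H)^n:\ g(f(X))=X,\ \|f(X)\|<1\}$; $\mathbb B_f^<(\mathbb C)\subset\mathbb C^n$ is the case $\mathcal H=\mathbb C$. Further objects. $H^\infty(\mathbb B_f)$ is the WOT-closure in $B(\mathbb H^2(f))$ of all noncommutative polynomials in $M_{Z_1},\ldots,M_{Z_n}$ and the identity. $J_c(1)=\{A1:A\in J_c\}$. For $\lambda\in\mathbb B_f^<(\mathbb C)$, $\Gamma_\lambda:=(1-\sum_i|f_i(\lambda)|^2)^{1/2}\sum_{\alpha\in\mathbb F_n^+}[\overline{f(\lambda)}]_\alpha f_\alpha\in\mathbb H^2(f)$. $\mathbb N_0=\{0,1,\ldots\}$; for $\mathbf k=(k_1,\ldots,k_n)\in\mathbb N_0^n$ and $\lambda\in\mathbb C^n$, $\lambda^{\mathbf k}=\lambda_1^{k_1}\cdots\lambda_n^{k_n}$,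 $f(\lambda)^{\mathbf k}=f_1(\lambda)^{k_1}\cdots f_n(\lambda)^{k_n}$; $\Lambda_{\mathbf k}:=\{\alpha\in\mathbb F_n^+:\lambda_\alpha=\lambda^{\mathbf k}\ \forall\lambda\in\mathbb C^n\}$; $\gamma_{\mathbf k}:=\operatorname{card}\Lambda_{\mathbf k}=\frac{|\mathbf k|!}{k_1!\cdots k_n!}$; $\omega^{(\mathbf k)}:=\frac1{\gamma_{\mathbf k}}\sum_{\alpha\in\Lambda_{\mathbf k}}f_\alpha$. The $\omega^{(\mathbf k)}$ are mutually orthogonal with $\|\omega^{(\mathbf k)}\|=\gamma_{\mathbf k}^{-1/2}$, and the symmetric Hardy space $\mathbb H_s^2(f)$ is their closed linear span in $\mathbb H^2(f)$. *)

theory Defs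
  imports "HOL-Analysis.Analysis"
begin

section \<open>Complex Hilbert spaces\<close>

class complex_inner = real_inner +
  fixes scaleC :: "complex \<Rightarrow> 'a \<Rightarrow> 'a"  (infixr \<open>*\<^sub>C\<close> 75)
    and cinner :: "'a \<Rightarrow> 'a \<Rightarrow> complex"
  assumes scaleC_add_right: "c *\<^sub>C (x + y) = c *\<^sub>C x + c *\<^sub>C y"
    and scaleC_add_left: "(c + d) *\<^sub>C x = c *\<^sub>C x + d *\<^sub>C x"
    and scaleC_scaleC: "c *\<^sub>C d *\<^sub>C x = (c * d) *\<^sub>C x"
    and scaleC_one: "1 *\<^sub>C x = x"
    and scaleR_scaleC: "r *\<^sub>R x = complex_of_real r *\<^sub>C x"
    and cinner_commute: "cinner x y = cnj (cinner y x)"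
    and cinner_add_left: "cinner (x + y) z = cinner x z + cinner y z"
    and cinner_scaleC_left: "cinner (c *\<^sub>C x) y = c * cinner x y"
    and inner_cinner: "inner x y = Re (cinner x y)"

class chilbert_space = complex_inner + complete_space
begin
subclass banach ..
end

lemma cinner_self: "cinner x x = complex_of_real ((norm x)\<^sup>2)"
  for x :: "'a::complex_inner"
proof (rule complex_eqI)
  have "Im (cinner x x) = Im (cnj (cinner x x))"
    by (metis cinner_commute)
  then show "Im (cinner x x) = Im (complex_of_real ((norm x)\<^sup>2))"
    by simp
qed (simp add: power2_norm_eq_inner inner_cinner)

lemma norm_scaleC: "norm (c *\<^sub>C x) = cmod c * norm x"
  for x :: "'a::complex_inner"
proof -
  have "cinner (c *\<^sub>C x) (c *\<^sub>C x) = c * cnj c * cinner x x"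
    by (metis (no_types, opaque_lifting) cinner_scaleC_left cinner_commute complex_cnj_mult
        mult.assoc)
  then have "complex_of_real ((norm (c *\<^sub>C x))\<^sup>2) = complex_of_real ((cmod c * norm x)\<^sup>2)"
    by (simp add: cinner_self complex_norm_square[symmetric] power_mult_distrib)
  then have "(norm (c *\<^sub>C x))\<^sup>2 = (cmod c * norm x)\<^sup>2"
    using of_real_eq_iff by blast
  then show ?thesis
    by (simp add: power2_eq_iff_nonneg)
qed

lemma bounded_linear_scaleC: "bounded_linear (\<lambda>x::'a::complex_inner. c *\<^sub>C x)"
proof (rule bounded_linear_intro[where K = "cmod c"])
  fix r and x :: 'a
  show "c *\<^sub>C r *\<^sub>R x = r *\<^sub>R c *\<^sub>C x"
    by (simp add: scaleR_scaleC scaleC_scaleC mult.commute)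
qed (simp_all add: scaleC_add_right norm_scaleC mult.commute)

global_interpretation complex_vector:
  vector_space "scaleC :: complex \<Rightarrow> 'a \<Rightarrow> 'a::complex_inner"
  defines cspan = complex_vector.span
  by unfold_locales (simp_all add: scaleC_add_right scaleC_add_left scaleC_scaleC scaleC_one)

instantiation complex :: chilbert_space
begin
definition scaleC_complex :: "complex \<Rightarrow> complex \<Rightarrow> complex"
  where "scaleC_complex c x = c * x"
definition cinner_complex :: "complex \<Rightarrow> complex \<Rightarrow> complex"
  where "cinner_complex x y = x * cnj y"
instance
  by standard (simp_all add: scaleC_complex_def cinner_complex_def algebra_simps
      scaleR_conv_of_real inner_complex_def)
end


subsection \<open>Square-summable families\<close>

typedef 'a ell2 = "{x :: 'a \<Rightarrow> complex. (\<lambda>i. (cmod (x i))\<^sup>2) summable_on UNIV}"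
  by (rule exI[of _ "\<lambda>_. 0"]) simp

setup_lifting type_definition_ell2

lemma Rep_ell2_summable: "(\<lambda>i. (cmod (Rep_ell2 x i))\<^sup>2) summable_on UNIV"
  using Rep_ell2[of x] by simp

lemma ell2_product_abs_summable:
  assumes "(\<lambda>i. (cmod (x i))\<^sup>2) summable_on UNIV" and "(\<lambda>i. (cmod (y i))\<^sup>2) summable_on UNIV"
  shows "(\<lambda>i. norm (x i * cnj (y i))) summable_on UNIV"
proof (rule summable_on_comparison_test)
  show "(\<lambda>i. (cmod (x i))\<^sup>2 + (cmod (y i))\<^sup>2) summable_on UNIV"
    using assms by (rule summable_on_add)
  fix i
  have "0 \<le> (cmod (x i) - cmod (y i))\<^sup>2" by simp
  then have "2 * (cmod (x i) * cmod (y i)) \<le> (cmod (x i))\<^sup>2 + (cmod (y i))\<^sup>2"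
    by (simp add: power2_diff)
  moreover have "0 \<le> cmod (x i) * cmod (y i)" by simp
  ultimately show "norm (x i * cnj (y i)) \<le> (cmod (x i))\<^sup>2 + (cmod (y i))\<^sup>2"
    unfolding norm_mult complex_mod_cnj by linarith
qed simp

lemma ell2_product_summable:
  assumes "(\<lambda>i. (cmod (x i))\<^sup>2) summable_on UNIV" and "(\<lambda>i. (cmod (y i))\<^sup>2) summable_on UNIV"
  shows "(\<lambda>i. x i * cnj (y i)) summable_on UNIV"
  using ell2_product_abs_summable[OF assms] by (rule abs_summable_summable)

lemma ell2_add_summable:
  assumes "(\<lambda>i. (cmod (x i))\<^sup>2) summable_on UNIV" and "(\<lambda>i. (cmod (y i))\<^sup>2) summable_on UNIV"
  shows "(\<lambda>i. (cmod (x i + y i))\<^sup>2) summable_on UNIV"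
proof (rule summable_on_comparison_test)
  show "(\<lambda>i. 2 * ((cmod (x i))\<^sup>2 + (cmod (y i))\<^sup>2)) summable_on UNIV"
    using assms by (intro summable_on_cmult_right summable_on_add)
  fix i
  have "(cmod (x i + y i))\<^sup>2 \<le> (cmod (x i) + cmod (y i))\<^sup>2"
    by (simp add: norm_triangle_ineq power_mono)
  also have "\<dots> \<le> 2 * ((cmod (x i))\<^sup>2 + (cmod (y i))\<^sup>2)"
    using zero_le_power2[of "cmod (x i) - cmod (y i)"] by (simp add: power2_sum power2_diff)
  finally show "(cmod (x i + y i))\<^sup>2 \<le> 2 * ((cmod (x i))\<^sup>2 + (cmod (y i))\<^sup>2)" .
qed simp

lemma ell2_scale_summable:
  assumes "(\<lambda>i. (cmod (x i))\<^sup>2) summable_on UNIV"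
  shows "(\<lambda>i. (cmod (c * x i))\<^sup>2) summable_on UNIV"
  using assms by (simp add: norm_mult power_mult_distrib summable_on_cmult_right)

instantiation ell2 :: (type) real_vector
begin
lift_definition zero_ell2 :: "'a ell2" is "\<lambda>_. 0" by simp
lift_definition plus_ell2 :: "'a ell2 \<Rightarrow> 'a ell2 \<Rightarrow> 'a ell2" is "\<lambda>x y i. x i + y i"
  by (rule ell2_add_summable)
lift_definition uminus_ell2 :: "'a ell2 \<Rightarrow> 'a ell2" is "\<lambda>x i. - x i"
  by simp
lift_definition minus_ell2 :: "'a ell2 \<Rightarrow> 'a ell2 \<Rightarrow> 'a ell2" is "\<lambda>x y i. x i - y i"
  subgoal for x y using ell2_add_summable[of x "\<lambda>i. - y i"] by simp
  done
lift_definition scaleR_ell2 :: "real \<Rightarrow> 'a ell2 \<Rightarrow> 'a ell2" is "\<lambda>r x i. complex_of_real r * x i"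
  by (rule ell2_scale_summable)
instance
  by standard (transfer, simp add: algebra_simps fun_eq_iff)+
end

instantiation ell2 :: (type) complex_inner
begin
lift_definition scaleC_ell2 :: "complex \<Rightarrow> 'a ell2 \<Rightarrow> 'a ell2" is "\<lambda>c x i. c * x i"
  by (rule ell2_scale_summable)
lift_definition cinner_ell2 :: "'a ell2 \<Rightarrow> 'a ell2 \<Rightarrow> complex"
  is "\<lambda>x y. \<Sum>\<^sub>\<infinity>i. x i * cnj (y i)" .
definition inner_ell2 :: "'a ell2 \<Rightarrow> 'a ell2 \<Rightarrow> real"
  where "inner_ell2 x y = Re (cinner x y)"
definition norm_ell2 :: "'a ell2 \<Rightarrow> real"
  where "norm_ell2 x = sqrt (inner x x)"
definition dist_ell2 :: "'a ell2 \<Rightarrow> 'a ell2 \<Rightarrow> real"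
  where "dist_ell2 x y = norm (x - y)"
definition sgn_ell2 :: "'a ell2 \<Rightarrow> 'a ell2"
  where "sgn_ell2 x = inverse (norm x) *\<^sub>R x"
definition uniformity_ell2 :: "('a ell2 \<times> 'a ell2) filter"
  where "uniformity_ell2 = (INF e\<in>{0<..}. principal {(x, y). dist x y < e})"
definition open_ell2 :: "'a ell2 set \<Rightarrow> bool"
  where "open_ell2 U \<longleftrightarrow> (\<forall>x\<in>U. \<forall>\<^sub>F (x', y) in uniformity. x' = x \<longrightarrow> y \<in> U)"
instance
proof
  fix x y z :: "'a ell2" and c d :: complex and r :: real
  show comm: "cinner x y = cnj (cinner y x)" for x y :: "'a ell2"
    by transfer (simp add: infsum_cnj[symmetric] mult.commute)
  show add: "cinner (x + y) z = cinner x z + cinner y z"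
    by transfer (simp add: distrib_right infsum_add ell2_product_summable)
  show scale: "cinner (c *\<^sub>C x) y = c * cinner x y" for c and x y :: "'a ell2"
    by transfer (simp add: mult.assoc infsum_cmult_right ell2_product_summable)
  show scaleRC: "r *\<^sub>R x = complex_of_real r *\<^sub>C x" for r and x :: "'a ell2"
    by transfer simp
  have self: "inner x x = (\<Sum>\<^sub>\<infinity>i. (cmod (Rep_ell2 x i))\<^sup>2)" for x :: "'a ell2"
    unfolding inner_ell2_def
    using infsum_Re[OF ell2_product_summable[OF Rep_ell2_summable Rep_ell2_summable, of x x]]
    by (simp add: cinner_ell2.rep_eq complex_norm_square[symmetric] flip: of_real_power)
  show "c *\<^sub>C (x + y) = c *\<^sub>C x + c *\<^sub>C y" "(c + d) *\<^sub>C x = c *\<^sub>C x + d *\<^sub>C x"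
    "c *\<^sub>C d *\<^sub>C x = (c * d) *\<^sub>C x" "1 *\<^sub>C x = x"
    by (transfer, simp add: algebra_simps)+
  show "inner x y = Re (cinner x y)"
    by (simp add: inner_ell2_def)
  show "inner x y = inner y x"
    using comm[of x y] by (simp add: inner_ell2_def)
  show "inner (x + y) z = inner x z + inner y z"
    by (simp add: inner_ell2_def add)
  show "inner (r *\<^sub>R x) y = r * inner x y"
    by (simp add: inner_ell2_def scaleRC scale)
  show "0 \<le> inner x x"
    unfolding self by (rule infsum_nonneg) simp
  show "inner x x = 0 \<longleftrightarrow> x = 0"
  proof
    assume "inner x x = 0"
    then have "(cmod (Rep_ell2 x i))\<^sup>2 = 0" for i
      by (intro nonneg_infsum_le_0D[where A = UNIV])
        (simp_all add: self Rep_ell2_summable)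
    then show "x = 0"
      by transfer (simp add: fun_eq_iff)
  qed (simp add: self zero_ell2.rep_eq)
qed (simp_all add: norm_ell2_def dist_ell2_def sgn_ell2_def uniformity_ell2_def open_ell2_def)
end

lemma norm_ell2_sum: "(norm x)\<^sup>2 = (\<Sum>\<^sub>\<infinity>i. (cmod (Rep_ell2 x i))\<^sup>2)"
  using infsum_Re[OF ell2_product_summable[OF Rep_ell2_summable Rep_ell2_summable, of x x]]
  by (simp add: power2_norm_eq_inner inner_ell2_def cinner_ell2.rep_eq
      complex_norm_square[symmetric] flip: of_real_power)

lemma ell2_sum_le_norm:
  assumes "finite F"
  shows "(\<Sum>i\<in>F. (cmod (Rep_ell2 x i))\<^sup>2) \<le> (norm x)\<^sup>2"
  unfolding norm_ell2_sum
  by (rule finite_sum_le_infsum) (use assms Rep_ell2_summable in auto)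

lemma ell2_coord_le_norm: "cmod (Rep_ell2 x i) \<le> norm x"
  using ell2_sum_le_norm[of "{i}" x] by (simp add: power2_le_iff_abs_le)

instance ell2 :: (type) chilbert_space
proof
  fix X :: "nat \<Rightarrow> 'a ell2"
  assume X: "Cauchy X"
  have "Cauchy (\<lambda>n. Rep_ell2 (X n) i)" for i
  proof (rule metric_CauchyI)
    fix e :: real assume "0 < e"
    then obtain N where N: "\<And>m n. m \<ge> N \<Longrightarrow> n \<ge> N \<Longrightarrow> dist (X m) (X n) < e"
      using X unfolding Cauchy_def by blast
    have "dist (Rep_ell2 (X m) i) (Rep_ell2 (X n) i) \<le> dist (X m) (X n)" for m n
      using ell2_coord_le_norm[of "X m - X n" i] by (simp add: dist_norm minus_ell2.rep_eq)
    then show "\<exists>N. \<forall>m\<ge>N. \<forall>n\<ge>N. dist (Rep_ell2 (X m) i) (Rep_ell2 (X n) i) < e"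
      using N by (meson le_less_trans)
  qed
  then have "\<exists>l. (\<lambda>n. Rep_ell2 (X n) i) \<longlonglongrightarrow> l" for i
    using Cauchy_convergent convergent_def by blast
  then obtain l where l: "\<And>i. (\<lambda>n. Rep_ell2 (X n) i) \<longlonglongrightarrow> l i"
    by metis
  have bound: "(\<Sum>i\<in>F. (cmod (l i - Rep_ell2 (X n) i))\<^sup>2) \<le> e\<^sup>2"
    if "finite F" "0 < e" "\<And>m. m \<ge> n \<Longrightarrow> dist (X m) (X n) < e" for F n e
  proof (rule tendsto_upperbound[OF _ _ sequentially_bot])
    show "(\<lambda>m. \<Sum>i\<in>F. (cmod (Rep_ell2 (X m) i - Rep_ell2 (X n) i))\<^sup>2)
        \<longlonglongrightarrow> (\<Sum>i\<in>F. (cmod (l i - Rep_ell2 (X n) i))\<^sup>2)"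
      by (intro tendsto_intros l)
    show "\<forall>\<^sub>F m in sequentially. (\<Sum>i\<in>F. (cmod (Rep_ell2 (X m) i - Rep_ell2 (X n) i))\<^sup>2) \<le> e\<^sup>2"
    proof (rule eventually_sequentiallyI[of n])
      fix m assume "n \<le> m"
      then have "(norm (X m - X n))\<^sup>2 \<le> e\<^sup>2"
        using that(3)[of m] by (intro power_mono) (simp_all add: dist_norm)
      then show "(\<Sum>i\<in>F. (cmod (Rep_ell2 (X m) i - Rep_ell2 (X n) i))\<^sup>2) \<le> e\<^sup>2"
        using ell2_sum_le_norm[OF that(1), of "X m - X n"] by (simp add: minus_ell2.rep_eq)
    qed
  qed
  have summ: "(\<lambda>i. (cmod (l i - Rep_ell2 (X n) i))\<^sup>2) summable_on UNIV"
    if "0 < e" "\<And>m. m \<ge> n \<Longrightarrow> dist (X m) (X n) < e" for n e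
    by (rule nonneg_bdd_above_summable_on)
      (use bound[OF _ that] in \<open>auto intro!: bdd_aboveI2\<close>)
  obtain N where "\<And>m n. m \<ge> N \<Longrightarrow> n \<ge> N \<Longrightarrow> dist (X m) (X n) < 1"
    using X unfolding Cauchy_def by (meson zero_less_one)
  then have "(\<lambda>i. (cmod (l i - Rep_ell2 (X N) i))\<^sup>2) summable_on UNIV"
    by (intro summ[of 1]) auto
  from ell2_add_summable[OF this Rep_ell2_summable[of "X N"]]
  have Rep: "Rep_ell2 (Abs_ell2 l) = l"
    by (simp add: Abs_ell2_inverse)
  have "X \<longlonglongrightarrow> Abs_ell2 l"
  proof (rule metric_LIMSEQ_I)
    fix e :: real assume e: "0 < e"
    obtain N where N: "\<And>m n. m \<ge> N \<Longrightarrow> n \<ge> N \<Longrightarrow> dist (X m) (X n) < e / 2"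
      using X e unfolding Cauchy_def by (meson half_gt_zero)
    have "dist (X n) (Abs_ell2 l) < e" if "n \<ge> N" for n
    proof -
      have "(norm (Abs_ell2 l - X n))\<^sup>2 \<le> (e / 2)\<^sup>2"
        unfolding norm_ell2_sum minus_ell2.rep_eq Rep
        by (rule infsum_le_finite_sums) (use summ[of "e/2" n] bound[of _ "e/2" n] N that e in auto)
      then have "norm (Abs_ell2 l - X n) \<le> e / 2"
        using e by (simp add: power2_le_iff_abs_le)
      then show ?thesis
        using e by (simp add: dist_norm norm_minus_commute)
    qed
    then show "\<exists>N. \<forall>n\<ge>N. dist (X n) (Abs_ell2 l) < e"
      by blast
  qed
  then show "convergent X"
    by (rule convergentI)
qed

lift_definition ell2_unit :: "'a \<Rightarrow> 'a ell2" is "\<lambda>i j. if j = i then 1 else 0"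
proof -
  fix i :: 'a
  have "(\<lambda>j. (cmod (if j = i then 1 else 0))\<^sup>2) summable_on {i}"
    by simp
  then show "(\<lambda>j. (cmod (if j = i then 1 else 0))\<^sup>2) summable_on UNIV"
    by (rule summable_on_cong_neutral[THEN iffD1, rotated -1]) auto
qed



section \<open>Noncommutative power series\<close>

text \<open>
  The generators are indexed by a finite type \<open>'n\<close>, so the free semigroup is \<open>'n list\<close>, with
  identity \<open>[]\<close> and length \<^const>\<open>length\<close>. A formal power series is its family of coefficients.
\<close>

type_synonym 'n ncseries = "'n list \<Rightarrow> complex"

definition nc_one :: "'n ncseries"
  where "nc_one w = (if w = [] then 1 else 0)"

definition nc_var :: "'n \<Rightarrow> 'n ncseries"
  where "nc_var i w = (if w = [i] then 1 else 0)"

definition nc_mult :: "'n ncseries \<Rightarrow> 'n ncseries \<Rightarrow> 'n ncseries"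
  where "nc_mult p q w = (\<Sum>k\<le>length w. p (take k w) * q (drop k w))"

definition nc_word :: "('n \<Rightarrow> 'n ncseries) \<Rightarrow> 'n list \<Rightarrow> 'n ncseries"
  where "nc_word f \<alpha> = foldr nc_mult (map f \<alpha>) nc_one"

definition nc_polynomial :: "'n ncseries \<Rightarrow> bool"
  where "nc_polynomial p \<longleftrightarrow> finite {\<alpha>. p \<alpha> \<noteq> 0}"

text \<open>
  The formal series \<open>\<Sum>\<^sub>\<alpha> a\<^sub>\<alpha> f\<^sub>\<alpha>\<close>. It is used only if \<open>a\<close> is a polynomial or all constant terms of \<open>f\<close>
  vanish; then only finitely many terms contribute to each coefficient.
\<close>

definition nc_comp :: "'n ncseries \<Rightarrow> ('n \<Rightarrow> 'n ncseries) \<Rightarrow> 'n ncseries"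
  where "nc_comp a f w = (\<Sum>\<alpha> | a \<alpha> * nc_word f \<alpha> w \<noteq> 0. a \<alpha> * nc_word f \<alpha> w)"

text \<open>
  In \<^typ>\<open>ereal\<close>, \<^term>\<open>inverse 0\<close> is infinite, so polynomials have infinite radius of convergence.
\<close>

definition nc_radius :: "'n::finite ncseries \<Rightarrow> ereal"
  where "nc_radius a =
    inverse (limsup (\<lambda>k. ereal (root (2 * k) (\<Sum>\<alpha> | length \<alpha> = k. (cmod (a \<alpha>))\<^sup>2))))"


section \<open>Evaluation on tuples of operators\<close>

text \<open>
  \<open>'a \<Rightarrow>\<^sub>L 'a\<close> is the type of bounded real-linear maps; the elements of \<open>B(H)\<close> are those satisfying
  \<open>clinear_op\<close>.
\<close>

definition clinear_op :: "('a::complex_inner \<Rightarrow>\<^sub>L 'a) \<Rightarrow> bool"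
  where "clinear_op T \<longleftrightarrow> (\<forall>c x. T (c *\<^sub>C x) = c *\<^sub>C T x)"

lift_definition scaleC_op :: "complex \<Rightarrow> 'a::complex_inner \<Rightarrow>\<^sub>L 'a" is "\<lambda>c x. c *\<^sub>C x"
  by (rule bounded_linear_scaleC)

definition op_word :: "('n \<Rightarrow> 'a::complex_inner \<Rightarrow>\<^sub>L 'a) \<Rightarrow> 'n list \<Rightarrow> 'a \<Rightarrow>\<^sub>L 'a"
  where "op_word X \<alpha> = foldr (o\<^sub>L) (map X \<alpha>) id_blinfun"

text \<open>The norm of the row operator \<open>H\<^sup>n \<rightarrow> H\<close>, which is the square root of the norm of \<open>\<Sum> X\<^sub>i X\<^sub>i\<^sup>*\<close>.\<close>

definition row_norm :: "('n::finite \<Rightarrow> 'a::complex_inner \<Rightarrow>\<^sub>L 'a) \<Rightarrow> real"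
  where "row_norm X = onorm (\<lambda>h::'a^'n. \<Sum>i\<in>UNIV. X i (h $ i))"

definition op_ball :: "real \<Rightarrow> ('n::finite \<Rightarrow> 'a::complex_inner \<Rightarrow>\<^sub>L 'a) set"
  where "op_ball \<gamma> = {X. (\<forall>i. clinear_op (X i)) \<and> row_norm X < \<gamma>}"

definition nc_hom :: "'n::finite ncseries \<Rightarrow> ('n \<Rightarrow> 'a::complex_inner \<Rightarrow>\<^sub>L 'a) \<Rightarrow> nat \<Rightarrow> 'a \<Rightarrow>\<^sub>L 'a"
  where "nc_hom c X k = (\<Sum>\<alpha> | length \<alpha> = k. scaleC_op (c \<alpha>) o\<^sub>L op_word X \<alpha>)"

definition nc_eval :: "'n::finite ncseries \<Rightarrow> ('n \<Rightarrow> 'a::chilbert_space \<Rightarrow>\<^sub>L 'a) \<Rightarrow> 'a \<Rightarrow>\<^sub>L 'a"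
  where "nc_eval c X = (\<Sum>k. nc_hom c X k)"

definition free_holomorphic :: "real \<Rightarrow> 'n::finite ncseries \<Rightarrow> bool"
  where "free_holomorphic \<gamma> p \<longleftrightarrow> ereal \<gamma> \<le> nc_radius p"

definition sot_value ::
    "('n::finite \<Rightarrow> 'n ncseries) \<Rightarrow> ('n \<Rightarrow> 'a::chilbert_space \<Rightarrow>\<^sub>L 'a) \<Rightarrow> ('n \<Rightarrow> 'a \<Rightarrow>\<^sub>L 'a) \<Rightarrow> bool"
  where "sot_value f X Y \<longleftrightarrow>
    (\<forall>j. limitin strong_operator_topology (\<lambda>N. \<Sum>k<N. nc_hom (f j) X k) (Y j) sequentially)"

definition rad_value ::
    "('n::finite \<Rightarrow> 'n ncseries) \<Rightarrow> ('n \<Rightarrow> 'a::chilbert_space \<Rightarrow>\<^sub>L 'a) \<Rightarrow> ('n \<Rightarrow> 'a \<Rightarrow>\<^sub>L 'a) \<Rightarrow> bool"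
  where "rad_value f X Y \<longleftrightarrow>
    (\<exists>\<delta>\<in>{0<..<1}. \<forall>r\<in>{\<delta><..<1}. \<forall>j. summable (\<lambda>k. nc_hom (f j) (\<lambda>i. r *\<^sub>R X i) k)) \<and>
    (\<forall>j. limitin strong_operator_topology (\<lambda>r. nc_eval (f j) (\<lambda>i. r *\<^sub>R X i)) (Y j) (at_left 1))"

definition conv_SOT :: "('n::finite \<Rightarrow> 'n ncseries) \<Rightarrow> ('n \<Rightarrow> 'a::chilbert_space \<Rightarrow>\<^sub>L 'a) set"
  where "conv_SOT f = {X. (\<forall>i. clinear_op (X i)) \<and> (\<exists>Y. sot_value f X Y)}"

definition conv_rad :: "('n::finite \<Rightarrow> 'n ncseries) \<Rightarrow> ('n \<Rightarrow> 'a::chilbert_space \<Rightarrow>\<^sub>L 'a) set"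
  where "conv_rad f = {X. (\<forall>i. clinear_op (X i)) \<and> (\<exists>Y. rad_value f X Y)}"

text \<open>If both limits exist, they agree by Abel's theorem.\<close>

definition tuple_value ::
    "('n::finite \<Rightarrow> 'n ncseries) \<Rightarrow> ('n \<Rightarrow> 'a::chilbert_space \<Rightarrow>\<^sub>L 'a) \<Rightarrow> 'n \<Rightarrow> 'a \<Rightarrow>\<^sub>L 'a"
  where "tuple_value f X = (THE Y. sot_value f X Y \<or> rad_value f X Y)"


section \<open>The Hardy space of a tuple and its universal model\<close>

text \<open>
  The three constructors select the space \<open>H\<^sup>2(f)\<close>: the completion of the polynomials, formal power
  series \<open>\<Sum> a\<^sub>\<alpha> f\<^sub>\<alpha>\<close>, or compositions \<open>G \<circ> f\<close> on the operator ball of radius \<open>\<gamma>\<close>. In each of them the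
  inner product is the one carried over from square-summable coefficient families, so the Hilbert
  space is represented by \<open>'n list ell2\<close>, in which \<open>ell2_unit \<alpha>\<close> stands for \<open>f\<^sub>\<alpha>\<close>. The relation
  \<open>hardy_element \<kappa> f p a\<close> states that the power series \<open>p\<close> is the element of \<open>H\<^sup>2(f)\<close> with coefficient
  family \<open>a\<close>. In the polynomial case it describes the embedding of the polynomials into their
  completion, so there it relates only finitely supported \<open>a\<close>.
\<close>

datatype model_kind = Polynomial | Formal | Free_Holomorphic real

fun hardy_element :: "model_kind \<Rightarrow> ('n::finite \<Rightarrow> 'n ncseries) \<Rightarrow> 'n ncseries \<Rightarrow> 'n list ell2 \<Rightarrow> bool"
  where
    "hardy_element Polynomial f p a \<longleftrightarrow> nc_polynomial (Rep_ell2 a) \<and> p = nc_comp (Rep_ell2 a) f"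
  | "hardy_element Formal f p a \<longleftrightarrow> p = nc_comp (Rep_ell2 a) f"
  | "hardy_element (Free_Holomorphic \<gamma>) f p a \<longleftrightarrow> free_holomorphic \<gamma> p \<and>
      (\<forall>X :: 'n \<Rightarrow> nat ell2 \<Rightarrow>\<^sub>L nat ell2. X \<in> op_ball \<gamma> \<longrightarrow>
        nc_eval p X = nc_eval (Rep_ell2 a) (\<lambda>j. nc_eval (f j) X))"

lemma hardy_element_unit:
  assumes "\<kappa> = Polynomial \<or> \<kappa> = Formal"
  shows "hardy_element \<kappa> f (nc_word f \<alpha>) (ell2_unit \<alpha>)"
proof -
  have "nc_comp (Rep_ell2 (ell2_unit \<alpha>)) f w = nc_word f \<alpha> w" for w
  proof -
    have "nc_comp (Rep_ell2 (ell2_unit \<alpha>)) f w =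
        (\<Sum>\<beta>\<in>{\<alpha>}. Rep_ell2 (ell2_unit \<alpha>) \<beta> * nc_word f \<beta> w)"
      unfolding nc_comp_def
      by (rule sum.mono_neutral_left) (auto simp: ell2_unit.rep_eq split: if_splits)
    then show ?thesis
      by (simp add: ell2_unit.rep_eq)
  qed
  moreover have "nc_polynomial (Rep_ell2 (ell2_unit \<alpha>))"
    by (simp add: nc_polynomial_def ell2_unit.rep_eq)
  ultimately show ?thesis
    using assms by (auto simp: fun_eq_iff)
qed

definition left_mult ::
    "model_kind \<Rightarrow> ('n::finite \<Rightarrow> 'n ncseries) \<Rightarrow> 'n ncseries \<Rightarrow> ('n list ell2 \<Rightarrow>\<^sub>L 'n list ell2) \<Rightarrow> bool"
  where "left_mult \<kappa> f p T \<longleftrightarrow> clinear_op T \<and>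
    (\<forall>q a. hardy_element \<kappa> f q a \<longrightarrow> hardy_element \<kappa> f (nc_mult p q) (T a))"

definition universal_model ::
    "model_kind \<Rightarrow> ('n::finite \<Rightarrow> 'n ncseries) \<Rightarrow> ('n \<Rightarrow> 'n list ell2 \<Rightarrow>\<^sub>L 'n list ell2) \<Rightarrow> bool"
  where "universal_model \<kappa> f M \<longleftrightarrow> (\<forall>i. left_mult \<kappa> f (nc_var i) (M i))"

text \<open>
  \<open>g\<^sub>i\<close> is the coefficient family of \<open>Z\<^sub>i\<close> with respect to \<open>(f\<^sub>\<alpha>)\<close>, read as a power series in the
  indeterminates.
\<close>

definition model_inverse ::
    "model_kind \<Rightarrow> ('n::finite \<Rightarrow> 'n ncseries) \<Rightarrow> ('n \<Rightarrow> 'n ncseries) \<Rightarrow> bool"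
  where "model_inverse \<kappa> f g \<longleftrightarrow>
    (\<forall>i. \<exists>a. hardy_element \<kappa> f (nc_var i) a \<and> g i = Rep_ell2 a)"

definition model_condition :: "model_kind \<Rightarrow> ('n::finite \<Rightarrow> 'n ncseries) \<Rightarrow> bool"
  where "model_condition \<kappa> f \<longleftrightarrow> (\<exists>g. model_inverse \<kappa> f g) \<and>
    (\<exists>M Y. universal_model \<kappa> f M \<and> (sot_value f M Y \<or> rad_value f M Y) \<and>
      (\<forall>j. left_mult \<kappa> f (f j) (Y j)))"

fun model_property :: "model_kind \<Rightarrow> ('n::finite \<Rightarrow> 'n ncseries) \<Rightarrow> bool"
  where
    "model_property Polynomial f \<longleftrightarrow> (\<forall>i. nc_polynomial (f i)) \<and>
      (\<exists>g. (\<forall>i. nc_polynomial (g i)) \<and>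
        (\<forall>i. nc_comp (f i) g = nc_var i) \<and> (\<forall>i. nc_comp (g i) f = nc_var i))"
  | "model_property Formal f \<longleftrightarrow> (\<forall>i. f i [] = 0) \<and> (\<forall>i. 0 < nc_radius (f i)) \<and>
      det (\<chi> i j. f i [j]) \<noteq> 0 \<and> model_condition Formal f"
  | "model_property (Free_Holomorphic \<gamma>) f \<longleftrightarrow> 0 < \<gamma> \<and> (\<forall>i. free_holomorphic \<gamma> (f i)) \<and>
      (\<forall>X :: 'n \<Rightarrow> nat ell2 \<Rightarrow>\<^sub>L nat ell2. X \<in> op_ball \<gamma> \<longrightarrow> (\<lambda>j. nc_eval (f j) X) \<in> op_ball 1) \<and>
      (\<forall>G. free_holomorphic 1 G \<and> G \<noteq> (\<lambda>_. 0) \<longrightarrow>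
        (\<exists>X :: 'n \<Rightarrow> nat ell2 \<Rightarrow>\<^sub>L nat ell2. X \<in> op_ball \<gamma> \<and> nc_eval G (\<lambda>j. nc_eval (f j) X) \<noteq> 0)) \<and>
      model_condition (Free_Holomorphic \<gamma>) f"


section \<open>The domain and its scalar points\<close>

text \<open>
  Here \<open>g\<close> is the inverse of \<open>f\<close>. If \<open>Y = f(X)\<close> has row norm less than \<open>1\<close>, the series of \<open>g\<close> converge in
  norm at \<open>rY\<close> for all \<open>r < 1\<close>, so \<open>rad_value g Y X\<close> amounts to the radial form of \<open>g(f(X)) = X\<close>.
\<close>

definition inverts :: "('n::finite \<Rightarrow> 'n ncseries) \<Rightarrow> ('n \<Rightarrow> 'n ncseries) \<Rightarrow>
    ('n \<Rightarrow> 'a::chilbert_space \<Rightarrow>\<^sub>L 'a) \<Rightarrow> bool"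
  where "inverts g f X \<longleftrightarrow> X \<in> conv_SOT f \<union> conv_rad f \<and>
    (sot_value g (tuple_value f X) X \<or> rad_value g (tuple_value f X) X)"

definition nc_domain :: "('n::finite \<Rightarrow> 'n ncseries) \<Rightarrow> ('n \<Rightarrow> 'n ncseries) \<Rightarrow>
    ('n \<Rightarrow> 'a::chilbert_space \<Rightarrow>\<^sub>L 'a) set"
  where "nc_domain f g = {X. inverts g f X \<and> row_norm (tuple_value f X) < 1}"

definition point_op :: "complex^'n \<Rightarrow> 'n \<Rightarrow> complex \<Rightarrow>\<^sub>L complex"
  where "point_op z i = scaleC_op (z $ i)"

definition scalar_domain :: "('n::finite \<Rightarrow> 'n ncseries) \<Rightarrow> ('n \<Rightarrow> 'n ncseries) \<Rightarrow> (complex^'n) set"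
  where "scalar_domain f g = {z. point_op z \<in> nc_domain f g}"

definition point_value :: "('n::finite \<Rightarrow> 'n ncseries) \<Rightarrow> complex^'n \<Rightarrow> 'n \<Rightarrow> complex"
  where "point_value f z i = tuple_value f (point_op z) i 1"

definition scalar_word :: "('n \<Rightarrow> complex) \<Rightarrow> 'n list \<Rightarrow> complex"
  where "scalar_word z \<alpha> = prod_list (map z \<alpha>)"

definition scalar_monomial :: "('n::finite \<Rightarrow> complex) \<Rightarrow> ('n \<Rightarrow> nat) \<Rightarrow> complex"
  where "scalar_monomial z k = (\<Prod>i\<in>UNIV. z i ^ k i)"


section \<open>The Hardy algebra and the commutator ideal\<close>

definition weak_operator_topology :: "('a::complex_inner \<Rightarrow>\<^sub>L 'a) topology"
  where "weak_operator_topology =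
    pullback_topology UNIV (\<lambda>T (x, y). cinner (blinfun_apply T x) y) euclidean"

definition op_polynomials :: "('n \<Rightarrow> 'a::complex_inner \<Rightarrow>\<^sub>L 'a) \<Rightarrow> ('a \<Rightarrow>\<^sub>L 'a) set"
  where "op_polynomials X =
    {\<Sum>\<alpha> | p \<alpha> \<noteq> 0. scaleC_op (p \<alpha>) o\<^sub>L op_word X \<alpha> | p. nc_polynomial p}"

definition hardy_algebra :: "('n \<Rightarrow> 'a::complex_inner \<Rightarrow>\<^sub>L 'a) \<Rightarrow> ('a \<Rightarrow>\<^sub>L 'a) set"
  where "hardy_algebra M = weak_operator_topology closure_of op_polynomials M"

definition wot_closed_ideal :: "('a::complex_inner \<Rightarrow>\<^sub>L 'a) set \<Rightarrow> ('a \<Rightarrow>\<^sub>L 'a) set \<Rightarrow> bool"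
  where "wot_closed_ideal A J \<longleftrightarrow> J \<subseteq> A \<and> closedin weak_operator_topology J \<and> 0 \<in> J \<and>
    (\<forall>S\<in>J. \<forall>T\<in>J. S + T \<in> J) \<and> (\<forall>c. \<forall>T\<in>J. scaleC_op c o\<^sub>L T \<in> J) \<and>
    (\<forall>S\<in>A. \<forall>T\<in>J. S o\<^sub>L T \<in> J \<and> T o\<^sub>L S \<in> J)"

definition commutator_ideal :: "('n \<Rightarrow> 'a::complex_inner \<Rightarrow>\<^sub>L 'a) \<Rightarrow> ('a \<Rightarrow>\<^sub>L 'a) set"
  where "commutator_ideal M =
    wot_closed_ideal (hardy_algebra M) hull {(M i o\<^sub>L M j) - (M j o\<^sub>L M i) | i j. True}"

definition orthogonal_complement :: "'a::complex_inner set \<Rightarrow> 'a set"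
  where "orthogonal_complement S = {x. \<forall>y\<in>S. cinner x y = 0}"

definition model_subspace :: "('n \<Rightarrow> 'n list ell2 \<Rightarrow>\<^sub>L 'n list ell2) \<Rightarrow> 'n list ell2 set"
  where "model_subspace M =
    orthogonal_complement (closure ((\<lambda>A. blinfun_apply A (ell2_unit [])) ` commutator_ideal M))"


section \<open>The symmetric Hardy space\<close>

definition sym_words :: "('n::finite \<Rightarrow> nat) \<Rightarrow> 'n list set"
  where "sym_words k = {\<alpha>. \<forall>z. scalar_word z \<alpha> = scalar_monomial z k}"

definition sym_card :: "('n::finite \<Rightarrow> nat) \<Rightarrow> real"
  where "sym_card k = real (card (sym_words k))"

definition sym_vector :: "('n::finite \<Rightarrow> nat) \<Rightarrow> 'n list ell2"
  where "sym_vector k = (1 / sym_card k) *\<^sub>R (\<Sum>\<alpha>\<in>sym_words k. ell2_unit \<alpha>)"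

definition sym_hardy :: "'n::finite list ell2 set"
  where "sym_hardy = closure (cspan (range sym_vector))"

definition point_gap :: "('n::finite \<Rightarrow> 'n ncseries) \<Rightarrow> complex^'n \<Rightarrow> real"
  where "point_gap f z = 1 - (\<Sum>i\<in>UNIV. (cmod (point_value f z i))\<^sup>2)"

definition Gamma_vector :: "('n::finite \<Rightarrow> 'n ncseries) \<Rightarrow> complex^'n \<Rightarrow> 'n list ell2"
  where "Gamma_vector f z = sqrt (point_gap f z) *\<^sub>R
    (\<Sum>\<^sub>\<infinity>\<alpha>. scalar_word (\<lambda>i. cnj (point_value f z i)) \<alpha> *\<^sub>C ell2_unit \<alpha>)"

definition Omega_vector :: "('n::finite \<Rightarrow> 'n ncseries) \<Rightarrow> complex^'n \<Rightarrow> 'n list ell2"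
  where "Omega_vector f z = (1 / sqrt (point_gap f z)) *\<^sub>R Gamma_vector f z"


section \<open>The function space on the scalar domain\<close>

text \<open>As with \<^const>\<open>holomorphic_on\<close>, the derivative is taken within the set and has to be complex linear.\<close>

definition several_holomorphic_on :: "(complex^'n \<Rightarrow> complex) \<Rightarrow> (complex^'n) set \<Rightarrow> bool"
  where "several_holomorphic_on \<psi> S \<longleftrightarrow>
    (\<forall>z\<in>S. \<exists>D. (\<forall>c v. D (c *s v) = c * D v) \<and> (\<psi> has_derivative D) (at z within S))"

definition series_representation :: "('n::finite \<Rightarrow> 'n ncseries) \<Rightarrow> ('n \<Rightarrow> 'n ncseries) \<Rightarrow>
    (complex^'n \<Rightarrow> complex) \<Rightarrow> (('n \<Rightarrow> nat) \<Rightarrow> complex) \<Rightarrow> bool"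
  where "series_representation f g \<psi> c \<longleftrightarrow>
    (\<lambda>k. (cmod (c k))\<^sup>2 / sym_card k) summable_on UNIV \<and>
    (\<forall>z\<in>scalar_domain f g. ((\<lambda>k. c k * scalar_monomial (point_value f z) k) has_sum \<psi> z) UNIV)"

text \<open>Functions on the scalar domain are represented by functions that are \<^const>\<open>undefined\<close> outside it.\<close>

definition domain_hardy :: "('n::finite \<Rightarrow> 'n ncseries) \<Rightarrow> ('n \<Rightarrow> 'n ncseries) \<Rightarrow>
    (complex^'n \<Rightarrow> complex) set"
  where "domain_hardy f g = {\<psi> \<in> extensional (scalar_domain f g).
    several_holomorphic_on \<psi> (scalar_domain f g) \<and> (\<exists>c. series_representation f g \<psi> c)}"

definition domain_hardy_norm :: "('n::finite \<Rightarrow> 'n ncseries) \<Rightarrow> ('n \<Rightarrow> 'n ncseries) \<Rightarrow>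
    (complex^'n \<Rightarrow> complex) \<Rightarrow> real"
  where "domain_hardy_norm f g \<psi> =
    sqrt (\<Sum>\<^sub>\<infinity>k. (cmod ((THE c. series_representation f g \<psi> c) k))\<^sup>2 / sym_card k)"

definition functional_representation :: "('n::finite \<Rightarrow> 'n ncseries) \<Rightarrow> ('n \<Rightarrow> 'n ncseries) \<Rightarrow>
    'n list ell2 \<Rightarrow> complex^'n \<Rightarrow> complex"
  where "functional_representation f g x = (\<lambda>z\<in>scalar_domain f g. cinner x (Omega_vector f z))"

text \<open>In the sense of reproducing kernels: all Gram matrices are positive semidefinite.\<close>

definition positive_definite_kernel :: "'b set \<Rightarrow> ('b \<Rightarrow> 'b \<Rightarrow> complex) \<Rightarrow> bool"
  where "positive_definite_kernel S K \<longleftrightarrow>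
    (\<forall>F c. finite F \<and> F \<subseteq> S \<longrightarrow> (\<Sum>x\<in>F. \<Sum>y\<in>F. cnj (c x) * c y * K x y) \<in> \<real>\<^sub>\<ge>\<^sub>0)"

end

theory Submission
  imports Defs "HOL-Library.Multiset"
begin

text \<open>
  On the Fock space spanned by the words \<open>f\<^sub>\<alpha>\<close>, the operator \<open>M\<^sub>i\<close> is left multiplication by the series \<open>g\<^sub>i\<close>
  and \<open>f\<^sub>j(M)\<close> is the left creation operator \<open>S\<^sub>j\<close>. The Szego vectors \<open>K\<^sub>l = \<Sum> cnj(l)\<^sub>\<alpha> f\<^sub>\<alpha>\<close>, for \<open>l\<close> in the
  open unit ball, are joint eigenvectors of the adjoints of the \<open>M\<^sub>i\<close> with eigenvalues \<open>cnj(g\<^sub>i(l))\<close>. Testing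
  \<open>f\<^sub>j(M) = S\<^sub>j\<close> against \<open>K\<^sub>l\<close> gives \<open>f(g(l)) = l\<close>, so \<open>g\<close> maps the ball bijectively onto the scalar domain,
  \<open>\<Omega>\<close> at \<open>g(l)\<close> is \<open>K\<^sub>l\<close>, and everything reduces to the ball. There, a square-summable family
  orthogonal to all \<open>K\<^sub>l\<close> is symmetrised to zero by the identity theorem, and orthogonality to
  \<open>J\<^sub>c(1)\<close>, which contains all \<open>S\<^sub>\<alpha>(S\<^sub>iS\<^sub>j - S\<^sub>jS\<^sub>i)S\<^sub>\<beta>1\<close>, forces symmetry under adjacent swaps. For holomorphy on
  the scalar domain one needs that \<open>f\<close> is differentiable there, i.e. that \<open>g'(l)\<close> is injective; this
  follows by differentiating \<open>l \<mapsto> \<langle>p(M)1, K\<^sub>l\<rangle> = p(g(l))\<close> and letting the polynomials \<open>p(M)\<close> tend to \<open>S\<^sub>j\<close>.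
\<close>


section \<open>Complex Hilbert spaces\<close>

text \<open>Three different spaces carry the name H^2(f), and the reduction to the Fock space rests
  on one fact in each case: an element determines its coefficients. It comes from the invertible
  Jacobian for formal series, from substituting the inverse tuple for polynomials, and from
  faithfulness of composition with f for free holomorphic functions. Afterwards only the data of the
  locale \<open>fock_model\<close> are used. The value f(M) is available in one of two modes, SOT
  sums or radial limits, so arguments about it are phrased as membership in an SOT-closed set
  containing the polynomials. At scalar points the two modes agree by Abel's theorem, which makes
  \<open>tuple_value\<close> well defined there. The ideal is generated by commutators of the M,
  while the shifts are only limits of polynomials in M; since composition is only separately
  WOT-continuous, reaching the commutators of the whole algebra takes two successive density
  arguments. Nothing is known in advance about openness of the scalar domain or regularity of f on
  it, so differentiability of f is recovered from that of g by an inverse function theorem.\<close>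

lemma cinner_add_right: "cinner x (y + z) = cinner x y + cinner x z"
  for x :: "'a::complex_inner"
  by (metis cinner_add_left cinner_commute complex_cnj_add)

lemma cinner_scaleC_right: "cinner x (c *\<^sub>C y) = cnj c * cinner x y"
  for x :: "'a::complex_inner"
  by (metis cinner_scaleC_left cinner_commute complex_cnj_mult)

lemma cinner_zero_left [simp]: "cinner 0 y = 0"
  for y :: "'a::complex_inner"
  by (metis add_cancel_right_left cinner_add_left)

lemma cinner_zero_right [simp]: "cinner x 0 = 0"
  for x :: "'a::complex_inner"
  by (metis cinner_commute cinner_zero_left complex_cnj_zero)

lemma cinner_minus_left: "cinner (- x) y = - cinner x y"
  for x :: "'a::complex_inner"
  by (metis add.right_inverse add_eq_0_iff cinner_add_left cinner_zero_left)

lemma cinner_diff_left: "cinner (x - y) z = cinner x z - cinner y z"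
  for x :: "'a::complex_inner"
  using cinner_add_left[of x "- y" z] by (simp add: cinner_minus_left)

lemma cinner_diff_right: "cinner x (y - z) = cinner x y - cinner x z"
  for x :: "'a::complex_inner"
  by (metis cinner_commute cinner_diff_left complex_cnj_diff)

lemma cinner_scaleR_left: "cinner (r *\<^sub>R x) y = complex_of_real r * cinner x y"
  for x :: "'a::complex_inner"
  by (simp add: scaleR_scaleC cinner_scaleC_left)

lemma cinner_scaleR_right: "cinner x (r *\<^sub>R y) = complex_of_real r * cinner x y"
  for x :: "'a::complex_inner"
  by (simp add: scaleR_scaleC cinner_scaleC_right)

lemma cinner_sum_left: "cinner (\<Sum>i\<in>A. f i) y = (\<Sum>i\<in>A. cinner (f i) y)"
  for y :: "'a::complex_inner"
  by (induction A rule: infinite_finite_induct) (simp_all add: cinner_add_left)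

lemma cinner_sum_right: "cinner x (\<Sum>i\<in>A. f i) = (\<Sum>i\<in>A. cinner x (f i))"
  for x :: "'a::complex_inner"
  by (induction A rule: infinite_finite_induct) (simp_all add: cinner_add_right)

lemma cinner_eq_0_sym: "cinner x y = 0 \<longleftrightarrow> cinner y x = 0"
  for x y :: "'a::complex_inner"
  by (metis cinner_commute complex_cnj_zero)

lemma cmod_cinner_le: "cmod (cinner x y) \<le> norm x * norm y"
  for x y :: "'a::complex_inner"
proof (cases "cinner x y = 0")
  case False
  \<comment> \<open>This phase turns \<open>cinner x y\<close> into its modulus, so that the real
    Cauchy-Schwarz inequality applies.\<close>
  define c where "c = cnj (cinner x y) / cmod (cinner x y)"
  have c: "cmod c = 1"
    using False by (simp add: c_def norm_divide)
  have "cinner (c *\<^sub>C x) y = complex_of_real (cmod (cinner x y))"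
    using False complex_norm_square[of "cinner x y"]
    by (simp add: c_def cinner_scaleC_left power2_eq_square field_simps)
  then have "cmod (cinner x y) = inner (c *\<^sub>C x) y"
    by (simp add: inner_cinner)
  also have "\<dots> \<le> norm (c *\<^sub>C x) * norm y"
    by (rule norm_cauchy_schwarz)
  finally show ?thesis
    by (simp add: norm_scaleC c)
qed simp

lemma bounded_linear_cinner_left: "bounded_linear (\<lambda>x::'a::complex_inner. cinner x y)"
  by (rule bounded_linear_intro[where K = "norm y"])
    (simp_all add: cinner_add_left cinner_scaleR_left cmod_cinner_le scaleR_conv_of_real)

lemma closed_cinner_eq_0: "closed {x :: 'a::complex_inner. cinner x y = 0}"
  by (rule closed_Collect_eq[OF linear_continuous_on[OF bounded_linear_cinner_left]
        continuous_on_const])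

section \<open>Closed subspaces, orthogonal projection and Riesz representation\<close>

lemma subspace_closure:
  fixes S :: "'a::complex_inner set"
  assumes "complex_vector.subspace S"
  shows "complex_vector.subspace (closure S)"
proof (rule complex_vector.subspaceI)
  show "0 \<in> closure S"
    using assms closure_subset complex_vector.subspace_0 by blast
next
  fix x y assume "x \<in> closure S" "y \<in> closure S"
  then obtain u v where uv: "\<And>n. u n \<in> S" "u \<longlonglongrightarrow> x" "\<And>n. v n \<in> S" "v \<longlonglongrightarrow> y"
    by (metis closure_sequential)
  have "(\<lambda>n. u n + v n) \<longlonglongrightarrow> x + y"
    by (intro tendsto_add uv(2,4))
  then show "x + y \<in> closure S"
    unfolding closure_sequential
    by (intro exI[of _ "\<lambda>n. u n + v n"] conjI allI complex_vector.subspace_add[OF assms] uv(1,3))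
next
  fix c x assume "x \<in> closure S"
  then obtain u where u: "\<And>n. u n \<in> S" "u \<longlonglongrightarrow> x"
    by (metis closure_sequential)
  have "(\<lambda>n. c *\<^sub>C u n) \<longlonglongrightarrow> c *\<^sub>C x"
    by (rule bounded_linear.tendsto[OF bounded_linear_scaleC u(2)])
  then show "c *\<^sub>C x \<in> closure S"
    unfolding closure_sequential
    by (intro exI[of _ "\<lambda>n. c *\<^sub>C u n"] conjI allI complex_vector.subspace_scale[OF assms] u(1))
qed

lemma subspace_closure_cspan: "complex_vector.subspace (closure (cspan S))"
  for S :: "'a::complex_inner set"
  by (intro subspace_closure complex_vector.subspace_span)

lemma closure_cspan_subset:
  fixes S V :: "'a::complex_inner set"
  assumes "S \<subseteq> V" "complex_vector.subspace V" "closed V"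
  shows "closure (cspan S) \<subseteq> V"
  by (intro closure_minimal complex_vector.span_minimal assms)

lemma subspace_scaleR:
  fixes V :: "'a::complex_inner set"
  assumes "complex_vector.subspace V" "x \<in> V"
  shows "r *\<^sub>R x \<in> V"
  using assms by (simp add: scaleR_scaleC complex_vector.subspace_scale)

text \<open>A sequence in \<open>V\<close> minimising the distance to \<open>x\<close> is Cauchy by
  the parallelogram law, and a first-order variation at its limit gives orthogonality.\<close>

lemma projection_exists:
  fixes V :: "'a::chilbert_space set"
  assumes sub: "complex_vector.subspace V" and "closed V"
  obtains v where "v \<in> V" "\<And>u. u \<in> V \<Longrightarrow> cinner (x - v) u = 0"
proof -
  define d where "d = infdist x V"
  have V0: "V \<noteq> {}"
    using sub complex_vector.subspace_0 by blast
  have d0: "0 \<le> d"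
    unfolding d_def by (rule infdist_nonneg)
  have dle: "d \<le> norm (x - v)" if "v \<in> V" for v
    using infdist_le[OF that, of x] by (simp add: d_def dist_norm)
  have "\<exists>v\<in>V. norm (x - v) < d + 1 / Suc n" for n
  proof (rule ccontr)
    assume "\<not> ?thesis"
    then have "d + 1 / Suc n \<le> infdist x V"
      unfolding infdist_notempty[OF V0]
      by (intro cINF_greatest V0) (auto simp: dist_norm not_less)
    then show False
      by (simp add: d_def field_simps)
  qed
  then obtain v where v: "\<And>n. v n \<in> V" "\<And>n. norm (x - v n) < d + 1 / Suc n"
    by metis
  have lim: "(\<lambda>n. norm (x - v n)) \<longlonglongrightarrow> d"
  proof (rule tendsto_sandwich[of "\<lambda>_. d" _ _ "\<lambda>n. d + 1 / Suc n"])
    show "(\<lambda>n. d + 1 / real (Suc n)) \<longlonglongrightarrow> d"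
      using tendsto_add[OF tendsto_const LIMSEQ_inverse_real_of_nat, of d]
      by (simp add: divide_inverse)
    show "\<forall>\<^sub>F n in sequentially. norm (x - v n) \<le> d + 1 / real (Suc n)"
      using v(2) by (intro always_eventually allI less_imp_le)
  qed (use dle v(1) in simp_all)
  \<comment> \<open>Parallelogram law for \<open>x - v m\<close> and \<open>x - v n\<close>: the
    midpoint of \<open>v m\<close> and \<open>v n\<close> lies in \<open>V\<close> and so has
    distance at least \<open>d\<close> from \<open>x\<close>.\<close>
  have par: "(norm (v m - v n))\<^sup>2 \<le> 2 * (norm (x - v m))\<^sup>2 + 2 * (norm (x - v n))\<^sup>2 - 4 * d\<^sup>2" for m n
  proof -
    have "(1/2) *\<^sub>R (v m + v n) \<in> V"
      by (intro subspace_scaleR complex_vector.subspace_add sub v)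
    then have "d\<^sup>2 \<le> (norm (x - (1/2) *\<^sub>R (v m + v n)))\<^sup>2"
      using d0 by (intro power_mono dle)
    also have "x - (1/2) *\<^sub>R (v m + v n) = (1/2) *\<^sub>R ((x - v m) + (x - v n))"
      by (simp add: algebra_simps flip: scaleR_2)
    finally have "4 * d\<^sup>2 \<le> (norm ((x - v m) + (x - v n)))\<^sup>2"
      by (simp add: power_divide)
    moreover have "(norm ((x - v m) + (x - v n)))\<^sup>2 + (norm (v m - v n))\<^sup>2
        = 2 * (norm (x - v m))\<^sup>2 + 2 * (norm (x - v n))\<^sup>2"
      by (simp add: power2_norm_eq_inner algebra_simps inner_commute)
    ultimately show ?thesis
      by simp
  qed
  have "Cauchy v"
  proof (rule metric_CauchyI)
    fix e :: real assume "0 < e"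
    have "(\<lambda>n. 2 * (norm (x - v n))\<^sup>2 - 2 * d\<^sup>2) \<longlonglongrightarrow> 2 * d\<^sup>2 - 2 * d\<^sup>2"
      by (intro tendsto_intros lim)
    then have "\<forall>\<^sub>F n in sequentially. 2 * (norm (x - v n))\<^sup>2 - 2 * d\<^sup>2 < e\<^sup>2 / 2"
      by (rule order_tendstoD) (use \<open>0 < e\<close> in simp)
    then obtain N where N: "\<And>n. n \<ge> N \<Longrightarrow> 2 * (norm (x - v n))\<^sup>2 - 2 * d\<^sup>2 < e\<^sup>2 / 2"
      by (auto simp: eventually_sequentially)
    have "dist (v m) (v n) < e" if "m \<ge> N" "n \<ge> N" for m n
    proof -
      have "(norm (v m - v n))\<^sup>2 < e\<^sup>2"
        using par[of m n] N[OF that(1)] N[OF that(2)] by linarith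
      then show ?thesis
        using \<open>0 < e\<close> by (simp add: dist_norm power_less_imp_less_base)
    qed
    then show "\<exists>N. \<forall>m\<ge>N. \<forall>n\<ge>N. dist (v m) (v n) < e"
      by blast
  qed
  then obtain w where w: "v \<longlonglongrightarrow> w"
    using Cauchy_convergent convergent_def by blast
  have wV: "w \<in> V"
    using \<open>closed V\<close> v(1) w closed_sequentially by blast
  have "(\<lambda>n. norm (x - v n)) \<longlonglongrightarrow> norm (x - w)"
    by (intro tendsto_intros w)
  then have nw: "norm (x - w) = d"
    using lim LIMSEQ_unique by blast
  have re: "inner (x - w) u = 0" if u: "u \<in> V" for u
  proof (cases "u = 0")
    case False
    \<comment> \<open>The minimiser of the quadratic polynomial that measures the squared distance
      from \<open>x\<close> to \<open>w + t *\<^sub>R u\<close>; any gain would contradict that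
      \<open>w\<close> is nearest.\<close>
    define t where "t = inner (x - w) u / (norm u)\<^sup>2"
    have "w + t *\<^sub>R u \<in> V"
      by (intro complex_vector.subspace_add subspace_scaleR sub wV u)
    then have "(norm (x - w))\<^sup>2 \<le> (norm ((x - w) - t *\<^sub>R u))\<^sup>2"
      using dle[of "w + t *\<^sub>R u"] nw d0 by (intro power_mono) (simp_all add: algebra_simps)
    also have "\<dots> = (norm (x - w))\<^sup>2 - 2 * t * inner (x - w) u + t\<^sup>2 * (norm u)\<^sup>2"
      unfolding power2_norm_eq_inner
      by (simp add: inner_diff_left inner_diff_right inner_commute power2_eq_square algebra_simps)
    also have "\<dots> = (norm (x - w))\<^sup>2 - (inner (x - w) u)\<^sup>2 / (norm u)\<^sup>2"
      using False by (simp add: t_def power2_eq_square field_simps)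
    finally have "(inner (x - w) u)\<^sup>2 / (norm u)\<^sup>2 \<le> 0"
      by simp
    then show ?thesis
      using False by (simp add: divide_le_0_iff)
  qed simp
  \<comment> \<open>The variation sees only the real inner product; the imaginary part comes from
    testing against \<i> times \<open>u\<close>, so it matters that \<open>V\<close> is a complex
    subspace.\<close>
  have "cinner (x - w) u = 0" if u: "u \<in> V" for u
  proof (rule complex_eqI)
    show "Re (cinner (x - w) u) = Re 0"
      using re[OF u] by (simp add: inner_cinner)
    have "inner (x - w) (\<i> *\<^sub>C u) = 0"
      by (intro re complex_vector.subspace_scale sub u)
    then show "Im (cinner (x - w) u) = Im 0"
      by (simp add: inner_cinner cinner_scaleC_right)
  qed
  with wV show ?thesis
    using that by blast
qed

text \<open>The residual of an element of \<open>W\<close> after projection to \<open>V\<close>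
  stays in \<open>W\<close> and is orthogonal to \<open>V\<close>. An equality of closed subspaces
  thereby becomes a uniqueness statement, which the identity theorem supplies for the Szego
  vectors.\<close>

lemma subspace_eq_of_orthogonal:
  fixes V W :: "'a::chilbert_space set"
  assumes "complex_vector.subspace V" "closed V" "complex_vector.subspace W" "V \<subseteq> W"
    and zero: "\<And>x. x \<in> W \<Longrightarrow> (\<And>v. v \<in> V \<Longrightarrow> cinner x v = 0) \<Longrightarrow> x = 0"
  shows "V = W"
proof (rule equalityI[OF \<open>V \<subseteq> W\<close>], rule subsetI)
  fix x assume x: "x \<in> W"
  obtain v where v: "v \<in> V" "\<And>u. u \<in> V \<Longrightarrow> cinner (x - v) u = 0"
    using projection_exists[OF assms(1,2)] by blast
  have "x - v \<in> W"
    using x v(1) assms by (meson complex_vector.subspace_diff subsetD)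
  then have "x - v = 0"
    using v(2) zero by blast
  then show "x \<in> V"
    using v(1) by simp
qed

text \<open>The kernel is a closed hyperplane; a vector \<open>p\<close> orthogonal to it represents
  the functional up to a scalar, because \<open>\<phi> x *\<^sub>C p - \<phi> p *\<^sub>C x\<close>
  lies in the kernel for every \<open>x\<close>.\<close>

lemma riesz_representation:
  fixes \<phi> :: "'a::chilbert_space \<Rightarrow> complex"
  assumes bl: "bounded_linear \<phi>" and cl: "\<And>c x. \<phi> (c *\<^sub>C x) = c * \<phi> x"
  obtains y where "\<And>x. \<phi> x = cinner x y"
proof (cases "\<forall>x. \<phi> x = 0")
  case True
  then show ?thesis
    using that[of 0] by simp
next
  case False
  interpret bounded_linear \<phi> by fact
  define V where "V = {x. \<phi> x = 0}"
  have "complex_vector.subspace V"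
    by (rule complex_vector.subspaceI) (simp_all add: V_def add cl zero)
  moreover have "closed V"
    unfolding V_def by (rule closed_Collect_eq[OF linear_continuous_on[OF bl] continuous_on_const])
  moreover obtain x0 where x0: "\<phi> x0 \<noteq> 0"
    using False by blast
  ultimately obtain v where v: "v \<in> V" "\<And>u. u \<in> V \<Longrightarrow> cinner (x0 - v) u = 0"
    using projection_exists by blast
  define p where "p = x0 - v"
  have p: "\<phi> p \<noteq> 0"
    using x0 v(1) by (simp add: p_def V_def diff)
  then have "p \<noteq> 0"
    using zero by auto
  then have pp: "cinner p p \<noteq> 0"
    by (simp add: cinner_self)
  show ?thesis
  proof
    fix x
    have "\<phi> x *\<^sub>C p - \<phi> p *\<^sub>C x \<in> V"
      by (simp add: V_def diff cl)
    then have "cinner p (\<phi> x *\<^sub>C p - \<phi> p *\<^sub>C x) = 0"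
      using v(2) by (simp add: p_def)
    then have "cinner (\<phi> x *\<^sub>C p - \<phi> p *\<^sub>C x) p = 0"
      using cinner_eq_0_sym by blast
    then have "\<phi> x * cinner p p = \<phi> p * cinner x p"
      by (simp add: cinner_diff_left cinner_scaleC_left)
    then show "\<phi> x = cinner x (cnj (\<phi> p / cinner p p) *\<^sub>C p)"
      using pp by (simp add: cinner_scaleC_right field_simps)
  qed
qed

text \<open>Weak continuity of composing with \<open>T\<close> on the left needs the adjoint only at
  one vector at a time, so no adjoint operator is constructed.\<close>

lemma adjoint_vector_exists:
  fixes T :: "'a::chilbert_space \<Rightarrow>\<^sub>L 'a"
  assumes "clinear_op T"
  obtains y' where "\<And>x. cinner (T x) y = cinner x y'"
proof -
  have "bounded_linear (\<lambda>x. cinner (T x) y)"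
    by (intro bounded_linear_compose[OF bounded_linear_cinner_left] blinfun.bounded_linear_right)
  moreover have "cinner (T (c *\<^sub>C x)) y = c * cinner (T x) y" for c x
    using assms by (simp add: clinear_op_def cinner_scaleC_left)
  ultimately show ?thesis
    by (rule riesz_representation[of "\<lambda>x. cinner (T x) y"]) (rule that)
qed


section \<open>Square-summable families\<close>

lemma ell2_eqI: "(\<And>i. Rep_ell2 x i = Rep_ell2 y i) \<Longrightarrow> x = y"
  by (simp add: Rep_ell2_inject[symmetric] fun_eq_iff)

lemma Rep_ell2_sum: "Rep_ell2 (\<Sum>a\<in>A. f a) i = (\<Sum>a\<in>A. Rep_ell2 (f a) i)"
  by (induction A rule: infinite_finite_induct)
    (simp_all add: zero_ell2.rep_eq plus_ell2.rep_eq)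

lemma bounded_linear_Rep_ell2: "bounded_linear (\<lambda>x. Rep_ell2 x i)"
  by (rule bounded_linear_intro[where K = 1])
    (simp_all add: plus_ell2.rep_eq scaleR_ell2.rep_eq scaleR_conv_of_real ell2_coord_le_norm)

lemma cinner_ell2_has_sum:
  "((\<lambda>i. Rep_ell2 x i * cnj (Rep_ell2 y i)) has_sum cinner x y) UNIV"
  by (simp add: cinner_ell2.rep_eq ell2_product_summable Rep_ell2_summable)

lemma norm_ell2_has_sum: "((\<lambda>i. (cmod (Rep_ell2 x i))\<^sup>2) has_sum (norm x)\<^sup>2) UNIV"
  by (simp add: norm_ell2_sum Rep_ell2_summable)

lemma cinner_ell2_unit_right: "cinner x (ell2_unit i) = Rep_ell2 x i"
proof -
  have "((\<lambda>j. Rep_ell2 x j * cnj (Rep_ell2 (ell2_unit i) j)) has_sum Rep_ell2 x i) UNIV"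
    by (rule has_sum_finite_neutralI[of "{i}"]) (auto simp: ell2_unit.rep_eq)
  then show ?thesis
    using cinner_ell2_has_sum has_sum_unique by blast
qed

text \<open>The squared error of a finite partial sum is the squared norm minus the squares already
  collected, and this tends to zero.\<close>

lemma ell2_has_sum: "((\<lambda>i. Rep_ell2 x i *\<^sub>C ell2_unit i) has_sum x) UNIV"
proof -
  let ?p = "\<lambda>F. \<Sum>i\<in>F. Rep_ell2 x i *\<^sub>C ell2_unit i"
  have Rep: "Rep_ell2 (?p F) i = (if i \<in> F then Rep_ell2 x i else 0)" if "finite F" for F i
    using that by (simp add: Rep_ell2_sum scaleC_ell2.rep_eq ell2_unit.rep_eq sum.delta if_distrib cong: if_cong)
  have eq: "(norm (?p F - x))\<^sup>2 = (norm x)\<^sup>2 - (\<Sum>i\<in>F. (cmod (Rep_ell2 x i))\<^sup>2)" if "finite F" for F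
  proof -
    have "((\<lambda>i. if i \<in> F then - (cmod (Rep_ell2 x i))\<^sup>2 else 0) has_sum
        (\<Sum>i\<in>F. - (cmod (Rep_ell2 x i))\<^sup>2)) UNIV"
      by (rule has_sum_finite_neutralI[of F]) (use that in auto)
    from has_sum_add[OF norm_ell2_has_sum[of x] this]
    have "((\<lambda>i. (cmod (Rep_ell2 (?p F - x) i))\<^sup>2) has_sum
        ((norm x)\<^sup>2 + (\<Sum>i\<in>F. - (cmod (Rep_ell2 x i))\<^sup>2))) UNIV"
      by (rule has_sum_cong[THEN iffD1, rotated])
        (auto simp: minus_ell2.rep_eq Rep[OF that] norm_minus_commute)
    from has_sum_unique[OF norm_ell2_has_sum this] show ?thesis
      by (simp add: sum_negf)
  qed
  have "((\<lambda>F. (norm x)\<^sup>2 - (\<Sum>i\<in>F. (cmod (Rep_ell2 x i))\<^sup>2)) \<longlongrightarrow> (norm x)\<^sup>2 - (norm x)\<^sup>2)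
      (finite_subsets_at_top UNIV)"
    using norm_ell2_has_sum[of x] unfolding has_sum_def by (intro tendsto_intros)
  moreover have "\<forall>\<^sub>F F in finite_subsets_at_top UNIV.
      (norm x)\<^sup>2 - (\<Sum>i\<in>F. (cmod (Rep_ell2 x i))\<^sup>2) = (norm (?p F - x))\<^sup>2"
    by (auto simp: eq intro!: eventually_finite_subsets_at_top_weakI)
  ultimately have "((\<lambda>F. (norm (?p F - x))\<^sup>2) \<longlongrightarrow> 0) (finite_subsets_at_top UNIV)"
    using Lim_transform_eventually by fastforce
  then have "((\<lambda>F. sqrt ((norm (?p F - x))\<^sup>2)) \<longlongrightarrow> sqrt 0) (finite_subsets_at_top UNIV)"
    by (rule tendsto_real_sqrt)
  then have "((\<lambda>F. norm (?p F - x)) \<longlongrightarrow> 0) (finite_subsets_at_top UNIV)"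
    by simp
  then show ?thesis
    unfolding has_sum_def by (simp add: tendsto_norm_zero_iff LIM_zero_iff)
qed

text \<open>The codomain is kept general so that the principle serves for operators as well as for
  functionals such as \<open>fock_eval\<close> and single coefficients.\<close>

lemma bounded_clinear_ell2_eqI:
  fixes \<phi> \<psi> :: "'i ell2 \<Rightarrow> 'b::complex_inner"
  assumes "bounded_linear \<phi>" "\<And>c x. \<phi> (c *\<^sub>C x) = c *\<^sub>C \<phi> x"
    and "bounded_linear \<psi>" "\<And>c x. \<psi> (c *\<^sub>C x) = c *\<^sub>C \<psi> x"
    and "\<And>i. \<phi> (ell2_unit i) = \<psi> (ell2_unit i)"
  shows "\<phi> x = \<psi> x"
proof -
  have "((\<lambda>i. Rep_ell2 x i *\<^sub>C \<phi> (ell2_unit i)) has_sum \<phi> x) UNIV"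
    using has_sum_bounded_linear[OF assms(1) ell2_has_sum[of x]] by (simp add: assms(2))
  moreover have "((\<lambda>i. Rep_ell2 x i *\<^sub>C \<phi> (ell2_unit i)) has_sum \<psi> x) UNIV"
    using has_sum_bounded_linear[OF assms(3) ell2_has_sum[of x]] by (simp add: assms(4,5))
  ultimately show ?thesis
    by (rule has_sum_unique)
qed

lemma clinear_op_ell2_eqI:
  fixes S T :: "'i ell2 \<Rightarrow>\<^sub>L 'b ell2"
  assumes "\<And>c x. S (c *\<^sub>C x) = c *\<^sub>C S x" "\<And>c x. T (c *\<^sub>C x) = c *\<^sub>C T x"
    and "\<And>i. S (ell2_unit i) = T (ell2_unit i)"
  shows "S = T"
  by (rule blinfun_eqI, rule bounded_clinear_ell2_eqI)
    (simp_all add: assms blinfun.bounded_linear_right)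


section \<open>Words and the backward shifts\<close>

text \<open>Every regrouping below is an instance: words by length, by letter counts or by Kronecker
  weight, and pairs of indices by total degree in a Cauchy product.\<close>

lemma has_sum_fibers:
  fixes h :: "'a \<Rightarrow> 'b::{topological_comm_monoid_add,t3_space}"
  assumes "(h has_sum s) UNIV" "\<And>k. finite {a. \<phi> a = k}"
  shows "((\<lambda>k. \<Sum>a | \<phi> a = k. h a) has_sum s) UNIV"
proof (rule has_sum_SigmaD)
  have "bij_betw snd (SIGMA k:UNIV. {a. \<phi> a = k}) UNIV"
    by (rule bij_betwI[where g = "\<lambda>a. (\<phi> a, a)"]) auto
  from has_sum_reindex_bij_betw[OF this, of h]
  show "((\<lambda>(k, a). h a) has_sum s) (SIGMA k:UNIV. {a. \<phi> a = k})"
    using assms(1) by (simp add: case_prod_unfold)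
qed (auto intro!: has_sum_finiteI simp: assms(2))

lemma finite_words_length: "finite {\<alpha> :: 'n::finite list. length \<alpha> = m}"
  using finite_lists_length_eq[of "UNIV :: 'n set" m] by simp

lemma sum_words_Suc:
  "(\<Sum>\<alpha> | length \<alpha> = Suc m. h \<alpha>) = (\<Sum>i\<in>UNIV. \<Sum>\<beta> | length \<beta> = m. h (i # \<beta>))"
  for h :: "'n::finite list \<Rightarrow> 'a::comm_monoid_add"
proof -
  have "{\<alpha> :: 'n list. length \<alpha> = Suc m} = (\<lambda>(i, \<beta>). i # \<beta>) ` (UNIV \<times> {\<beta>. length \<beta> = m})"
    by (auto simp: length_Suc_conv image_iff)
  then have "(\<Sum>\<alpha> | length \<alpha> = Suc m. h \<alpha>) = (\<Sum>(i, \<beta>)\<in>UNIV \<times> {\<beta>. length \<beta> = m}. h (i # \<beta>))"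
    by (simp add: sum.reindex inj_on_def case_prod_unfold)
  then show ?thesis
    by (simp add: sum.cartesian_product)
qed

lemma summable_on_Cons:
  fixes h :: "'n list \<Rightarrow> 'a::banach"
  assumes "h summable_on UNIV"
  shows "(\<lambda>\<beta>. h (i # \<beta>)) summable_on UNIV"
proof -
  have "h summable_on range ((#) i)"
    using summable_on_subset_banach[OF assms] by simp
  then show ?thesis
    by (subst (asm) summable_on_reindex) (auto simp: inj_on_def o_def)
qed

text \<open>A nonempty word has a unique first letter. This self-similarity of the free semigroup
  yields the norm identity for the backward shifts and the closed form of the Szego kernel.\<close>

lemma infsum_words_unfold:
  fixes h :: "'n::finite list \<Rightarrow> 'a::banach"
  assumes "h summable_on UNIV"
  shows "infsum h UNIV = h [] + (\<Sum>i\<in>UNIV. \<Sum>\<^sub>\<infinity>\<beta>. h (i # \<beta>))"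
proof -
  have part: "(h has_sum (\<Sum>\<^sub>\<infinity>\<beta>. h (i # \<beta>))) (range ((#) i))" for i
    by (subst has_sum_reindex) (auto simp: inj_on_def o_def summable_on_Cons[OF assms])
  have "(h has_sum (\<Sum>i\<in>UNIV. \<Sum>\<^sub>\<infinity>\<beta>. h (i # \<beta>))) (\<Union>i\<in>UNIV. range ((#) i))"
    by (intro sum_has_sum) (auto simp: part)
  moreover have "(h has_sum h []) {[]}"
    by (rule has_sum_finiteI) auto
  ultimately have "(h has_sum (h [] + (\<Sum>i\<in>UNIV. \<Sum>\<^sub>\<infinity>\<beta>. h (i # \<beta>)))) ({[]} \<union> (\<Union>i\<in>UNIV. range ((#) i)))"
    by (intro has_sum_Un_disjoint) auto
  moreover have "{[]} \<union> (\<Union>i::'n. range ((#) i)) = UNIV"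
    by (auto simp: image_iff) (metis list.exhaust)
  ultimately show ?thesis
    by (simp add: infsumI)
qed

text \<open>The adjoint of the left creation operator of the letter \<open>i\<close>.\<close>

lift_definition back_shift :: "'n \<Rightarrow> 'n list ell2 \<Rightarrow> 'n list ell2" is "\<lambda>i x \<beta>. x (i # \<beta>)"
  by (rule summable_on_Cons)

lemma back_shift_add: "back_shift i (x + y) = back_shift i x + back_shift i y"
  by transfer simp

lemma back_shift_scaleC: "back_shift i (c *\<^sub>C x) = c *\<^sub>C back_shift i x"
  by transfer simp

lemma back_shift_diff: "back_shift i (x - y) = back_shift i x - back_shift i y"
  by transfer simp

text \<open>The column of backward shifts is a contraction, and what it loses is the constant term.
  This is what bounds \<open>shift_comb l\<close> by \<open>norm l\<close>.\<close>

lemma norm_back_shift_sum: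
  "(norm x)\<^sup>2 = (cmod (Rep_ell2 x []))\<^sup>2 + (\<Sum>i\<in>UNIV. (norm (back_shift i x))\<^sup>2)"
  for x :: "'n::finite list ell2"
  unfolding norm_ell2_sum back_shift.rep_eq
  by (rule infsum_words_unfold[OF Rep_ell2_summable])


section \<open>The Szego kernel of the ball\<close>

lemma scalar_word_Nil [simp]: "scalar_word z [] = 1"
  by (simp add: scalar_word_def)

lemma scalar_word_Cons [simp]: "scalar_word z (i # \<alpha>) = z i * scalar_word z \<alpha>"
  by (simp add: scalar_word_def)

lemma scalar_word_append: "scalar_word z (\<alpha> @ \<beta>) = scalar_word z \<alpha> * scalar_word z \<beta>"
  by (simp add: scalar_word_def)

lemma cnj_scalar_word: "cnj (scalar_word z \<alpha>) = scalar_word (\<lambda>i. cnj (z i)) \<alpha>"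
  by (induction \<alpha>) simp_all

lemma norm_vec_sum: "(norm l)\<^sup>2 = (\<Sum>i\<in>UNIV. (norm (l $ i))\<^sup>2)"
  for l :: "'a::real_normed_vector^'n"
  by (simp add: norm_vec_def L2_set_def sum_nonneg)

lemma sum_scalar_word_length:
  "(\<Sum>\<alpha> | length \<alpha> = m. (cmod (scalar_word (($) l) \<alpha>))\<^sup>2) = ((norm l)\<^sup>2) ^ m"
  for l :: "complex^'n"
proof (induction m)
  case (Suc m)
  then show ?case
    by (simp add: sum_words_Suc norm_mult power_mult_distrib norm_vec_sum sum_distrib_right
        flip: sum_distrib_left)
qed simp

text \<open>The words of length m contribute the m-th power of the squared norm of \<open>l\<close>,
  so every finite set of words is dominated by a geometric series; here the ball has to be
  open.\<close>

lemma scalar_word_summable: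
  fixes l :: "complex^'n"
  assumes "norm l < 1"
  shows "(\<lambda>\<alpha>. (cmod (scalar_word (($) l) \<alpha>))\<^sup>2) summable_on UNIV"
proof (rule nonneg_bdd_above_summable_on)
  show "bdd_above (sum (\<lambda>\<alpha>. (cmod (scalar_word (($) l) \<alpha>))\<^sup>2) ` {F. F \<subseteq> UNIV \<and> finite F})"
  proof (rule bdd_aboveI2)
    fix F :: "'n list set" assume "F \<in> {F. F \<subseteq> UNIV \<and> finite F}"
    then have F: "finite F" by simp
    define N where "N = Max (length ` F)"
    have "length \<alpha> \<le> N" if "\<alpha> \<in> F" for \<alpha>
      unfolding N_def using F that by (intro Max_ge) auto
    then have sub: "F \<subseteq> (\<Union>m\<in>{..N}. {\<alpha>. length \<alpha> = m})"
      by auto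
    have "(\<Sum>\<alpha>\<in>F. (cmod (scalar_word (($) l) \<alpha>))\<^sup>2)
        \<le> (\<Sum>\<alpha>\<in>(\<Union>m\<in>{..N}. {\<alpha>. length \<alpha> = m}). (cmod (scalar_word (($) l) \<alpha>))\<^sup>2)"
      by (rule sum_mono2) (use sub in \<open>auto simp: finite_words_length\<close>)
    also have "\<dots> = (\<Sum>m\<le>N. ((norm l)\<^sup>2) ^ m)"
      by (subst sum.UNION_disjoint) (auto simp: finite_words_length sum_scalar_word_length)
    also have "\<dots> \<le> (\<Sum>m. ((norm l)\<^sup>2) ^ m)"
      using assms by (intro sum_le_suminf summable_geometric) (auto simp: power_less_one_iff abs_square_less_1)
    finally show "(\<Sum>\<alpha>\<in>F. (cmod (scalar_word (($) l) \<alpha>))\<^sup>2) \<le> (\<Sum>m. ((norm l)\<^sup>2) ^ m)" .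
  qed
qed simp

text \<open>The conjugation makes pairing with this vector on the right the evaluation of a family
  at the commuting point \<open>l\<close>. For \<open>l\<close> outside the open ball the
  coefficients are not square-summable and the value is unspecified.\<close>

definition szego_vector :: "complex^'n \<Rightarrow> 'n list ell2"
  where "szego_vector l = Abs_ell2 (\<lambda>\<alpha>. cnj (scalar_word (($) l) \<alpha>))"

definition fock_eval :: "complex^'n \<Rightarrow> 'n list ell2 \<Rightarrow> complex"
  where "fock_eval l x = cinner x (szego_vector l)"

lemma Rep_szego_vector:
  "norm l < 1 \<Longrightarrow> Rep_ell2 (szego_vector l) \<alpha> = cnj (scalar_word (($) l) \<alpha>)"
  unfolding szego_vector_def by (subst Abs_ell2_inverse) (simp_all add: scalar_word_summable)

lemma fock_eval_has_sum:
  "norm l < 1 \<Longrightarrow> ((\<lambda>\<alpha>. Rep_ell2 x \<alpha> * scalar_word (($) l) \<alpha>) has_sum fock_eval l x) UNIV"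
  using cinner_ell2_has_sum[of x "szego_vector l"] by (simp add: Rep_szego_vector fock_eval_def)

lemma fock_eval_unit: "norm l < 1 \<Longrightarrow> fock_eval l (ell2_unit \<alpha>) = scalar_word (($) l) \<alpha>"
  unfolding fock_eval_def
  by (subst cinner_commute) (simp add: cinner_ell2_unit_right Rep_szego_vector)

lemma fock_eval_add: "fock_eval l (x + y) = fock_eval l x + fock_eval l y"
  by (simp add: fock_eval_def cinner_add_left)

lemma fock_eval_scaleC: "fock_eval l (c *\<^sub>C x) = c * fock_eval l x"
  by (simp add: fock_eval_def cinner_scaleC_left)

lemma fock_eval_diff: "fock_eval l (x - y) = fock_eval l x - fock_eval l y"
  by (simp add: fock_eval_def cinner_diff_left)

lemma fock_eval_sum: "fock_eval l (\<Sum>i\<in>A. f i) = (\<Sum>i\<in>A. fock_eval l (f i))"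
  by (simp add: fock_eval_def cinner_sum_left)

lemma bounded_linear_fock_eval: "bounded_linear (fock_eval l)"
  unfolding fock_eval_def by (rule bounded_linear_cinner_left)

lemma fock_eval_unfold:
  assumes "norm l < 1"
  shows "fock_eval l x = Rep_ell2 x [] + (\<Sum>i\<in>UNIV. l $ i * fock_eval l (back_shift i x))"
proof -
  let ?h = "\<lambda>\<alpha>. Rep_ell2 x \<alpha> * scalar_word (($) l) \<alpha>"
  have "infsum ?h UNIV = ?h [] + (\<Sum>i\<in>UNIV. \<Sum>\<^sub>\<infinity>\<beta>. ?h (i # \<beta>))"
    using fock_eval_has_sum[OF assms] by (intro infsum_words_unfold has_sum_imp_summable)
  moreover have "(\<Sum>\<^sub>\<infinity>\<beta>. ?h (i # \<beta>)) = l $ i * fock_eval l (back_shift i x)" for i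
  proof -
    have "((\<lambda>\<beta>. l $ i * (Rep_ell2 (back_shift i x) \<beta> * scalar_word (($) l) \<beta>)) has_sum
        l $ i * fock_eval l (back_shift i x)) UNIV"
      by (intro has_sum_cmult_right fock_eval_has_sum assms)
    then show ?thesis
      by (intro infsumI) (simp add: back_shift.rep_eq mult_ac)
  qed
  ultimately show ?thesis
    using infsumI[OF fock_eval_has_sum[OF assms]] by simp
qed

lemma fock_eval_sums:
  assumes "norm l < 1"
  shows "(\<lambda>m. \<Sum>\<alpha> | length \<alpha> = m. Rep_ell2 x \<alpha> * scalar_word (($) l) \<alpha>) sums fock_eval l x"
  by (intro has_sum_imp_sums has_sum_fibers fock_eval_has_sum assms finite_words_length)

lemma cinner_szego_vector:
  assumes "norm z < 1" "norm w < 1"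
  shows "cinner (szego_vector z) (szego_vector w) = 1 / (1 - (\<Sum>i\<in>UNIV. w $ i * cnj (z $ i)))"
proof -
  \<comment> \<open>The Szego vector is a joint eigenvector of the backward shifts, so splitting off
    the first letter gives a linear equation for the kernel.\<close>
  have "back_shift i (szego_vector z) = cnj (z $ i) *\<^sub>C szego_vector z" for i
    by (rule ell2_eqI) (simp add: back_shift.rep_eq Rep_szego_vector assms scaleC_ell2.rep_eq)
  then have "fock_eval w (szego_vector z) =
      1 + (\<Sum>i\<in>UNIV. w $ i * cnj (z $ i)) * fock_eval w (szego_vector z)"
    by (subst fock_eval_unfold[OF assms(2)])
      (simp add: Rep_szego_vector assms fock_eval_scaleC sum_distrib_right mult.assoc)
  \<comment> \<open>That this product is 1 already shows the denominator to be nonzero.\<close>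
  then have "fock_eval w (szego_vector z) * (1 - (\<Sum>i\<in>UNIV. w $ i * cnj (z $ i))) = 1"
    by (simp add: algebra_simps)
  then show ?thesis
    unfolding fock_eval_def by (metis mult_zero_right nonzero_eq_divide_eq zero_neq_one)
qed

lemma norm_szego_vector:
  assumes "norm z < 1"
  shows "norm (szego_vector z) = 1 / sqrt (1 - (norm z)\<^sup>2)"
proof -
  have "complex_of_real ((norm (szego_vector z))\<^sup>2) = complex_of_real (1 / (1 - (norm z)\<^sup>2))"
    unfolding cinner_self[symmetric] cinner_szego_vector[OF assms assms]
    by (simp add: norm_vec_sum complex_norm_square del: of_real_power)
  then have "(norm (szego_vector z))\<^sup>2 = 1 / (1 - (norm z)\<^sup>2)"
    by (simp only: of_real_eq_iff)
  then have "sqrt ((norm (szego_vector z))\<^sup>2) = sqrt (1 / (1 - (norm z)\<^sup>2))"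
    by simp
  then show ?thesis
    by (simp add: real_sqrt_divide)
qed

lemma cmod_fock_eval_le: "norm l < 1 \<Longrightarrow> cmod (fock_eval l x) \<le> norm x / sqrt (1 - (norm l)\<^sup>2)"
  using cmod_cinner_le[of x "szego_vector l"] by (simp add: fock_eval_def norm_szego_vector)


section \<open>Holomorphy on the ball\<close>

definition shift_comb :: "complex^'n \<Rightarrow> 'n list ell2 \<Rightarrow> 'n list ell2"
  where "shift_comb l x = (\<Sum>i\<in>UNIV. (l $ i) *\<^sub>C back_shift i x)"

lemma shift_comb_diff: "shift_comb l (x - y) = shift_comb l x - shift_comb l y"
  by (simp add: shift_comb_def back_shift_diff complex_vector.scale_right_diff_distrib sum_subtractf)

lemma shift_comb_add: "shift_comb l (x + y) = shift_comb l x + shift_comb l y"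
  by (simp add: shift_comb_def back_shift_add scaleC_add_right sum.distrib)

lemma shift_comb_scaleC: "shift_comb l (c *\<^sub>C x) = c *\<^sub>C shift_comb l x"
  by (simp add: shift_comb_def back_shift_scaleC scaleC_scaleC mult.commute
      complex_vector.scale_sum_right)

lemma norm_back_shift_le: "norm (back_shift i x) \<le> norm x"
  for x :: "'n::finite list ell2"
proof -
  have "(norm (back_shift i x))\<^sup>2 \<le> (\<Sum>i\<in>UNIV. (norm (back_shift i x))\<^sup>2)"
    by (rule member_le_sum) auto
  also have "\<dots> \<le> (norm x)\<^sup>2"
    using norm_back_shift_sum[of x] by simp
  finally show ?thesis
    by (simp add: power2_le_iff_abs_le)
qed

lemma norm_shift_comb_le: "norm (shift_comb l x) \<le> norm l * norm x"
proof -
  have "norm (shift_comb l x) \<le> (\<Sum>i\<in>UNIV. \<bar>norm (l $ i)\<bar> * \<bar>norm (back_shift i x)\<bar>)"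
    unfolding shift_comb_def by (rule order_trans[OF norm_sum]) (simp add: norm_scaleC)
  also have "\<dots> \<le> L2_set (\<lambda>i. norm (l $ i)) UNIV * L2_set (\<lambda>i. norm (back_shift i x)) UNIV"
    by (rule L2_set_mult_ineq)
  also have "L2_set (\<lambda>i. norm (back_shift i x)) UNIV \<le> norm x"
    unfolding L2_set_def using norm_back_shift_sum[of x] by (intro real_le_lsqrt) (auto intro: sum_nonneg)
  finally show ?thesis
    by (simp add: norm_vec_def mult_left_mono)
qed

text \<open>The fixed point is the inverse of the identity minus \<open>shift_comb l\<close>,
  applied to \<open>x\<close>; the contraction constant \<open>norm l\<close> is less than
  1.\<close>

lemma resolvent_exists:
  fixes x :: "'n::finite list ell2"
  assumes "norm l < 1"
  shows "\<exists>!w. w = x + shift_comb l w"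
proof -
  have "\<forall>v w. dist (x + shift_comb l v) (x + shift_comb l w) \<le> norm l * dist v w"
    using norm_shift_comb_le[of l] by (simp add: dist_norm flip: shift_comb_diff)
  from banach_fix_type[OF _ assms this] show ?thesis
    by (metis norm_ge_zero)
qed

definition resolvent :: "complex^'n \<Rightarrow> 'n list ell2 \<Rightarrow> 'n list ell2"
  where "resolvent l x = (THE w. w = x + shift_comb l w)"

lemma resolvent_eq: "norm l < 1 \<Longrightarrow> resolvent l x = x + shift_comb l (resolvent l x)"
  unfolding resolvent_def by (rule theI') (rule resolvent_exists)

lemma resolvent_unique: "norm l < 1 \<Longrightarrow> w = x + shift_comb l w \<Longrightarrow> resolvent l x = w"
  using resolvent_exists[of l x] resolvent_eq[of l x] by auto

lemma bounded_linear_resolvent: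
  fixes l :: "complex^'n"
  assumes l: "norm l < 1"
  shows "bounded_linear (resolvent l)"
proof (rule bounded_linear_intro[where K = "1 / (1 - norm l)"])
  note eq = resolvent_eq[OF l]
  fix x y :: "'n list ell2" and r :: real
  show "resolvent l (x + y) = resolvent l x + resolvent l y"
    by (rule resolvent_unique[OF l], rule trans[OF arg_cong2[of _ _ _ _ "(+)", OF eq[of x] eq[of y]]])
      (simp only: shift_comb_add ac_simps)
  show "resolvent l (r *\<^sub>R x) = r *\<^sub>R resolvent l x"
    by (rule resolvent_unique[OF l], rule trans[OF arg_cong[of _ _ "(*\<^sub>R) r", OF eq[of x]]])
      (simp only: scaleR_scaleC shift_comb_scaleC scaleC_add_right)
  have "norm (resolvent l x) \<le> norm x + norm (shift_comb l (resolvent l x))"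
    by (subst eq) (rule norm_triangle_ineq)
  also have "\<dots> \<le> norm x + norm l * norm (resolvent l x)"
    by (simp add: norm_shift_comb_le)
  finally show "norm (resolvent l x) \<le> norm x * (1 / (1 - norm l))"
    using l by (simp add: field_simps)
qed

text \<open>Gleason's problem on the ball, solved by the resolvent of the backward shifts.\<close>

lemma fock_eval_difference:
  assumes "norm l < 1" "norm m < 1"
  shows "fock_eval m x - fock_eval l x =
    (\<Sum>i\<in>UNIV. (m - l) $ i * fock_eval m (back_shift i (resolvent l x)))"
proof -
  let ?w = "resolvent l x"
  \<comment> \<open>The resolvent is taken at \<open>l\<close> while \<open>n\<close> is free: for
    \<open>n = l\<close> the linear terms vanish, for \<open>n = m\<close> they are the claimed
    difference.\<close>
  have *: "fock_eval n x = Rep_ell2 ?w [] + (\<Sum>i\<in>UNIV. (n - l) $ i * fock_eval n (back_shift i ?w))"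
    if "norm n < 1" for n
  proof -
    have "x = ?w - shift_comb l ?w"
      using resolvent_eq[OF assms(1), of x] by (simp add: algebra_simps)
    then have "fock_eval n x = fock_eval n ?w - (\<Sum>i\<in>UNIV. l $ i * fock_eval n (back_shift i ?w))"
      by (metis (no_types, lifting) fock_eval_diff fock_eval_scaleC fock_eval_sum shift_comb_def sum.cong)
    then show ?thesis
      by (subst (asm) fock_eval_unfold[OF that, of ?w]) (simp add: algebra_simps sum_subtractf)
  qed
  show ?thesis
    using *[OF assms(1)] *[OF assms(2)] by simp
qed

section \<open>Continuity and differentiability in the evaluation point\<close>

lemma eventually_norm_less:
  fixes l :: "'a::real_normed_vector"
  assumes "norm l < r"
  shows "\<forall>\<^sub>F m in at l. norm m < r"
proof -
  have "((\<lambda>m. norm m) \<longlongrightarrow> norm l) (at l)"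
    by (intro tendsto_intros)
  then show ?thesis
    using assms by (rule order_tendstoD)
qed

lemma fock_eval_tendsto:
  fixes l :: "complex^'n"
  assumes l: "norm l < 1"
  shows "((\<lambda>m. fock_eval m x) \<longlongrightarrow> fock_eval l x) (at l)"
proof -
  \<comment> \<open>A radius strictly between \<open>norm l\<close> and 1 bounds the norms of the
    Szego vectors uniformly near \<open>l\<close>.\<close>
  obtain r where r: "norm l < r" "r < 1"
    using dense l by blast
  define C where "C = (\<Sum>i\<in>UNIV. norm (back_shift i (resolvent l x)) / sqrt (1 - r\<^sup>2))"
  have r0: "0 < r"
    using r norm_ge_zero[of l] by linarith
  have "\<forall>\<^sub>F m in at l. norm (fock_eval m x - fock_eval l x) \<le> norm (m - l) * C"
    using eventually_norm_less[OF r(1)]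
  proof eventually_elim
    case (elim m)
    then have m: "norm m < 1"
      using r by linarith
    have "(norm m)\<^sup>2 \<le> r\<^sup>2" and r2: "r\<^sup>2 < 1"
      using elim r r0 by (auto intro!: power_mono simp: abs_square_less_1)
    then have sq: "sqrt (1 - r\<^sup>2) \<le> sqrt (1 - (norm m)\<^sup>2)" "0 < sqrt (1 - r\<^sup>2)"
      by auto
    have "cmod ((m - l) $ i * fock_eval m (back_shift i (resolvent l x)))
        \<le> norm (m - l) * (norm (back_shift i (resolvent l x)) / sqrt (1 - r\<^sup>2))" for i
      unfolding norm_mult
    proof (rule mult_mono)
      have "cmod (fock_eval m (back_shift i (resolvent l x)))
          \<le> norm (back_shift i (resolvent l x)) / sqrt (1 - (norm m)\<^sup>2)"
        by (rule cmod_fock_eval_le[OF m])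
      also have "\<dots> \<le> norm (back_shift i (resolvent l x)) / sqrt (1 - r\<^sup>2)"
        using sq by (intro divide_left_mono) auto
      finally show "cmod (fock_eval m (back_shift i (resolvent l x)))
          \<le> norm (back_shift i (resolvent l x)) / sqrt (1 - r\<^sup>2)" .
    qed (use Finite_Cartesian_Product.norm_nth_le in blast, simp_all)
    then show ?case
      unfolding fock_eval_difference[OF l m] C_def sum_distrib_left by (rule sum_norm_le)
  qed
  moreover have "((\<lambda>m. norm (m - l) * C) \<longlongrightarrow> 0) (at l)"
    by (auto intro!: tendsto_eq_intros)
  ultimately have "((\<lambda>m. fock_eval m x - fock_eval l x) \<longlongrightarrow> 0) (at l)"
    by (rule Lim_null_comparison)
  then show ?thesis
    by (simp add: LIM_zero_iff)
qed

text \<open>The difference formula with its moving evaluation point frozen at \<open>l\<close>.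
  Having \<open>x\<close> as the last argument stresses that the derivative is a bounded functional
  of \<open>x\<close>, through which strong limits of operators can be taken.\<close>

definition fock_deriv :: "complex^'n \<Rightarrow> complex^'n \<Rightarrow> 'n list ell2 \<Rightarrow> complex"
  where "fock_deriv l h x = (\<Sum>i\<in>UNIV. h $ i * fock_eval l (back_shift i (resolvent l x)))"

lemma bounded_linear_back_shift: "bounded_linear (back_shift i)"
  for i :: "'n::finite"
  by (rule bounded_linear_intro[where K = 1])
    (simp_all add: back_shift_add scaleR_scaleC back_shift_scaleC norm_back_shift_le)

lemma bounded_linear_fock_deriv:
  assumes "norm l < 1"
  shows "bounded_linear (fock_deriv l h)"
  unfolding fock_deriv_def
  by (intro bounded_linear_sum bounded_linear_const_mult bounded_linear_resolvent assms
      bounded_linear_compose[OF bounded_linear_fock_eval]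
      bounded_linear_compose[OF bounded_linear_back_shift])

lemma fock_deriv_scale: "fock_deriv l (c *s h) x = c * fock_deriv l h x"
  by (simp add: fock_deriv_def sum_distrib_left mult.assoc)

text \<open>The remainder is a combination of differences of \<open>fock_eval\<close> at
  \<open>m\<close> and \<open>l\<close>, with coefficients bounded by \<open>norm (m - l)\<close>;
  continuity in the point therefore suffices.\<close>

lemma fock_eval_has_derivative:
  fixes l :: "complex^'n"
  assumes l: "norm l < 1"
  shows "((\<lambda>m. fock_eval m x) has_derivative (\<lambda>h. fock_deriv l h x)) (at l)"
  unfolding has_derivative_iff_norm
proof
  let ?v = "\<lambda>i. back_shift i (resolvent l x)"
  show "bounded_linear (\<lambda>h. fock_deriv l h x)"
    unfolding fock_deriv_def
    by (intro bounded_linear_sum bounded_linear_mult_const bounded_linear_vec_nth)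
  have "\<forall>\<^sub>F m in at l. norm (norm (fock_eval m x - fock_eval l x - fock_deriv l (m - l) x) / norm (m - l))
      \<le> (\<Sum>i\<in>UNIV. cmod (fock_eval m (?v i) - fock_eval l (?v i)))"
    using eventually_norm_less[OF l]
  proof eventually_elim
    case (elim m)
    have "fock_eval m x - fock_eval l x - fock_deriv l (m - l) x =
        (\<Sum>i\<in>UNIV. (m - l) $ i * (fock_eval m (?v i) - fock_eval l (?v i)))"
      unfolding fock_eval_difference[OF l elim, of x] fock_deriv_def
      by (simp add: right_diff_distrib flip: sum_subtractf)
    also have "norm \<dots> \<le> (\<Sum>i\<in>UNIV. norm (m - l) * cmod (fock_eval m (?v i) - fock_eval l (?v i)))"
      by (intro sum_norm_le)
        (simp add: norm_mult mult_right_mono Finite_Cartesian_Product.norm_nth_le del: vector_minus_component)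
    finally have "norm (fock_eval m x - fock_eval l x - fock_deriv l (m - l) x)
        \<le> norm (m - l) * (\<Sum>i\<in>UNIV. cmod (fock_eval m (?v i) - fock_eval l (?v i)))"
      by (simp add: sum_distrib_left)
    then show ?case
      by (cases "m = l") (simp_all add: sum_nonneg divide_le_eq mult.commute)
  qed
  moreover have "((\<lambda>m. \<Sum>i\<in>UNIV. cmod (fock_eval m (?v i) - fock_eval l (?v i))) \<longlongrightarrow> 0) (at l)"
    using tendsto_norm_zero[OF LIM_zero[OF fock_eval_tendsto[OF l]]] by (intro tendsto_null_sum)
  ultimately show "((\<lambda>m. norm (fock_eval m x - fock_eval l x - fock_deriv l (m - l) x) / norm (m - l))
      \<longlongrightarrow> 0) (at l)"
    by (rule Lim_null_comparison)
qed


section \<open>The identity theorem on the ball\<close>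

text \<open>After division by the lowest nonvanishing power the sum is continuous at 0 and its value
  there is that coefficient. Only positive real arguments are used, since Kronecker substitution
  supplies no others.\<close>

lemma power_series_zero_coeffs:
  fixes a :: "nat \<Rightarrow> complex"
  assumes "0 < s" and sums0: "\<And>t. 0 < t \<Longrightarrow> t < s \<Longrightarrow> (\<lambda>n. a n * complex_of_real t ^ n) sums 0"
  shows "a n = 0"
proof (rule ccontr)
  assume "a n \<noteq> 0"
  define m where "m = (LEAST m. a m \<noteq> 0)"
  have am: "a m \<noteq> 0"
    unfolding m_def by (rule LeastI[of "\<lambda>m. a m \<noteq> 0", OF \<open>a n \<noteq> 0\<close>])
  have ak: "a k = 0" if "k < m" for k
    using not_less_Least[of k "\<lambda>m. a m \<noteq> 0"] that unfolding m_def by blast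
  define b where "b = (\<lambda>n. a (n + m))"
  have b0: "(\<lambda>n. b n * complex_of_real t ^ n) sums 0" if t: "0 < t" "t < s" for t
  proof -
    have "(\<lambda>n. a (n + m) * complex_of_real t ^ (n + m)) sums (0 - (\<Sum>k<m. a k * complex_of_real t ^ k))"
      by (rule sums_split_initial_segment[OF sums0[OF t]])
    then have "(\<lambda>n. complex_of_real t ^ m * (b n * complex_of_real t ^ n)) sums (complex_of_real t ^ m * 0)"
      by (simp add: ak b_def power_add mult_ac)
    then show ?thesis
      using t by (subst (asm) sums_mult_iff) auto
  qed
  define F where "F = (\<lambda>z. \<Sum>n. b n * z ^ n)"
  have "summable (\<lambda>n. b n * complex_of_real (s / 2) ^ n)"
    using b0[of "s / 2"] assms(1) by (auto simp: sums_iff)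
  then have "isCont F 0"
    unfolding F_def using assms(1) by (intro isCont_powser) auto
  then have lim: "(F \<longlongrightarrow> F 0) (at 0)"
    by (simp add: isCont_def)
  have "((\<lambda>t. complex_of_real t) \<longlongrightarrow> complex_of_real 0) (at_right 0)"
    by (intro tendsto_intros)
  moreover have "\<forall>\<^sub>F t in at_right 0. complex_of_real t \<noteq> 0"
    using eventually_at_right_less[of "0::real"] by eventually_elim simp
  ultimately have "filterlim (\<lambda>t. complex_of_real t) (at 0) (at_right 0)"
    by (simp add: filterlim_at)
  then have "((\<lambda>t. F (complex_of_real t)) \<longlongrightarrow> F 0) (at_right 0)"
    using lim filterlim_compose by blast
  moreover have "\<forall>\<^sub>F t in at_right 0. F (complex_of_real t) = 0"
    using b0 assms(1) unfolding eventually_at_right_field F_def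
    by (auto simp: sums_iff intro!: exI[of _ s])
  ultimately have "((\<lambda>t. 0) \<longlongrightarrow> F 0) (at_right (0::real))"
    by (rule Lim_transform_eventually)
  then have "F 0 = 0"
    using tendsto_unique[OF trivial_limit_at_right_real _ tendsto_const] by blast
  then show False
    using am by (simp add: F_def b_def)
qed


section \<open>Symmetric families\<close>

lemma scalar_word_monomial: "scalar_word z \<alpha> = scalar_monomial z (count_list \<alpha>)"
proof (induction \<alpha>)
  case (Cons a \<alpha>)
  have "scalar_monomial z (count_list (a # \<alpha>)) =
      (\<Prod>i\<in>UNIV. (if i = a then z i else 1) * z i ^ count_list \<alpha> i)"
    unfolding scalar_monomial_def by (intro prod.cong) auto
  also have "\<dots> = z a * scalar_monomial z (count_list \<alpha>)"
    by (simp add: prod.distrib scalar_monomial_def)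
  finally show ?case
    by (simp only: scalar_word_Cons Cons)
qed (simp add: scalar_monomial_def)

lemma sym_words_eq: "sym_words k = {\<alpha>. count_list \<alpha> = k}"
proof -
  have "count_list \<alpha> = k" if *: "\<forall>z. scalar_monomial z (count_list \<alpha>) = scalar_monomial z k" for \<alpha>
  proof
    fix i
    \<comment> \<open>The point with 2 in one coordinate and 1 elsewhere reads off a single
      exponent.\<close>
    have "scalar_monomial (\<lambda>j. if j = i then 2 else 1) m = 2 ^ m i" for m :: "'a \<Rightarrow> nat"
    proof -
      have "scalar_monomial (\<lambda>j. if j = i then 2 else 1) m = (\<Prod>j\<in>UNIV. if j = i then 2 ^ m i else 1)"
        unfolding scalar_monomial_def by (intro prod.cong) auto
      then show ?thesis by simp
    qed
    then have "(2 :: complex) ^ count_list \<alpha> i = 2 ^ k i"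
      using * by metis
    then have "complex_of_real (2 ^ count_list \<alpha> i) = complex_of_real (2 ^ k i)"
      by simp
    then have "(2 :: real) ^ count_list \<alpha> i = 2 ^ k i"
      using of_real_eq_iff by blast
    then show "count_list \<alpha> i = k i"
      by simp
  qed
  then show ?thesis
    by (auto simp: sym_words_def scalar_word_monomial)
qed

lemma finite_count_list_fiber: "finite {\<alpha>. count_list \<alpha> = k}"
  for k :: "'n::finite \<Rightarrow> nat"
proof (rule finite_subset[OF _ finite_words_length])
  show "{\<alpha>. count_list \<alpha> = k} \<subseteq> {\<alpha>. length \<alpha> = sum k UNIV}"
    using sum_count_set[of _ "UNIV :: 'n set"] by auto
qed

lemma count_list_surj: "\<exists>\<alpha>. count_list \<alpha> = k"
  for k :: "'n::finite \<Rightarrow> nat"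
proof -
  obtain \<alpha> where "mset \<alpha> = Abs_multiset k"
    using ex_mset by blast
  then have "count (mset \<alpha>) = k"
    by (simp add: Abs_multiset_inverse)
  then show ?thesis
    by (auto simp: fun_eq_iff count_mset)
qed

lemma sym_card_pos: "0 < sym_card k"
  using count_list_surj[of k] finite_count_list_fiber[of k]
  by (auto simp: sym_card_def sym_words_eq card_gt_0_iff)

lemma Rep_sym_vector:
  "Rep_ell2 (sym_vector k) \<alpha> = (if count_list \<alpha> = k then complex_of_real (1 / sym_card k) else 0)"
  by (auto simp: sym_vector_def scaleR_ell2.rep_eq Rep_ell2_sum ell2_unit.rep_eq sym_words_eq
      finite_count_list_fiber)

text \<open>The coordinate form of the symmetric Hardy space. It is visibly closed, and membership
  can be tested on pairs of words.\<close>

definition symmetric_families :: "'n::finite list ell2 set"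
  where "symmetric_families =
    {x. \<forall>\<alpha> \<beta>. count_list \<alpha> = count_list \<beta> \<longrightarrow> Rep_ell2 x \<alpha> = Rep_ell2 x \<beta>}"

lemma symmetric_familiesD:
  "x \<in> symmetric_families \<Longrightarrow> count_list \<alpha> = count_list \<beta> \<Longrightarrow> Rep_ell2 x \<alpha> = Rep_ell2 x \<beta>"
  unfolding symmetric_families_def by blast

text \<open>A sum rather than the common value, because \<open>sym_vector k\<close> is an average
  over its class: for symmetric \<open>x\<close> this is the coefficient c_k. For arbitrary
  \<open>x\<close> it is the coefficient of the commutative monomial of exponent \<open>k\<close> in
  \<open>fock_eval\<close>.\<close>

definition sym_coeff :: "'n::finite list ell2 \<Rightarrow> ('n \<Rightarrow> nat) \<Rightarrow> complex"
  where "sym_coeff x k = (\<Sum>\<alpha>\<in>sym_words k. Rep_ell2 x \<alpha>)"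

lemma subspace_symmetric_families: "complex_vector.subspace symmetric_families"
  by (rule complex_vector.subspaceI; unfold symmetric_families_def mem_Collect_eq
      zero_ell2.rep_eq plus_ell2.rep_eq scaleC_ell2.rep_eq; metis)

lemma closed_symmetric_families: "closed symmetric_families"
proof -
  have eq: "symmetric_families =
      (\<Inter>(\<alpha>, \<beta>)\<in>{(\<alpha>, \<beta>). count_list \<alpha> = count_list \<beta>}. {x. Rep_ell2 x \<alpha> = Rep_ell2 x \<beta>})"
    by (auto simp: symmetric_families_def)
  have "closed {x. Rep_ell2 x \<alpha> = Rep_ell2 x \<beta>}" for \<alpha> \<beta> :: "'a list"
    by (intro closed_Collect_eq linear_continuous_on bounded_linear_Rep_ell2)
  then show ?thesis
    unfolding eq by (intro closed_INT ballI) (simp add: case_prod_unfold)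
qed

lemma has_sum_sym_words:
  fixes h :: "'n::finite list \<Rightarrow> 'b::{topological_comm_monoid_add,t3_space}"
  assumes "(h has_sum s) UNIV"
  shows "((\<lambda>k. \<Sum>\<alpha>\<in>sym_words k. h \<alpha>) has_sum s) UNIV"
  unfolding sym_words_eq by (rule has_sum_fibers[OF assms finite_count_list_fiber])

lemma sym_coeff_eq:
  assumes "x \<in> symmetric_families"
  shows "Rep_ell2 x \<alpha> = sym_coeff x (count_list \<alpha>) / sym_card (count_list \<alpha>)"
proof -
  have "sym_coeff x (count_list \<alpha>) = (\<Sum>\<beta>\<in>sym_words (count_list \<alpha>). Rep_ell2 x \<alpha>)"
    unfolding sym_coeff_def
    by (intro sum.cong refl symmetric_familiesD[OF assms]) (simp add: sym_words_eq)
  then show ?thesis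
    using sym_card_pos[of "count_list \<alpha>"] by (simp add: sym_card_def)
qed

lemma symmetric_has_sum:
  assumes "x \<in> symmetric_families"
  shows "((\<lambda>k. sym_coeff x k *\<^sub>C sym_vector k) has_sum x) UNIV"
proof -
  have "(\<Sum>\<alpha>\<in>sym_words k. Rep_ell2 x \<alpha> *\<^sub>C ell2_unit \<alpha>) = sym_coeff x k *\<^sub>C sym_vector k" for k
  proof -
    have "(\<Sum>\<alpha>\<in>sym_words k. Rep_ell2 x \<alpha> *\<^sub>C ell2_unit \<alpha>) =
        (\<Sum>\<alpha>\<in>sym_words k. (sym_coeff x k / sym_card k) *\<^sub>C ell2_unit \<alpha>)"
      by (rule sum.cong) (use sym_coeff_eq[OF assms] in \<open>auto simp: sym_words_eq\<close>)
    then show ?thesis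
      by (simp add: sym_vector_def scaleR_scaleC scaleC_scaleC flip: complex_vector.scale_sum_right)
  qed
  then show ?thesis
    using has_sum_sym_words[OF ell2_has_sum[of x]] by simp
qed

lemma sym_has_sum_Rep:
  assumes "((\<lambda>k. c k *\<^sub>C sym_vector k) has_sum x) UNIV"
  shows "Rep_ell2 x \<alpha> = c (count_list \<alpha>) / sym_card (count_list \<alpha>)"
proof -
  have "((\<lambda>k. Rep_ell2 (c k *\<^sub>C sym_vector k) \<alpha>) has_sum Rep_ell2 x \<alpha>) UNIV"
    by (rule has_sum_bounded_linear[OF bounded_linear_Rep_ell2 assms])
  moreover have "((\<lambda>k. Rep_ell2 (c k *\<^sub>C sym_vector k) \<alpha>) has_sum
      (c (count_list \<alpha>) / sym_card (count_list \<alpha>))) UNIV"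
    by (rule has_sum_finite_neutralI[of "{count_list \<alpha>}"])
      (auto simp: scaleC_ell2.rep_eq Rep_sym_vector)
  ultimately show ?thesis
    by (rule has_sum_unique)
qed

lemma sym_hardy_eq: "sym_hardy = (symmetric_families :: 'n::finite list ell2 set)"
proof (rule equalityI)
  show "sym_hardy \<subseteq> (symmetric_families :: 'n list ell2 set)"
    unfolding sym_hardy_def
  proof (rule closure_cspan_subset)
    show "range sym_vector \<subseteq> (symmetric_families :: 'n list ell2 set)"
      by (auto simp: symmetric_families_def Rep_sym_vector)
  qed (rule subspace_symmetric_families closed_symmetric_families)+
  show "symmetric_families \<subseteq> (sym_hardy :: 'n list ell2 set)"
  proof
    fix x :: "'n list ell2" assume "x \<in> symmetric_families"
    then have "((\<lambda>F. \<Sum>k\<in>F. sym_coeff x k *\<^sub>C sym_vector k) \<longlongrightarrow> x) (finite_subsets_at_top UNIV)"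
      using symmetric_has_sum unfolding has_sum_def by blast
    moreover have "(\<Sum>k\<in>F. sym_coeff x k *\<^sub>C sym_vector k) \<in> sym_hardy" for F
      unfolding sym_hardy_def
      by (intro subsetD[OF closure_subset] complex_vector.span_sum complex_vector.span_scale
          complex_vector.span_base rangeI)
    ultimately show "x \<in> sym_hardy"
      unfolding sym_hardy_def
      by (intro Lim_in_closed_set[OF closed_closure]) (auto intro: always_eventually)
  qed
qed

lemma sum_sym_words_norm:
  fixes c :: "('n::finite \<Rightarrow> nat) \<Rightarrow> complex"
  shows
  "(\<Sum>\<alpha>\<in>sym_words k. (cmod (c (count_list \<alpha>) / sym_card (count_list \<alpha>)))\<^sup>2) =
    (cmod (c k))\<^sup>2 / sym_card k"
proof -
  have "(\<Sum>\<alpha>\<in>sym_words k. (cmod (c (count_list \<alpha>) / sym_card (count_list \<alpha>)))\<^sup>2) =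
      (\<Sum>\<alpha>\<in>sym_words k. (cmod (c k) / sym_card k)\<^sup>2)"
    by (rule sum.cong) (auto simp: sym_words_eq norm_divide abs_of_pos[OF sym_card_pos])
  also have "\<dots> = sym_card k * (cmod (c k) / sym_card k)\<^sup>2"
    by (simp add: sym_card_def)
  also have "\<dots> = (cmod (c k))\<^sup>2 / sym_card k"
    using sym_card_pos[of k] by (simp add: power2_eq_square)
  finally show ?thesis .
qed

lemma symmetric_norm_has_sum:
  assumes "x \<in> symmetric_families"
  shows "((\<lambda>k. (cmod (sym_coeff x k))\<^sup>2 / sym_card k) has_sum (norm x)\<^sup>2) UNIV"
proof -
  have "(\<lambda>\<alpha>. (cmod (Rep_ell2 x \<alpha>))\<^sup>2) =
      (\<lambda>\<alpha>. (cmod (sym_coeff x (count_list \<alpha>) / sym_card (count_list \<alpha>)))\<^sup>2)"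
    using sym_coeff_eq[OF assms] by simp
  then show ?thesis
    using has_sum_sym_words[OF norm_ell2_has_sum[of x]] by (simp only: sum_sym_words_norm)
qed

lemma fock_eval_sym_has_sum:
  assumes "norm l < 1"
  shows "((\<lambda>k. sym_coeff x k * scalar_monomial (($) l) k) has_sum fock_eval l x) UNIV"
proof -
  have "(\<Sum>\<alpha>\<in>sym_words k. Rep_ell2 x \<alpha> * scalar_word (($) l) \<alpha>) =
      sym_coeff x k * scalar_monomial (($) l) k" for k
    unfolding sym_coeff_def sum_distrib_right
    by (rule sum.cong) (auto simp: sym_words_eq scalar_word_monomial)
  then show ?thesis
    using has_sum_sym_words[OF fock_eval_has_sum[OF assms, of x]] by simp
qed

text \<open>Each c_k is spread evenly over the words of its class, which turns the weight
  1/\<gamma>_k into the plain square sum.\<close>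

lemma symmetric_family_exists:
  fixes c :: "('n::finite \<Rightarrow> nat) \<Rightarrow> complex"
  assumes "(\<lambda>k. (cmod (c k))\<^sup>2 / sym_card k) summable_on UNIV"
  obtains x where "x \<in> symmetric_families" "sym_coeff x = c"
proof -
  define u where "u = (\<lambda>\<alpha>. c (count_list \<alpha>) / sym_card (count_list \<alpha>))"
  have fib: "(\<Sum>\<alpha>\<in>sym_words k. (cmod (u \<alpha>))\<^sup>2) = (cmod (c k))\<^sup>2 / sym_card k" for k
    unfolding u_def by (rule sum_sym_words_norm)
  have "(\<lambda>\<alpha>. (cmod (u \<alpha>))\<^sup>2) summable_on UNIV"
  proof (rule nonneg_bdd_above_summable_on)
    show "bdd_above (sum (\<lambda>\<alpha>. (cmod (u \<alpha>))\<^sup>2) ` {F. F \<subseteq> UNIV \<and> finite F})"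
    proof (rule bdd_aboveI2)
      fix F :: "'n list set" assume "F \<in> {F. F \<subseteq> UNIV \<and> finite F}"
      then have F: "finite F" by simp
      \<comment> \<open>Completing \<open>F\<close> to a union of full classes makes a partial sum
        of the weighted series appear.\<close>
      have "(\<Sum>\<alpha>\<in>F. (cmod (u \<alpha>))\<^sup>2) \<le> (\<Sum>\<alpha>\<in>(\<Union>k\<in>count_list ` F. sym_words k). (cmod (u \<alpha>))\<^sup>2)"
        by (rule sum_mono2) (use F in \<open>auto simp: sym_words_eq finite_count_list_fiber\<close>)
      also have "\<dots> = (\<Sum>k\<in>count_list ` F. (cmod (c k))\<^sup>2 / sym_card k)"
        unfolding fib[symmetric]
        by (rule sum.UNION_disjoint) (use F in \<open>auto simp: sym_words_eq finite_count_list_fiber\<close>)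
      also have "\<dots> \<le> (\<Sum>\<^sub>\<infinity>k. (cmod (c k))\<^sup>2 / sym_card k)"
        by (rule finite_sum_le_infsum)
          (use assms F in \<open>auto intro!: divide_nonneg_pos sym_card_pos\<close>)
      finally show "(\<Sum>\<alpha>\<in>F. (cmod (u \<alpha>))\<^sup>2) \<le> (\<Sum>\<^sub>\<infinity>k. (cmod (c k))\<^sup>2 / sym_card k)" .
    qed
  qed simp
  then have Rep: "Rep_ell2 (Abs_ell2 u) = u"
    by (subst Abs_ell2_inverse) simp_all
  have "sym_coeff (Abs_ell2 u) k = c k" for k
  proof -
    have "sym_coeff (Abs_ell2 u) k = (\<Sum>\<alpha>\<in>sym_words k. c k / sym_card k)"
      unfolding sym_coeff_def Rep by (rule sum.cong) (auto simp: u_def sym_words_eq)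
    also have "\<dots> = c k"
      using sym_card_pos[of k] by (simp add: sym_card_def)
    finally show ?thesis .
  qed
  moreover have "Abs_ell2 u \<in> symmetric_families"
    unfolding symmetric_families_def mem_Collect_eq Rep by (intro allI impI) (simp only: u_def)
  ultimately show ?thesis
    using that by blast
qed

section \<open>Kronecker substitution and the identity theorem in several variables\<close>

lemma digits_unique:
  fixes c c' :: "nat \<Rightarrow> nat"
  assumes "\<And>j. j < n \<Longrightarrow> c j < N" "\<And>j. j < n \<Longrightarrow> c' j < N"
    and "(\<Sum>j<n. c j * N ^ j) = (\<Sum>j<n. c' j * N ^ j)" "j < n"
  shows "c j = c' j"
  using assms
proof (induction n arbitrary: c c' j)
  case (Suc n)
  have split: "(\<Sum>j<Suc n. d j * N ^ j) = d 0 + N * (\<Sum>j<n. d (Suc j) * N ^ j)" for d :: "nat \<Rightarrow> nat"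
    by (simp add: sum.lessThan_Suc_shift sum_distrib_left mult_ac del: sum.lessThan_Suc)
  have lt: "c 0 < N" "c' 0 < N"
    using Suc.prems(1,2) by auto
  have eq: "c 0 + N * (\<Sum>j<n. c (Suc j) * N ^ j) = c' 0 + N * (\<Sum>j<n. c' (Suc j) * N ^ j)"
    using Suc.prems(3) unfolding split .
  \<comment> \<open>Reduction modulo \<open>N\<close> isolates the lowest digit; the others are
    shifted down by one place for the induction.\<close>
  then have "(c 0 + N * (\<Sum>j<n. c (Suc j) * N ^ j)) mod N = (c' 0 + N * (\<Sum>j<n. c' (Suc j) * N ^ j)) mod N"
    by simp
  then have c0: "c 0 = c' 0"
    using lt by simp
  with eq lt have "(\<Sum>j<n. c (Suc j) * N ^ j) = (\<Sum>j<n. c' (Suc j) * N ^ j)"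
    by simp
  then have "c (Suc i) = c' (Suc i)" if "i < n" for i
    using Suc.IH[of "\<lambda>j. c (Suc j)" "\<lambda>j. c' (Suc j)" i] Suc.prems(1,2) that by simp
  then show ?case
    using c0 Suc.prems(4) by (cases j) auto
qed simp

text \<open>
  Kronecker substitution: weights whose total on a word determines first its length and then, as
  digits to a base exceeding the length, its letter counts.
\<close>

lemma kronecker_weights:
  fixes \<alpha> :: "'n::finite list"
  obtains d :: "'n \<Rightarrow> nat" where "\<And>i. 0 < d i"
    and "\<And>\<beta>. (\<Sum>i\<in>UNIV. count_list \<beta> i * d i) = (\<Sum>i\<in>UNIV. count_list \<alpha> i * d i)
      \<Longrightarrow> count_list \<beta> = count_list \<alpha>"
proof -
  define n where "n = CARD('n)"
  obtain idx :: "'n \<Rightarrow> nat" where idx: "bij_betw idx UNIV {..<n}"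
    using ex_bij_betw_finite_nat[of "UNIV :: 'n set"] by (auto simp: n_def atLeast0LessThan)
  define N where "N = Suc (length \<alpha>)"
  \<comment> \<open>\<open>B\<close> exceeds the digit sum \<open>s\<close> of every word no longer
    than \<open>\<alpha>\<close>, so division with remainder by \<open>B\<close> separates the
    length from the digits.\<close>
  define B where "B = Suc (length \<alpha> * N ^ n)"
  define d where "d = (\<lambda>i. B + N ^ idx i)"
  define s where "s = (\<lambda>\<beta>::'n list. \<Sum>i\<in>UNIV. count_list \<beta> i * N ^ idx i)"
  have len: "(\<Sum>i\<in>UNIV. count_list \<beta> i) = length \<beta>" for \<beta> :: "'n list"
    by (rule sum_count_set) auto
  have D: "(\<Sum>i\<in>UNIV. count_list \<beta> i * d i) = length \<beta> * B + s \<beta>" for \<beta>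
    by (simp add: d_def s_def distrib_left sum.distrib flip: sum_distrib_right len)
  have s_le: "s \<beta> < B" if "length \<beta> \<le> length \<alpha>" for \<beta>
  proof -
    have "idx i \<le> n" for i
      using bij_betw_apply[OF idx, of i] by simp
    then have "s \<beta> \<le> (\<Sum>i\<in>UNIV. count_list \<beta> i * N ^ n)"
      unfolding s_def by (intro sum_mono mult_left_mono power_increasing) (auto simp: N_def)
    also have "\<dots> \<le> length \<alpha> * N ^ n"
      using that by (simp add: len flip: sum_distrib_right)
    finally show ?thesis
      by (simp add: B_def)
  qed
  show ?thesis
  proof
    show "0 < d i" for i
      by (simp add: d_def B_def)
    fix \<beta> :: "'n list"
    assume "(\<Sum>i\<in>UNIV. count_list \<beta> i * d i) = (\<Sum>i\<in>UNIV. count_list \<alpha> i * d i)"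
    then have eq: "length \<beta> * B + s \<beta> = length \<alpha> * B + s \<alpha>"
      by (simp only: D)
    \<comment> \<open>The lengths come first: the bound on \<open>s \<beta>\<close>, needed for the
      remainder modulo \<open>B\<close>, holds only once \<open>\<beta>\<close> is known not to be
      longer than \<open>\<alpha>\<close>.\<close>
    have "length \<beta> * B < Suc (length \<alpha>) * B"
      using eq s_le[of \<alpha>] by simp
    then have le: "length \<beta> \<le> length \<alpha>"
      by (metis less_Suc_eq_le mult_less_cancel2)
    have "s \<beta> = s \<alpha>"
      using arg_cong[OF eq, of "\<lambda>m. m mod B"] s_le[OF le] s_le[of \<alpha>] by simp
    moreover have "s \<gamma> = (\<Sum>j<n. count_list \<gamma> (inv idx j) * N ^ j)" for \<gamma>
      unfolding s_def using sum.reindex_bij_betw[OF idx, of "\<lambda>j. count_list \<gamma> (inv idx j) * N ^ j"]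
      by (simp add: bij_betw_imp_inj_on[OF idx])
    ultimately have sums: "(\<Sum>j<n. count_list \<beta> (inv idx j) * N ^ j) = (\<Sum>j<n. count_list \<alpha> (inv idx j) * N ^ j)"
      by simp
    have lt: "count_list \<gamma> i < N" if "length \<gamma> \<le> length \<alpha>" for \<gamma> i
      using count_le_length[of \<gamma> i] that by (simp add: N_def)
    show "count_list \<beta> = count_list \<alpha>"
    proof
      fix i
      have "idx i < n"
        using bij_betw_apply[OF idx, of i] by simp
      from digits_unique[OF lt[OF le] lt[OF order_refl] sums this]
      show "count_list \<beta> i = count_list \<alpha> i"
        by (simp add: bij_betw_imp_inj_on[OF idx])
    qed
  qed
qed

text \<open>Along the curve with coordinates \<open>t ^ d i\<close> a word contributes the power of
  \<open>t\<close> given by its weight, and Kronecker weights make the class \<open>k\<close> a full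
  fibre of the weight. A power series in one variable then decides. The conclusion concerns only
  class sums, because commuting points cannot separate the words of a class.\<close>

lemma fock_eval_identity:
  fixes x :: "'n::finite list ell2"
  assumes "\<And>l. norm l < 1 \<Longrightarrow> fock_eval l x = 0"
  shows "sym_coeff x k = 0"
proof -
  obtain \<alpha> where \<alpha>: "count_list \<alpha> = k"
    using count_list_surj by blast
  obtain d :: "'n \<Rightarrow> nat" where d: "\<And>i. 0 < d i"
    and inj: "\<And>\<beta>. (\<Sum>i\<in>UNIV. count_list \<beta> i * d i) = (\<Sum>i\<in>UNIV. count_list \<alpha> i * d i)
      \<Longrightarrow> count_list \<beta> = count_list \<alpha>"
    using kronecker_weights[of \<alpha>] by blast
  define D where "D = (\<lambda>\<beta>. \<Sum>i\<in>UNIV. count_list \<beta> i * d i)"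
  define a where "a = (\<lambda>p. \<Sum>\<beta> | D \<beta> = p. Rep_ell2 x \<beta>)"
  have len: "length \<beta> \<le> D \<beta>" for \<beta>
  proof -
    have "length \<beta> = (\<Sum>i\<in>UNIV. count_list \<beta> i)"
      by (rule sum_count_set[symmetric]) auto
    also have "\<dots> \<le> D \<beta>"
      unfolding D_def using d by (intro sum_mono) (simp add: Suc_le_eq)
    finally show ?thesis .
  qed
  have fin: "finite {\<beta>. D \<beta> = p}" for p
  proof (rule finite_subset)
    show "{\<beta>. D \<beta> = p} \<subseteq> (\<Union>m\<in>{..p}. {\<beta>. length \<beta> = m})"
      using len by auto
  qed (simp add: finite_words_length)
  \<comment> \<open>The coordinates are at most \<open>t\<close> in modulus, so their sum stays
    below 1 for \<open>t\<close> less than \<open>s\<close>, and the curve remains in the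
    ball.\<close>
  define s where "s = 1 / (real CARD('n) + 1)"
  have "(\<lambda>p. a p * complex_of_real t ^ p) sums 0" if t: "0 < t" "t < s" for t
  proof -
    define l :: "complex^'n" where "l = (\<chi> i. complex_of_real t ^ d i)"
    have "s \<le> 1"
      by (simp add: s_def)
    then have "t < 1"
      using t by linarith
    have "norm l \<le> (\<Sum>i\<in>UNIV. norm (l $ i))"
      unfolding norm_vec_def by (rule L2_set_le_sum) simp
    also have "\<dots> \<le> (\<Sum>i\<in>(UNIV::'n set). t)"
    proof (rule sum_mono)
      fix i
      have "t ^ d i \<le> t ^ 1"
        using t \<open>t < 1\<close> d[of i] by (intro power_decreasing) auto
      then show "norm (l $ i) \<le> t"
        using t by (simp add: l_def norm_power)
    qed
    also have "\<dots> < 1"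
    proof -
      have "real CARD('n) * t < real CARD('n) * s"
        using t by simp
      also have "\<dots> \<le> 1"
        by (simp add: s_def)
      finally show ?thesis by simp
    qed
    finally have l: "norm l < 1" .
    have "scalar_word (($) l) \<beta> = complex_of_real t ^ D \<beta>" for \<beta>
      by (simp add: scalar_word_monomial scalar_monomial_def l_def D_def power_sum mult.commute
          flip: power_mult)
    then have "((\<lambda>\<beta>. Rep_ell2 x \<beta> * complex_of_real t ^ D \<beta>) has_sum 0) UNIV"
      using fock_eval_has_sum[OF l, of x] assms[OF l] by simp
    then have "((\<lambda>p. \<Sum>\<beta> | D \<beta> = p. Rep_ell2 x \<beta> * complex_of_real t ^ D \<beta>) has_sum 0) UNIV"
      by (rule has_sum_fibers) (rule fin)
    then show ?thesis
      by (intro has_sum_imp_sums) (simp add: a_def sum_distrib_right)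
  qed
  then have "a (D \<alpha>) = 0"
    by (intro power_series_zero_coeffs[of s]) (simp_all add: s_def)
  \<comment> \<open>The choice of the weights gives one inclusion; the other holds because the
    weight depends only on letter counts.\<close>
  moreover have "{\<beta>. D \<beta> = D \<alpha>} = sym_words k"
    using inj \<alpha> by (auto simp: D_def sym_words_eq)
  ultimately show ?thesis
    by (simp add: a_def sym_coeff_def)
qed

lemma symmetric_eq_0:
  assumes "x \<in> symmetric_families" "\<And>l. norm l < 1 \<Longrightarrow> fock_eval l x = 0"
  shows "x = 0"
  by (rule ell2_eqI)
    (simp add: sym_coeff_eq[OF assms(1)] fock_eval_identity[OF assms(2)] zero_ell2.rep_eq)

lemma szego_vector_symmetric: "norm l < 1 \<Longrightarrow> szego_vector l \<in> symmetric_families"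
  unfolding symmetric_families_def mem_Collect_eq
  by (intro allI impI) (simp only: Rep_szego_vector scalar_word_monomial)

text \<open>For a symmetric family, orthogonality to all Szego vectors is vanishing of its
  evaluation on the ball, and the identity theorem leaves only zero.\<close>

lemma closure_span_szego: "closure (cspan (szego_vector ` ball 0 1)) = symmetric_families"
proof (rule subspace_eq_of_orthogonal)
  show "closure (cspan (szego_vector ` ball 0 1)) \<subseteq> symmetric_families"
    by (rule closure_cspan_subset)
      (auto simp: szego_vector_symmetric subspace_symmetric_families closed_symmetric_families)
next
  fix x :: "'a list ell2"
  assume x: "x \<in> symmetric_families"
    and orth: "\<And>v. v \<in> closure (cspan (szego_vector ` ball 0 1)) \<Longrightarrow> cinner x v = 0"
  show "x = 0"
  proof (rule symmetric_eq_0[OF x])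
    fix l :: "complex^'a" assume "norm l < 1"
    then have "szego_vector l \<in> closure (cspan (szego_vector ` ball 0 1))"
      by (intro subsetD[OF closure_subset] complex_vector.span_base imageI) simp
    then show "fock_eval l x = 0"
      unfolding fock_eval_def by (rule orth)
  qed
qed (auto simp: subspace_closure_cspan subspace_symmetric_families)


section \<open>The weak operator topology\<close>

text \<open>The topology is pulled back from a product, so continuity is tested on one matrix
  coefficient at a time. All continuity claims for operations on operators reduce to this.\<close>

lemma continuous_map_weak_operator_topology_iff:
  "continuous_map X weak_operator_topology f \<longleftrightarrow>
    (\<forall>x y. continuous_map X euclidean (\<lambda>t. cinner (f t x) y))"
  for f :: "'b \<Rightarrow> ('a::complex_inner \<Rightarrow>\<^sub>L 'a)"
proof
  assume f: "continuous_map X weak_operator_topology f"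
  have "continuous_map weak_operator_topology euclidean
      (\<lambda>T. (\<lambda>(x, y). cinner (blinfun_apply T x) (y :: 'a)))"
    unfolding weak_operator_topology_def
    using continuous_map_pullback[of euclidean euclidean id] by (simp add: o_def)
  then have "continuous_map X euclidean (\<lambda>t. (\<lambda>(x, y). cinner (f t x) y))"
    using continuous_map_compose[OF f] by (simp add: o_def)
  then have "continuous_map X euclidean (\<lambda>t. (\<lambda>(x, y). cinner (f t x) y) p)" for p
    using continuous_map_componentwise_UNIV euclidean_product_topology by (metis (no_types))
  from this[of "(_, _)"] show "\<forall>x y. continuous_map X euclidean (\<lambda>t. cinner (f t x) y)"
    by simp
next
  assume "\<forall>x y. continuous_map X euclidean (\<lambda>t. cinner (f t x) y)"
  then have "continuous_map X euclidean (\<lambda>t. (\<lambda>(x, y). cinner (f t x) y) p)" for p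
    by (simp add: case_prod_unfold)
  then have "continuous_map X euclidean (\<lambda>t. (\<lambda>(x, y). cinner (f t x) y))"
    by (metis (no_types) continuous_map_componentwise_UNIV euclidean_product_topology)
  then show "continuous_map X weak_operator_topology f"
    unfolding weak_operator_topology_def
    by (intro continuous_map_pullback') (auto simp: o_def)
qed

lemma topspace_weak_operator_topology [simp]: "topspace weak_operator_topology = UNIV"
  by (simp add: weak_operator_topology_def topspace_pullback_topology)

lemma continuous_map_wot_cinner:
  "continuous_map weak_operator_topology euclidean (\<lambda>T. cinner (blinfun_apply T x) y)"
  by (rule continuous_map_weak_operator_topology_iff[THEN iffD1, rule_format]) simp

lemma continuous_map_scale:
  fixes f :: "'b \<Rightarrow> complex"
  assumes "continuous_map X euclidean f"
  shows "continuous_map X euclidean (\<lambda>t. c * f t)"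
proof -
  have "continuous_map euclidean euclidean (\<lambda>z. c * z)"
    by (simp add: continuous_intros)
  from continuous_map_compose[OF assms this] show ?thesis
    by (simp add: o_def)
qed

lemma closedin_eq_0:
  fixes f :: "'b \<Rightarrow> complex"
  assumes "continuous_map X euclidean f" "topspace X = UNIV"
  shows "closedin X {t. f t = 0}"
  using closedin_continuous_map_preimage[OF assms(1), of "{0}"] assms(2) by simp

lemma closedin_wot_preimage:
  assumes "continuous_map weak_operator_topology weak_operator_topology F"
    and "closedin weak_operator_topology C"
  shows "closedin weak_operator_topology {T. F T \<in> C}"
  using closedin_continuous_map_preimage[OF assms] by simp

lemma continuous_map_wot_add: "continuous_map weak_operator_topology weak_operator_topology (\<lambda>T. T + S)"
  unfolding continuous_map_weak_operator_topology_iff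
  by (auto simp: blinfun.add_left cinner_add_left intro!: continuous_map_add continuous_map_wot_cinner)

lemma continuous_map_wot_scale:
  "continuous_map weak_operator_topology weak_operator_topology (\<lambda>T. scaleC_op c o\<^sub>L T)"
  unfolding continuous_map_weak_operator_topology_iff
  by (auto simp: scaleC_op.rep_eq cinner_scaleC_left intro!: continuous_map_scale continuous_map_wot_cinner)

lemma continuous_map_wot_compose_right:
  "continuous_map weak_operator_topology weak_operator_topology (\<lambda>T. T o\<^sub>L S)"
  unfolding continuous_map_weak_operator_topology_iff
  by (auto intro!: continuous_map_wot_cinner)

text \<open>Separate continuity on the left passes through the adjoint.\<close>

lemma continuous_map_wot_compose_left:
  fixes S :: "'a::chilbert_space \<Rightarrow>\<^sub>L 'a"
  assumes "clinear_op S"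
  shows "continuous_map weak_operator_topology weak_operator_topology (\<lambda>T. S o\<^sub>L T)"
  unfolding continuous_map_weak_operator_topology_iff
proof (intro allI)
  fix x y
  obtain y' where "\<And>x. cinner (S x) y = cinner x y'"
    using adjoint_vector_exists[OF assms] by blast
  then show "continuous_map weak_operator_topology euclidean (\<lambda>T. cinner ((S o\<^sub>L T) x) y)"
    by (simp add: continuous_map_wot_cinner)
qed

lemma continuous_map_wot_commutator:
  fixes S :: "'a::chilbert_space \<Rightarrow>\<^sub>L 'a"
  assumes "clinear_op S"
  shows "continuous_map weak_operator_topology weak_operator_topology (\<lambda>T. (T o\<^sub>L S) - (S o\<^sub>L T))"
  using continuous_map_wot_compose_left[OF assms] continuous_map_wot_compose_right[of S]
  unfolding continuous_map_weak_operator_topology_iff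
  by (auto simp: blinfun.diff_left cinner_diff_left intro!: continuous_map_diff)

text \<open>The values f_j(M) are SOT limits, whereas the Hardy algebra is closed in the WOT; this
  bridges the two.\<close>

lemma closedin_sot_of_wot:
  fixes C :: "('a::complex_inner \<Rightarrow>\<^sub>L 'a) set"
  assumes "closedin weak_operator_topology C"
  shows "closedin strong_operator_topology C"
proof -
  have "continuous_map strong_operator_topology weak_operator_topology (\<lambda>T :: 'a \<Rightarrow>\<^sub>L 'a. T)"
    unfolding continuous_map_weak_operator_topology_iff
  proof (intro allI)
    fix x y :: 'a
    have "continuous_map euclidean euclidean (\<lambda>v. cinner v y)"
      by (simp add: linear_continuous_on bounded_linear_cinner_left)
    from continuous_map_compose[OF strong_operator_topology_continuous_evaluation this]
    show "continuous_map strong_operator_topology euclidean (\<lambda>T. cinner (blinfun_apply T x) y)"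
      by (simp add: o_def)
  qed
  from closedin_continuous_map_preimage[OF this assms] show ?thesis
    by (simp add: strong_operator_topology_topspace)
qed

text \<open>The operator type contains all bounded real-linear maps. Complex linearity is an
  intersection of scalar equations in matrix coefficients, so it survives weak and strong
  limits.\<close>

lemma closedin_clinear_op:
  "closedin weak_operator_topology (Collect (clinear_op :: ('a::complex_inner \<Rightarrow>\<^sub>L 'a) \<Rightarrow> bool))"
proof -
  have eq: "Collect (clinear_op :: ('a \<Rightarrow>\<^sub>L 'a) \<Rightarrow> bool) =
      (\<Inter>(c, x, y)\<in>UNIV. {T :: 'a \<Rightarrow>\<^sub>L 'a. cinner (T (c *\<^sub>C x)) y - c * cinner (T x) y = 0})"
  proof (intro equalityI subsetI)
    fix T :: "'a \<Rightarrow>\<^sub>L 'a"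
    assume T: "T \<in> (\<Inter>(c, x, y)\<in>UNIV. {T :: 'a \<Rightarrow>\<^sub>L 'a. cinner (T (c *\<^sub>C x)) y - c * cinner (T x) y = 0})"
    have "T (c *\<^sub>C x) = c *\<^sub>C T x" for c x
    proof -
      have "cinner (T (c *\<^sub>C x) - c *\<^sub>C T x) y = 0" for y
        using T by (auto simp: cinner_diff_left cinner_scaleC_left)
      from this[of "T (c *\<^sub>C x) - c *\<^sub>C T x"] show ?thesis
        by (simp add: cinner_self)
    qed
    then show "T \<in> Collect clinear_op"
      by (simp add: clinear_op_def)
  qed (auto simp: clinear_op_def cinner_scaleC_left)
  have "closedin weak_operator_topology
      {T :: 'a \<Rightarrow>\<^sub>L 'a. cinner (T (c *\<^sub>C x)) y - c * cinner (T x) y = 0}" for c x y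
    by (intro closedin_eq_0 continuous_map_diff continuous_map_scale continuous_map_wot_cinner) simp
  then show ?thesis
    unfolding eq by (intro closedin_INT) auto
qed


section \<open>Polynomials in operators and the Hardy algebra\<close>

lemma blinfun_compose_id [simp]: "id_blinfun o\<^sub>L T = T" "T o\<^sub>L id_blinfun = T"
  by (auto intro: blinfun_eqI)

lemma blinfun_compose_assoc: "(R o\<^sub>L S) o\<^sub>L T = R o\<^sub>L (S o\<^sub>L T)"
  by (rule blinfun_eqI) simp

lemma op_word_Nil [simp]: "op_word X [] = id_blinfun"
  by (simp add: op_word_def)

lemma op_word_Cons [simp]: "op_word X (i # \<alpha>) = X i o\<^sub>L op_word X \<alpha>"
  by (simp add: op_word_def)

lemma op_word_append: "op_word X (\<alpha> @ \<beta>) = op_word X \<alpha> o\<^sub>L op_word X \<beta>"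
  by (induction \<alpha>) (simp_all add: blinfun_compose_assoc)

lemma blinfun_compose_zero [simp]: "S o\<^sub>L 0 = 0" "0 o\<^sub>L S = 0"
  by (auto intro: blinfun_eqI)

lemma blinfun_compose_add_left: "(S + T) o\<^sub>L R = (S o\<^sub>L R) + (T o\<^sub>L R)"
  by (rule blinfun_eqI) (simp add: blinfun.add_left)

lemma blinfun_compose_add_right: "R o\<^sub>L (S + T) = (R o\<^sub>L S) + (R o\<^sub>L T)"
  by (rule blinfun_eqI) (simp add: blinfun.add_left blinfun.add_right)

lemma clinear_op_id: "clinear_op id_blinfun"
  by (simp add: clinear_op_def)

lemma clinear_op_compose: "clinear_op S \<Longrightarrow> clinear_op T \<Longrightarrow> clinear_op (S o\<^sub>L T)"
  by (simp add: clinear_op_def)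

lemma clinear_op_add: "clinear_op S \<Longrightarrow> clinear_op T \<Longrightarrow> clinear_op (S + T)"
  by (simp add: clinear_op_def blinfun.add_left scaleC_add_right)

lemma clinear_op_zero: "clinear_op 0"
  by (simp add: clinear_op_def)

lemma clinear_op_scaleC_op: "clinear_op (scaleC_op c)"
  by (simp add: clinear_op_def scaleC_op.rep_eq scaleC_scaleC mult.commute)

lemma clinear_op_word: "(\<And>i. clinear_op (X i)) \<Longrightarrow> clinear_op (op_word X \<alpha>)"
  by (induction \<alpha>) (simp_all add: clinear_op_id clinear_op_compose)

lemma scaleC_op_comm: "clinear_op S \<Longrightarrow> S o\<^sub>L scaleC_op c = scaleC_op c o\<^sub>L S"
  by (rule blinfun_eqI) (simp add: clinear_op_def scaleC_op.rep_eq)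

lemma scaleC_op_comm_compose: "clinear_op S \<Longrightarrow> S o\<^sub>L (scaleC_op c o\<^sub>L T) = scaleC_op c o\<^sub>L (S o\<^sub>L T)"
  by (simp add: scaleC_op_comm flip: blinfun_compose_assoc)

lemma scaleC_op_mult: "scaleC_op c o\<^sub>L (scaleC_op d o\<^sub>L T) = scaleC_op (c * d) o\<^sub>L T"
  by (rule blinfun_eqI) (simp add: scaleC_op.rep_eq scaleC_scaleC)

lemma scaleC_op_one: "scaleC_op 1 = id_blinfun"
  by (rule blinfun_eqI) (simp add: scaleC_op.rep_eq)

lemma scaleC_op_distrib: "scaleC_op (c + d) o\<^sub>L T = (scaleC_op c o\<^sub>L T) + (scaleC_op d o\<^sub>L T)"
  by (rule blinfun_eqI) (simp add: scaleC_op.rep_eq blinfun.add_left scaleC_add_left)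

lemma scaleC_op_zero: "scaleC_op 0 = 0"
  by (rule blinfun_eqI) (simp add: scaleC_op.rep_eq)

lemma op_polynomials_finite_sum:
  assumes "finite A"
  shows "(\<Sum>\<alpha>\<in>A. scaleC_op (c \<alpha>) o\<^sub>L op_word X \<alpha>) \<in> op_polynomials X"
proof -
  define p where "p = (\<lambda>\<alpha>. if \<alpha> \<in> A then c \<alpha> else 0)"
  have sub: "{\<alpha>. p \<alpha> \<noteq> 0} \<subseteq> A"
    by (auto simp: p_def)
  have "(\<Sum>\<alpha>\<in>A. scaleC_op (c \<alpha>) o\<^sub>L op_word X \<alpha>) = (\<Sum>\<alpha>\<in>A. scaleC_op (p \<alpha>) o\<^sub>L op_word X \<alpha>)"
    by (rule sum.cong) (simp_all add: p_def)
  also have "\<dots> = (\<Sum>\<alpha> | p \<alpha> \<noteq> 0. scaleC_op (p \<alpha>) o\<^sub>L op_word X \<alpha>)"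
    by (rule sum.mono_neutral_right) (use assms sub in \<open>auto simp: scaleC_op_zero\<close>)
  finally show ?thesis
    unfolding op_polynomials_def nc_polynomial_def using finite_subset[OF sub assms] by blast
qed

text \<open>A property need only respect sums and scaled words, which removes finite supports and
  index sets from the density arguments.\<close>

lemma op_polynomials_induct [consumes 1, case_names zero add word]:
  assumes "T \<in> op_polynomials X"
    and "Q 0" "\<And>S T. Q S \<Longrightarrow> Q T \<Longrightarrow> Q (S + T)" "\<And>c \<alpha>. Q (scaleC_op c o\<^sub>L op_word X \<alpha>)"
  shows "Q T"
proof -
  have "Q (\<Sum>\<alpha>\<in>A. scaleC_op (p \<alpha>) o\<^sub>L op_word X \<alpha>)" for A p
    by (induction A rule: infinite_finite_induct) (simp_all add: assms)
  then show ?thesis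
    using assms(1) by (auto simp: op_polynomials_def)
qed

lemma op_polynomials_zero: "0 \<in> op_polynomials X"
  using op_polynomials_finite_sum[of "{}"] by simp

lemma op_polynomials_word: "scaleC_op c o\<^sub>L op_word X \<alpha> \<in> op_polynomials X"
  using op_polynomials_finite_sum[of "{\<alpha>}" "\<lambda>_. c"] by simp

lemma op_polynomials_add:
  assumes "S \<in> op_polynomials X" "T \<in> op_polynomials X"
  shows "S + T \<in> op_polynomials X"
proof -
  obtain p q where pq: "finite {\<alpha>. p \<alpha> \<noteq> 0}" "finite {\<alpha>. q \<alpha> \<noteq> 0}"
    and S: "S = (\<Sum>\<alpha> | p \<alpha> \<noteq> 0. scaleC_op (p \<alpha>) o\<^sub>L op_word X \<alpha>)"
    and T: "T = (\<Sum>\<alpha> | q \<alpha> \<noteq> 0. scaleC_op (q \<alpha>) o\<^sub>L op_word X \<alpha>)"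
    using assms by (auto simp: op_polynomials_def nc_polynomial_def)
  let ?U = "{\<alpha>. p \<alpha> \<noteq> 0} \<union> {\<alpha>. q \<alpha> \<noteq> 0}"
  have "S = (\<Sum>\<alpha>\<in>?U. scaleC_op (p \<alpha>) o\<^sub>L op_word X \<alpha>)"
    unfolding S by (rule sum.mono_neutral_left) (use pq in \<open>auto simp: scaleC_op_zero\<close>)
  moreover have "T = (\<Sum>\<alpha>\<in>?U. scaleC_op (q \<alpha>) o\<^sub>L op_word X \<alpha>)"
    unfolding T by (rule sum.mono_neutral_left) (use pq in \<open>auto simp: scaleC_op_zero\<close>)
  ultimately have "S + T = (\<Sum>\<alpha>\<in>?U. scaleC_op (p \<alpha> + q \<alpha>) o\<^sub>L op_word X \<alpha>)"
    by (simp add: scaleC_op_distrib sum.distrib)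
  then show ?thesis
    using op_polynomials_finite_sum[of ?U "\<lambda>\<alpha>. p \<alpha> + q \<alpha>" X] pq by simp
qed

lemma op_polynomials_sum:
  "(\<And>a. a \<in> A \<Longrightarrow> f a \<in> op_polynomials X) \<Longrightarrow> (\<Sum>a\<in>A. f a) \<in> op_polynomials X"
  by (induction A rule: infinite_finite_induct) (simp_all add: op_polynomials_zero op_polynomials_add)

lemma op_polynomials_scale:
  assumes "T \<in> op_polynomials X"
  shows "scaleC_op c o\<^sub>L T \<in> op_polynomials X"
  using assms
  by (induction rule: op_polynomials_induct)
    (simp_all add: op_polynomials_zero op_polynomials_add op_polynomials_word
      blinfun_compose_add_right scaleC_op_mult)

lemma op_polynomials_compose:
  assumes X: "\<And>i. clinear_op (X i)" and "S \<in> op_polynomials X" "T \<in> op_polynomials X"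
  shows "S o\<^sub>L T \<in> op_polynomials X"
  using assms(2)
proof (induction rule: op_polynomials_induct)
  case (word c \<alpha>)
  show ?case
    using assms(3)
  proof (induction rule: op_polynomials_induct)
    case (word d \<beta>)
    have "(scaleC_op c o\<^sub>L op_word X \<alpha>) o\<^sub>L (scaleC_op d o\<^sub>L op_word X \<beta>)
        = scaleC_op (c * d) o\<^sub>L op_word X (\<alpha> @ \<beta>)"
      using clinear_op_word[of X, OF X]
      by (simp add: blinfun_compose_assoc scaleC_op_comm_compose scaleC_op_mult op_word_append)
    then show ?case
      by (simp add: op_polynomials_word)
  qed (simp_all add: op_polynomials_zero op_polynomials_add blinfun_compose_add_right)
qed (simp_all add: op_polynomials_zero op_polynomials_add blinfun_compose_add_left)

lemma op_polynomials_clinear: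
  assumes X: "\<And>i. clinear_op (X i)" and "T \<in> op_polynomials X"
  shows "clinear_op T"
  using assms(2)
  by (induction rule: op_polynomials_induct)
    (simp_all add: clinear_op_zero clinear_op_add clinear_op_compose clinear_op_scaleC_op
      clinear_op_word[OF X])

section \<open>The WOT closure of the polynomials as an algebra\<close>

lemma op_polynomials_subset_hardy: "op_polynomials M \<subseteq> hardy_algebra M"
  unfolding hardy_algebra_def by (rule closure_of_subset) simp

lemma hardy_algebra_closed: "closedin weak_operator_topology (hardy_algebra M)"
  by (simp add: hardy_algebra_def)

lemma hardy_algebra_minimal:
  assumes "T \<in> hardy_algebra M" "closedin weak_operator_topology C" "op_polynomials M \<subseteq> C"
  shows "T \<in> C"
  using closure_of_minimal[OF assms(3,2)] assms(1) by (auto simp: hardy_algebra_def)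

text \<open>The density argument used throughout: with one variable moving and the rest fixed, it is
  enough to check polynomials.\<close>

lemma hardy_algebra_lift:
  assumes "T \<in> hardy_algebra M"
    and "continuous_map weak_operator_topology weak_operator_topology F"
    and "closedin weak_operator_topology C" "\<And>p. p \<in> op_polynomials M \<Longrightarrow> F p \<in> C"
  shows "F T \<in> C"
  using hardy_algebra_minimal[OF assms(1) closedin_wot_preimage[OF assms(2,3)]] assms(4) by auto

locale clinear_tuple =
  fixes M :: "'n \<Rightarrow> 'a::chilbert_space \<Rightarrow>\<^sub>L 'a"
  assumes clinear: "\<And>i. clinear_op (M i)"
begin

lemma hardy_clinear: "T \<in> hardy_algebra M \<Longrightarrow> clinear_op T"
  using hardy_algebra_minimal[OF _ closedin_clinear_op, of T M] op_polynomials_clinear[of M, OF clinear]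
  by blast

lemma hardy_word: "op_word M \<alpha> \<in> hardy_algebra M"
  using op_polynomials_subset_hardy op_polynomials_word[of 1 M \<alpha>] by (auto simp: scaleC_op_one)

lemma hardy_id: "id_blinfun \<in> hardy_algebra M"
  using hardy_word[of "[]"] by simp

lemma hardy_gen: "M i \<in> hardy_algebra M"
  using hardy_word[of "[i]"] by simp

lemma hardy_zero: "0 \<in> hardy_algebra M"
  using op_polynomials_subset_hardy op_polynomials_zero by blast

lemma hardy_add:
  assumes "S \<in> hardy_algebra M" "T \<in> hardy_algebra M"
  shows "S + T \<in> hardy_algebra M"
proof (rule hardy_algebra_lift[OF assms(1) continuous_map_wot_add hardy_algebra_closed])
  fix p assume "p \<in> op_polynomials M"
  then have "T + p \<in> hardy_algebra M"
    using hardy_algebra_lift[OF assms(2) continuous_map_wot_add hardy_algebra_closed]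
      op_polynomials_add op_polynomials_subset_hardy by blast
  then show "p + T \<in> hardy_algebra M"
    by (simp add: add.commute)
qed

lemma hardy_scale:
  assumes "T \<in> hardy_algebra M"
  shows "scaleC_op c o\<^sub>L T \<in> hardy_algebra M"
  by (rule hardy_algebra_lift[OF assms continuous_map_wot_scale hardy_algebra_closed])
    (use op_polynomials_scale op_polynomials_subset_hardy in blast)

text \<open>Multiplication is only separately WOT-continuous. The right factor is taken to the limit
  against a fixed polynomial, and only then the left factor.\<close>

lemma hardy_compose:
  assumes "S \<in> hardy_algebra M" "T \<in> hardy_algebra M"
  shows "S o\<^sub>L T \<in> hardy_algebra M"
proof (rule hardy_algebra_lift[OF assms(1) continuous_map_wot_compose_right hardy_algebra_closed])
  fix p assume p: "p \<in> op_polynomials M"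
  show "p o\<^sub>L T \<in> hardy_algebra M"
    by (rule hardy_algebra_lift[OF assms(2) continuous_map_wot_compose_left hardy_algebra_closed])
      (use p op_polynomials_clinear[of M, OF clinear] op_polynomials_compose[of M, OF clinear]
        op_polynomials_subset_hardy in blast)+
qed

lemma hardy_diff:
  assumes "S \<in> hardy_algebra M" "T \<in> hardy_algebra M"
  shows "S - T \<in> hardy_algebra M"
proof -
  have "S - T = S + (scaleC_op (- 1) o\<^sub>L T)"
    by (rule blinfun_eqI) (simp add: blinfun.diff_left blinfun.add_left scaleC_op.rep_eq)
  then show ?thesis
    by (simp only: hardy_add hardy_scale assms)
qed

section \<open>Commutators of the Hardy algebra in a closed ideal that contains those of the
  generators\<close>

context
  fixes J
  assumes J: "wot_closed_ideal (hardy_algebra M) J"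
    and gens: "\<And>i j. (M i o\<^sub>L M j) - (M j o\<^sub>L M i) \<in> J"
begin

lemma ideal_facts:
  "closedin weak_operator_topology J" "0 \<in> J"
  "S \<in> J \<Longrightarrow> T \<in> J \<Longrightarrow> S + T \<in> J" "T \<in> J \<Longrightarrow> scaleC_op c o\<^sub>L T \<in> J"
  "R \<in> hardy_algebra M \<Longrightarrow> T \<in> J \<Longrightarrow> R o\<^sub>L T \<in> J"
  "R \<in> hardy_algebra M \<Longrightarrow> T \<in> J \<Longrightarrow> T o\<^sub>L R \<in> J"
  using J by (auto simp: wot_closed_ideal_def)

text \<open>For words this is the Leibniz rule [AB,C] = A[B,C] + [A,C]B, applied letter by letter;
  density then replaces words by arbitrary elements of the algebra.\<close>

lemma commutator_gen_in_ideal: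
  assumes "T \<in> hardy_algebra M"
  shows "(T o\<^sub>L M i) - (M i o\<^sub>L T) \<in> J"
proof (rule hardy_algebra_lift[OF assms continuous_map_wot_commutator[OF clinear] ideal_facts(1)])
  fix p assume "p \<in> op_polynomials M"
  then show "(p o\<^sub>L M i) - (M i o\<^sub>L p) \<in> J"
  proof (induction rule: op_polynomials_induct)
    case zero
    show ?case
      by (simp add: ideal_facts)
  next
    case (add S T)
    have "((S + T) o\<^sub>L M i) - (M i o\<^sub>L (S + T)) =
        ((S o\<^sub>L M i) - (M i o\<^sub>L S)) + ((T o\<^sub>L M i) - (M i o\<^sub>L T))"
      by (simp add: blinfun_compose_add_left blinfun_compose_add_right)
    then show ?case
      using add ideal_facts(3) by simp
  next
    case (word c \<alpha>)
    have "(op_word M \<alpha> o\<^sub>L M i) - (M i o\<^sub>L op_word M \<alpha>) \<in> J"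
    proof (induction \<alpha>)
      case (Cons j \<alpha>)
      have "(op_word M (j # \<alpha>) o\<^sub>L M i) - (M i o\<^sub>L op_word M (j # \<alpha>)) =
          (M j o\<^sub>L ((op_word M \<alpha> o\<^sub>L M i) - (M i o\<^sub>L op_word M \<alpha>)))
          + (((M j o\<^sub>L M i) - (M i o\<^sub>L M j)) o\<^sub>L op_word M \<alpha>)"
        by (rule blinfun_eqI) (simp add: blinfun.diff_left blinfun.add_left blinfun.diff_right)
      then show ?case
        using Cons gens hardy_gen hardy_word ideal_facts by simp
    qed (simp add: ideal_facts)
    then have "scaleC_op c o\<^sub>L ((op_word M \<alpha> o\<^sub>L M i) - (M i o\<^sub>L op_word M \<alpha>)) \<in> J"
      by (rule ideal_facts)
    moreover have "scaleC_op c o\<^sub>L ((op_word M \<alpha> o\<^sub>L M i) - (M i o\<^sub>L op_word M \<alpha>)) =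
        ((scaleC_op c o\<^sub>L op_word M \<alpha>) o\<^sub>L M i) - (M i o\<^sub>L (scaleC_op c o\<^sub>L op_word M \<alpha>))"
      using clinear[of i]
      by (intro blinfun_eqI) (simp add: blinfun.diff_left blinfun.diff_right clinear_op_def scaleC_op.rep_eq
          complex_vector.scale_right_diff_distrib)
    ultimately show ?case
      by simp
  qed
qed

text \<open>The second density pass: \<open>T\<close> is now arbitrary and the other argument runs
  through polynomials, with commutators against single generators already known to be in the
  ideal.\<close>

lemma commutator_in_ideal:
  assumes S: "S \<in> hardy_algebra M" and T: "T \<in> hardy_algebra M"
  shows "(S o\<^sub>L T) - (T o\<^sub>L S) \<in> J"
proof (rule hardy_algebra_lift[OF S continuous_map_wot_commutator[OF hardy_clinear[OF T]] ideal_facts(1)])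
  fix p assume "p \<in> op_polynomials M"
  then show "(p o\<^sub>L T) - (T o\<^sub>L p) \<in> J"
  proof (induction rule: op_polynomials_induct)
    case zero
    show ?case
      by (simp add: ideal_facts)
  next
    case (add R S)
    have "((R + S) o\<^sub>L T) - (T o\<^sub>L (R + S)) = ((R o\<^sub>L T) - (T o\<^sub>L R)) + ((S o\<^sub>L T) - (T o\<^sub>L S))"
      by (simp add: blinfun_compose_add_left blinfun_compose_add_right)
    then show ?case
      using add ideal_facts(3) by simp
  next
    case (word c \<alpha>)
    have "(op_word M \<alpha> o\<^sub>L T) - (T o\<^sub>L op_word M \<alpha>) \<in> J"
    proof (induction \<alpha>)
      case (Cons j \<alpha>)
      have "(T o\<^sub>L M j) - (M j o\<^sub>L T) \<in> J"
        by (rule commutator_gen_in_ideal[OF T])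
      \<comment> \<open>The Leibniz rule calls for the commutator in the opposite order, hence the
        sign.\<close>
      then have "scaleC_op (- 1) o\<^sub>L ((T o\<^sub>L M j) - (M j o\<^sub>L T)) \<in> J"
        by (rule ideal_facts)
      moreover have "(op_word M (j # \<alpha>) o\<^sub>L T) - (T o\<^sub>L op_word M (j # \<alpha>)) =
          (M j o\<^sub>L ((op_word M \<alpha> o\<^sub>L T) - (T o\<^sub>L op_word M \<alpha>)))
          + ((scaleC_op (- 1) o\<^sub>L ((T o\<^sub>L M j) - (M j o\<^sub>L T))) o\<^sub>L op_word M \<alpha>)"
        by (rule blinfun_eqI)
          (simp add: blinfun.diff_left blinfun.add_left blinfun.diff_right scaleC_op.rep_eq)
      ultimately show ?case
        using Cons hardy_gen hardy_word ideal_facts by simp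
    qed (simp add: ideal_facts)
    then have "scaleC_op c o\<^sub>L ((op_word M \<alpha> o\<^sub>L T) - (T o\<^sub>L op_word M \<alpha>)) \<in> J"
      by (rule ideal_facts)
    moreover have "scaleC_op c o\<^sub>L ((op_word M \<alpha> o\<^sub>L T) - (T o\<^sub>L op_word M \<alpha>)) =
        ((scaleC_op c o\<^sub>L op_word M \<alpha>) o\<^sub>L T) - (T o\<^sub>L (scaleC_op c o\<^sub>L op_word M \<alpha>))"
      using hardy_clinear[OF T]
      by (intro blinfun_eqI) (simp add: blinfun.diff_left blinfun.diff_right clinear_op_def scaleC_op.rep_eq
          complex_vector.scale_right_diff_distrib)
    ultimately show ?case
      by simp
  qed
qed

end

end


section \<open>Abel's limit theorem\<close>

text \<open>Summation by parts writes the deviation from \<open>y\<close> as 1 - r times the power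
  series of the errors of the partial sums. The theorem makes SOT values and radial values agree at
  scalar points.\<close>

lemma abel_limit:
  fixes h :: "nat \<Rightarrow> complex"
  assumes h: "h sums y"
  shows "((\<lambda>r. \<Sum>n. complex_of_real r ^ n * h n) \<longlongrightarrow> y) (at_left 1)"
proof -
  \<comment> \<open>The partial sum includes the term of index \<open>n\<close>, so that
    \<open>e 0 = h 0 - y\<close> and consecutive errors differ by exactly
    \<open>h (Suc n)\<close>.\<close>
  define e where "e = (\<lambda>n. (\<Sum>k<Suc n. h k) - y)"
  have "(\<lambda>n. \<Sum>k<Suc n. h k) \<longlonglongrightarrow> y"
    using h unfolding sums_def by (rule LIMSEQ_Suc)
  then have e0: "e \<longlonglongrightarrow> 0"
    unfolding e_def by (rule LIM_zero)
  then have "Bseq e"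
    using convergent_imp_Bseq convergent_def by blast
  then obtain C where C: "0 < C" "\<And>n. norm (e n) \<le> C"
    by (auto simp: Bseq_def)
  have geo: "(\<lambda>n. r ^ n) sums (1 / (1 - r))" if "0 < r" "r < 1" for r :: real
    using that by (intro geometric_sums) auto
  \<comment> \<open>The first \<open>N\<close> errors, each at most \<open>C\<close>, are damped by
    the factor 1 - r; the later ones add up to at most \<epsilon>/(1 - r) before damping.\<close>
  have bnd: "norm ((\<Sum>n. complex_of_real r ^ n * h n) - y) \<le> (1 - r) * (real N * C) + \<epsilon>"
    if r: "0 < r" "r < 1" and N: "\<And>n. n \<ge> N \<Longrightarrow> norm (e n) \<le> \<epsilon>" and "0 < \<epsilon>" for r N \<epsilon>
  proof -
    let ?r = "complex_of_real r"
    have nr: "norm (?r ^ n) = r ^ n" for n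
      using r by (simp add: norm_power)
    have le: "norm (e n * ?r ^ n) \<le> (if n < N then C else 0) + \<epsilon> * r ^ n" for n
    proof (cases "n < N")
      case True
      have "norm (e n) * r ^ n \<le> C * 1"
        using r C by (intro mult_mono) (auto simp: power_le_one)
      then show ?thesis
        using True r \<open>0 < \<epsilon>\<close> by (simp add: norm_mult nr) (smt (verit) mult_pos_pos zero_less_power)
    next
      case False
      then show ?thesis
        using N[of n] r by (simp add: norm_mult nr mult_right_mono)
    qed
    have sumC: "(\<lambda>n. if n < N then C else 0) sums (real N * C)"
      using sums_If_finite_set[of "{..<N}" "\<lambda>_. C"] by (simp cong: if_cong)
    have sumb: "(\<lambda>n. (if n < N then C else 0) + \<epsilon> * r ^ n) sums (real N * C + \<epsilon> * (1 / (1 - r)))"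
      by (intro sums_add sumC sums_mult geo r)
    have summe: "summable (\<lambda>n. e n * ?r ^ n)"
      by (rule summable_comparison_test'[OF sums_summable[OF sumb], of 0]) (use le in auto)
    define s where "s = (\<Sum>n. e n * ?r ^ n)"
    have s: "(\<lambda>n. e n * ?r ^ n) sums s"
      unfolding s_def by (rule summable_sums[OF summe])
    \<comment> \<open>Consecutive errors telescope to the terms of the series; the boundary term
      \<open>e 0\<close> is restored with \<open>h 0\<close> below.\<close>
    have "(\<lambda>n. e (Suc n) * ?r ^ Suc n - ?r * (e n * ?r ^ n)) sums ((s - e 0) - ?r * s)"
    proof (intro sums_diff sums_mult)
      show "(\<lambda>n. e (Suc n) * ?r ^ Suc n) sums (s - e 0)"
        unfolding sums_Suc_iff[of "\<lambda>n. e n * ?r ^ n"] using s by simp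
    qed (rule s)
    moreover have "e (Suc n) * ?r ^ Suc n - ?r * (e n * ?r ^ n) = ?r ^ Suc n * h (Suc n)" for n
      by (simp add: e_def algebra_simps)
    ultimately have "(\<lambda>n. ?r ^ Suc n * h (Suc n)) sums ((s - e 0) - ?r * s)"
      by simp
    then have "(\<lambda>n. ?r ^ n * h n) sums ((s - e 0) - ?r * s + h 0)"
      using sums_Suc_iff[of "\<lambda>n. ?r ^ n * h n" "(s - e 0) - ?r * s"] by simp
    then have "(\<Sum>n. ?r ^ n * h n) = (s - e 0) - ?r * s + h 0"
      by (rule sums_unique[symmetric])
    moreover have "e 0 = h 0 - y"
      by (simp add: e_def)
    ultimately have eq: "(\<Sum>n. ?r ^ n * h n) - y = (1 - ?r) * s"
      by (simp only:) (simp add: algebra_simps)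
    have "norm ((\<Sum>n. ?r ^ n * h n) - y) = (1 - r) * norm s"
    proof -
      have "1 - ?r = complex_of_real (1 - r)"
        by simp
      then have "norm (1 - ?r) = 1 - r"
        using r by (simp only: norm_of_real)
      with eq show ?thesis
        by (simp add: norm_mult)
    qed
    also have "\<dots> \<le> (1 - r) * (real N * C + \<epsilon> * (1 / (1 - r)))"
    proof (rule mult_left_mono)
      show "norm s \<le> real N * C + \<epsilon> * (1 / (1 - r))"
        unfolding s_def sums_unique[OF sumb] by (rule norm_suminf_le[OF le sums_summable[OF sumb]])
    qed (use r in simp)
    also have "\<dots> = (1 - r) * (real N * C) + \<epsilon>"
      using r by (simp add: distrib_left)
    finally show ?thesis .
  qed
  show ?thesis
    unfolding tendsto_iff
  proof (intro allI impI)
    fix \<epsilon> :: real assume "0 < \<epsilon>"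
    have "\<forall>\<^sub>F n in sequentially. norm (e n) < \<epsilon> / 2"
      using tendsto_norm_zero[OF e0] by (rule order_tendstoD) (use \<open>0 < \<epsilon>\<close> in simp)
    then obtain N where N: "\<And>n. n \<ge> N \<Longrightarrow> norm (e n) \<le> \<epsilon> / 2"
      unfolding eventually_sequentially using less_imp_le by blast
    have "((\<lambda>r. (1 - r) * (real N * C) + \<epsilon> / 2) \<longlongrightarrow> (1 - 1) * (real N * C) + \<epsilon> / 2) (at_left 1)"
      by (intro tendsto_intros)
    then have "\<forall>\<^sub>F r in at_left 1. (1 - r) * (real N * C) + \<epsilon> / 2 < \<epsilon>"
      by (rule order_tendstoD) (use \<open>0 < \<epsilon>\<close> in simp)
    moreover have "\<forall>\<^sub>F r in at_left 1. r \<in> {0<..<1::real}"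
      by (rule eventually_at_left_real) simp
    ultimately show "\<forall>\<^sub>F r in at_left 1. dist (\<Sum>n. complex_of_real r ^ n * h n) y < \<epsilon>"
    proof eventually_elim
      case (elim r)
      then show ?case
        using bnd[of r N "\<epsilon> / 2"] N \<open>0 < \<epsilon>\<close> by (auto simp: dist_norm)
    qed
  qed
qed


section \<open>Evaluation at scalar points\<close>

definition scalar_hom :: "'n::finite ncseries \<Rightarrow> ('n \<Rightarrow> complex) \<Rightarrow> nat \<Rightarrow> complex"
  where "scalar_hom c z k = (\<Sum>\<alpha> | length \<alpha> = k. c \<alpha> * scalar_word z \<alpha>)"

lemma bounded_linear_scaleC_op: "bounded_linear (scaleC_op :: complex \<Rightarrow> complex \<Rightarrow>\<^sub>L complex)"
proof (rule bounded_linear_intro[where K = 1])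
  fix c d :: complex and r :: real
  show "scaleC_op (c + d) = (scaleC_op c + scaleC_op d :: complex \<Rightarrow>\<^sub>L complex)"
    by (rule blinfun_eqI) (simp add: scaleC_op.rep_eq blinfun.add_left scaleC_add_left)
  show "scaleC_op (r *\<^sub>R c) = (r *\<^sub>R scaleC_op c :: complex \<Rightarrow>\<^sub>L complex)"
    by (rule blinfun_eqI) (simp add: scaleC_op.rep_eq blinfun.scaleR_left scaleC_complex_def)
  show "norm (scaleC_op c :: complex \<Rightarrow>\<^sub>L complex) \<le> norm c * 1"
    by (rule norm_blinfun_bound) (simp_all add: scaleC_op.rep_eq norm_scaleC)
qed

lemma scaleC_op_apply_1: "(scaleC_op c :: complex \<Rightarrow>\<^sub>L complex) 1 = c"
  by (simp add: scaleC_op.rep_eq scaleC_complex_def)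

lemma scaleC_op_inject [simp]: "(scaleC_op c :: complex \<Rightarrow>\<^sub>L complex) = scaleC_op d \<longleftrightarrow> c = d"
  using scaleC_op_apply_1 by metis

lemma clinear_op_complex:
  fixes T :: "complex \<Rightarrow>\<^sub>L complex"
  assumes "clinear_op T"
  shows "T = scaleC_op (T 1)"
proof (rule blinfun_eqI)
  fix x :: complex
  have "T (x *\<^sub>C 1) = x *\<^sub>C T 1"
    using assms by (simp add: clinear_op_def)
  then show "T x = scaleC_op (T 1) x"
    by (simp add: scaleC_op.rep_eq scaleC_complex_def mult.commute)
qed

lemma op_word_point: "op_word (\<lambda>i. scaleC_op (z i)) \<alpha> = (scaleC_op (scalar_word z \<alpha>) :: complex \<Rightarrow>\<^sub>L complex)"
proof (induction \<alpha>)
  case (Cons i \<alpha>)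
  then show ?case
    by (intro blinfun_eqI) (simp add: scaleC_op.rep_eq scaleC_scaleC)
qed (simp add: scaleC_op_one)

lemma nc_hom_point: "nc_hom c (\<lambda>i. scaleC_op (z i)) k = (scaleC_op (scalar_hom c z k) :: complex \<Rightarrow>\<^sub>L complex)"
  unfolding nc_hom_def scalar_hom_def op_word_point
    linear_sum[OF bounded_linear.linear[OF bounded_linear_scaleC_op]]
  by (rule sum.cong) (auto intro!: blinfun_eqI simp: scaleC_op.rep_eq scaleC_scaleC)

lemma op_word_scaleR: "op_word (\<lambda>i. r *\<^sub>R X i) \<alpha> = r ^ length \<alpha> *\<^sub>R op_word X \<alpha>"
  by (induction \<alpha>)
    (auto intro!: blinfun_eqI simp: blinfun.scaleR_left blinfun.scaleR_right)

lemma nc_hom_scaleR: "nc_hom c (\<lambda>i. r *\<^sub>R X i) k = r ^ k *\<^sub>R nc_hom c X k"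
  unfolding nc_hom_def scaleR_sum_right
  by (rule sum.cong)
    (auto intro!: blinfun_eqI simp: op_word_scaleR blinfun.scaleR_left blinfun.scaleR_right
      scaleC_op.rep_eq scaleR_scaleC scaleC_scaleC mult.commute)

lemma limitin_sot_apply:
  assumes "limitin strong_operator_topology u T F"
  shows "((\<lambda>n. u n x) \<longlongrightarrow> T x) F"
  using continuous_map_limit[OF strong_operator_topology_continuous_evaluation assms, of x]
  by (simp add: o_def)

lemma limitin_sot_of_norm:
  assumes "(u \<longlongrightarrow> T) F"
  shows "limitin strong_operator_topology u T F"
  using continuous_map_limit[OF strong_operator_topology_weaker_than_euclidean, of u T F] assms
  by (simp add: o_def)

text \<open>A priori the limit is only a real-linear map of the plane; closedness of complex
  linearity makes it a multiplication, and then strong convergence is convergence of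
  numbers.\<close>

lemma limitin_sot_scaleC_op:
  fixes T :: "complex \<Rightarrow>\<^sub>L complex"
  assumes "F \<noteq> bot"
  shows "limitin strong_operator_topology (\<lambda>n. scaleC_op (u n)) T F \<longleftrightarrow>
    (\<exists>y. T = scaleC_op y \<and> (u \<longlongrightarrow> y) F)"
proof
  assume lim: "limitin strong_operator_topology (\<lambda>n. scaleC_op (u n)) T F"
  have "T \<in> Collect clinear_op"
    by (rule limitin_closedin[OF lim closedin_sot_of_wot[OF closedin_clinear_op] _ assms])
      (simp add: clinear_op_scaleC_op)
  moreover have "(u \<longlongrightarrow> T 1) F"
    using limitin_sot_apply[OF lim, of 1] by (simp add: scaleC_op_apply_1)
  ultimately show "\<exists>y. T = scaleC_op y \<and> (u \<longlongrightarrow> y) F"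
    using clinear_op_complex by blast
next
  assume "\<exists>y. T = scaleC_op y \<and> (u \<longlongrightarrow> y) F"
  then show "limitin strong_operator_topology (\<lambda>n. scaleC_op (u n)) T F"
    using bounded_linear.tendsto[OF bounded_linear_scaleC_op] limitin_sot_of_norm by blast
qed

lemma sot_value_point:
  "sot_value f (\<lambda>i. scaleC_op (z i) :: complex \<Rightarrow>\<^sub>L complex) Y \<longleftrightarrow>
    (\<exists>y. Y = (\<lambda>j. scaleC_op (y j)) \<and> (\<forall>j. scalar_hom (f j) z sums y j))"
proof -
  have "(\<Sum>k<N. nc_hom c (\<lambda>i. scaleC_op (z i) :: complex \<Rightarrow>\<^sub>L complex) k) =
      scaleC_op (\<Sum>k<N. scalar_hom c z k)" for c N
    by (simp add: nc_hom_point linear_sum[OF bounded_linear.linear[OF bounded_linear_scaleC_op]])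
  then have "sot_value f (\<lambda>i. scaleC_op (z i) :: complex \<Rightarrow>\<^sub>L complex) Y \<longleftrightarrow>
      (\<forall>j. \<exists>y. Y j = scaleC_op y \<and> scalar_hom (f j) z sums y)"
    by (simp add: sot_value_def limitin_sot_scaleC_op sums_def)
  then show ?thesis
    by (auto simp: fun_eq_iff choice_iff all_conj_distrib)
qed

lemma rad_value_point:
  "rad_value f (\<lambda>i. scaleC_op (z i) :: complex \<Rightarrow>\<^sub>L complex) Y \<longleftrightarrow>
    (\<exists>\<delta>\<in>{0<..<1}. \<forall>r\<in>{\<delta><..<1}. \<forall>j. summable (\<lambda>k. complex_of_real r ^ k * scalar_hom (f j) z k)) \<and>
    (\<exists>y. Y = (\<lambda>j. scaleC_op (y j)) \<and>
      (\<forall>j. ((\<lambda>r. \<Sum>k. complex_of_real r ^ k * scalar_hom (f j) z k) \<longlongrightarrow> y j) (at_left 1)))"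
  (is "?L \<longleftrightarrow> ?S \<and> ?R")
proof -
  let ?X = "\<lambda>i. scaleC_op (z i) :: complex \<Rightarrow>\<^sub>L complex"
  have hom: "nc_hom c (\<lambda>i. r *\<^sub>R ?X i) k = scaleC_op (complex_of_real r ^ k * scalar_hom c z k)" for c r k
    by (subst nc_hom_scaleR, subst nc_hom_point)
      (simp add: linear_scale[OF bounded_linear.linear[OF bounded_linear_scaleC_op], symmetric]
        scaleR_conv_of_real)
  have summ: "summable (\<lambda>k. nc_hom c (\<lambda>i. r *\<^sub>R ?X i) k) \<longleftrightarrow>
      summable (\<lambda>k. complex_of_real r ^ k * scalar_hom c z k)" for c r
  proof
    assume "summable (\<lambda>k. nc_hom c (\<lambda>i. r *\<^sub>R ?X i) k)"
    from bounded_linear.summable[OF blinfun.bounded_linear_left this, of 1]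
    show "summable (\<lambda>k. complex_of_real r ^ k * scalar_hom c z k)"
      by (simp add: hom scaleC_op_apply_1)
  next
    assume "summable (\<lambda>k. complex_of_real r ^ k * scalar_hom c z k)"
    then show "summable (\<lambda>k. nc_hom c (\<lambda>i. r *\<^sub>R ?X i) k)"
      unfolding hom by (rule bounded_linear.summable[OF bounded_linear_scaleC_op])
  qed
  have lim: "limitin strong_operator_topology (\<lambda>r. nc_eval (f j) (\<lambda>i. r *\<^sub>R ?X i)) T (at_left 1) \<longleftrightarrow>
      (\<exists>y. T = scaleC_op y \<and>
        ((\<lambda>r. \<Sum>k. complex_of_real r ^ k * scalar_hom (f j) z k) \<longlongrightarrow> y) (at_left 1))"
    if S: ?S for j T
  proof -
    obtain \<delta> where \<delta>: "\<delta> < 1"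
      "\<And>r. r \<in> {\<delta><..<1} \<Longrightarrow> summable (\<lambda>k. complex_of_real r ^ k * scalar_hom (f j) z k)"
      using S by auto
    \<comment> \<open>\<open>nc_eval\<close> is an infinite sum, meaningful only where the series
      converges, that is beyond \<delta>; the two functions of \<open>r\<close> are therefore
      compared eventually.\<close>
    have ev: "\<forall>\<^sub>F r in at_left 1. nc_eval (f j) (\<lambda>i. r *\<^sub>R ?X i) =
        scaleC_op (\<Sum>k. complex_of_real r ^ k * scalar_hom (f j) z k)"
      using eventually_at_left_real[OF \<delta>(1)]
      by eventually_elim
        (simp add: nc_eval_def hom bounded_linear.suminf[OF bounded_linear_scaleC_op \<delta>(2)])
    then have ev': "\<forall>\<^sub>F r in at_left 1. scaleC_op (\<Sum>k. complex_of_real r ^ k * scalar_hom (f j) z k) =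
        nc_eval (f j) (\<lambda>i. r *\<^sub>R ?X i)"
      by eventually_elim (rule sym)
    have "limitin strong_operator_topology (\<lambda>r. nc_eval (f j) (\<lambda>i. r *\<^sub>R ?X i)) T (at_left 1) \<longleftrightarrow>
        limitin strong_operator_topology
          (\<lambda>r. scaleC_op (\<Sum>k. complex_of_real r ^ k * scalar_hom (f j) z k)) T (at_left 1)"
      using limitin_transform_eventually[OF ev] limitin_transform_eventually[OF ev'] by (intro iffI)
    then show ?thesis
      by (simp add: limitin_sot_scaleC_op trivial_limit_at_left_real)
  qed
  have "?L \<longleftrightarrow> ?S \<and> (\<forall>j. \<exists>y. Y j = scaleC_op y \<and>
      ((\<lambda>r. \<Sum>k. complex_of_real r ^ k * scalar_hom (f j) z k) \<longlongrightarrow> y) (at_left 1))"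
    unfolding rad_value_def summ using lim by blast
  then show ?thesis
    by (simp add: fun_eq_iff choice_iff all_conj_distrib)
qed

text \<open>Abel's theorem turns a value of either kind into the same radial limit. This justifies
  the definite description in \<open>tuple_value\<close> at scalar points.\<close>

lemma point_value_unique:
  fixes z :: "'n::finite \<Rightarrow> complex"
  defines "X \<equiv> (\<lambda>i. scaleC_op (z i) :: complex \<Rightarrow>\<^sub>L complex)"
  assumes "sot_value f X Y \<or> rad_value f X Y" "sot_value f X Y' \<or> rad_value f X Y'"
  shows "Y = Y'"
proof -
  have *: "\<exists>y. Y = (\<lambda>j. scaleC_op (y j)) \<and>
      (\<forall>j. ((\<lambda>r. \<Sum>k. complex_of_real r ^ k * scalar_hom (f j) z k) \<longlongrightarrow> y j) (at_left 1))"
    if "sot_value f X Y \<or> rad_value f X Y" for Y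
    using that
  proof
    assume "sot_value f X Y"
    then obtain y where "Y = (\<lambda>j. scaleC_op (y j))" "\<And>j. scalar_hom (f j) z sums y j"
      unfolding X_def sot_value_point by blast
    then show ?thesis
      by (intro exI[of _ y] conjI allI abel_limit)
  next
    assume "rad_value f X Y"
    then show ?thesis
      unfolding X_def rad_value_point by (elim conjE)
  qed
  obtain y y' where y: "Y = (\<lambda>j. scaleC_op (y j))" "Y' = (\<lambda>j. scaleC_op (y' j))"
    and lim: "\<And>j. ((\<lambda>r. \<Sum>k. complex_of_real r ^ k * scalar_hom (f j) z k) \<longlongrightarrow> y j) (at_left 1)"
      "\<And>j. ((\<lambda>r. \<Sum>k. complex_of_real r ^ k * scalar_hom (f j) z k) \<longlongrightarrow> y' j) (at_left 1)"
    using *[OF assms(2)] *[OF assms(3)] by (elim exE conjE) (rule that, auto)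
  have "y j = y' j" for j
    by (rule tendsto_unique[OF trivial_limit_at_left_real lim])
  then show ?thesis
    by (simp add: y)
qed

lemma tuple_value_point:
  fixes z :: "'n::finite \<Rightarrow> complex"
  defines "X \<equiv> (\<lambda>i. scaleC_op (z i) :: complex \<Rightarrow>\<^sub>L complex)"
  assumes "sot_value f X Y \<or> rad_value f X Y"
  shows "tuple_value f X = Y"
  unfolding tuple_value_def
proof (rule the_equality)
  fix Y' assume "sot_value f X Y' \<or> rad_value f X Y'"
  then show "Y' = Y"
    using assms(2) unfolding X_def by (rule point_value_unique)
qed (rule assms(2))

lemma row_norm_point:
  fixes l :: "complex^'n"
  shows "row_norm (point_op l) = norm l"
proof -
  have eq: "(\<lambda>h::complex^'n. \<Sum>i\<in>UNIV. point_op l i (h $ i)) = (\<lambda>h. \<Sum>i\<in>UNIV. l $ i * h $ i)"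
    by (simp add: point_op_def scaleC_op.rep_eq scaleC_complex_def)
  have bl: "bounded_linear (\<lambda>h::complex^'n. \<Sum>i\<in>UNIV. l $ i * h $ i)"
    by (intro bounded_linear_sum bounded_linear_const_mult bounded_linear_vec_nth)
  have "onorm (\<lambda>h::complex^'n. \<Sum>i\<in>UNIV. l $ i * h $ i) \<le> norm l"
  proof (rule onorm_le)
    fix h :: "complex^'n"
    have "norm (\<Sum>i\<in>UNIV. l $ i * h $ i) \<le> (\<Sum>i\<in>UNIV. \<bar>norm (l $ i)\<bar> * \<bar>norm (h $ i)\<bar>)"
      by (rule order_trans[OF norm_sum]) (simp add: norm_mult)
    also have "\<dots> \<le> L2_set (\<lambda>i. norm (l $ i)) UNIV * L2_set (\<lambda>i. norm (h $ i)) UNIV"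
      by (rule L2_set_mult_ineq)
    finally show "norm (\<Sum>i\<in>UNIV. l $ i * h $ i) \<le> norm l * norm h"
      by (simp add: norm_vec_def)
  qed
  moreover have "norm l \<le> onorm (\<lambda>h::complex^'n. \<Sum>i\<in>UNIV. l $ i * h $ i)"
  proof (cases "l = 0")
    case False
    \<comment> \<open>The conjugate vector is the equality case of Cauchy-Schwarz.\<close>
    define h :: "complex^'n" where "h = (\<chi> i. cnj (l $ i))"
    have nh: "norm h = norm l"
      by (simp add: norm_vec_def h_def)
    have "(\<Sum>i\<in>UNIV. l $ i * h $ i) = complex_of_real ((norm l)\<^sup>2)"
      by (simp add: h_def norm_vec_sum complex_norm_square del: of_real_power)
    then have "(norm l)\<^sup>2 \<le> onorm (\<lambda>h::complex^'n. \<Sum>i\<in>UNIV. l $ i * h $ i) * norm l"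
      using onorm[OF bl, of h] nh by (simp add: norm_power)
    then show ?thesis
      using False by (simp add: power2_eq_square)
  qed (simp add: onorm_zero)
  ultimately show ?thesis
    unfolding row_norm_def eq by (rule antisym)
qed


section \<open>The universal model on the Fock space\<close>

lemma has_sum_append_word:
  fixes h H :: "'n list \<Rightarrow> 'b::{topological_space,comm_monoid_add}"
  assumes "\<And>\<alpha>. H (\<alpha> @ \<beta>) = h \<alpha>" "\<And>w. w \<notin> range (\<lambda>\<alpha>. \<alpha> @ \<beta>) \<Longrightarrow> H w = 0"
  shows "(H has_sum s) UNIV \<longleftrightarrow> (h has_sum s) UNIV"
proof -
  have "(H has_sum s) UNIV \<longleftrightarrow> (H has_sum s) (range (\<lambda>\<alpha>. \<alpha> @ \<beta>))"
    by (rule has_sum_cong_neutral) (use assms(2) in auto)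
  also have "\<dots> \<longleftrightarrow> (h has_sum s) UNIV"
    by (subst has_sum_reindex) (simp_all add: inj_on_def o_def assms(1))
  finally show ?thesis .
qed

text \<open>Right multiplication by a word, the isometry that turns the coefficients of Z_i into
  those of Z_i times f_\<beta>.\<close>

lift_definition append_word :: "'n list \<Rightarrow> 'n list ell2 \<Rightarrow> 'n list ell2"
  is "\<lambda>\<beta> x w. if w \<in> range (\<lambda>\<alpha>. \<alpha> @ \<beta>) then x (take (length w - length \<beta>) w) else 0"
proof -
  fix \<beta> :: "'n list" and x :: "'n list \<Rightarrow> complex"
  assume "(\<lambda>i. (cmod (x i))\<^sup>2) summable_on UNIV"
  then obtain s where "((\<lambda>i. (cmod (x i))\<^sup>2) has_sum s) UNIV"
    by (auto simp: summable_on_def)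
  then have "((\<lambda>w. (cmod (if w \<in> range (\<lambda>\<alpha>. \<alpha> @ \<beta>) then x (take (length w - length \<beta>) w) else 0))\<^sup>2)
      has_sum s) UNIV"
    by (subst has_sum_append_word[where h = "\<lambda>i. (cmod (x i))\<^sup>2" and \<beta> = \<beta>]) auto
  then show "(\<lambda>w. (cmod (if w \<in> range (\<lambda>\<alpha>. \<alpha> @ \<beta>) then x (take (length w - length \<beta>) w) else 0))\<^sup>2)
      summable_on UNIV"
    by (rule has_sum_imp_summable)
qed

lemma Rep_append_word:
  "Rep_ell2 (append_word \<beta> x) (\<alpha> @ \<beta>) = Rep_ell2 x \<alpha>"
  "w \<notin> range (\<lambda>\<alpha>. \<alpha> @ \<beta>) \<Longrightarrow> Rep_ell2 (append_word \<beta> x) w = 0"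
  by (auto simp: append_word.rep_eq)

lemma append_word_unit: "append_word \<beta> (ell2_unit \<alpha>) = ell2_unit (\<alpha> @ \<beta>)"
  by (rule ell2_eqI) (auto simp: append_word.rep_eq ell2_unit.rep_eq)

lemma fock_eval_append_word:
  assumes "norm l < 1"
  shows "fock_eval l (append_word \<beta> x) = fock_eval l x * scalar_word (($) l) \<beta>"
proof (rule has_sum_unique)
  show "((\<lambda>w. Rep_ell2 (append_word \<beta> x) w * scalar_word (($) l) w) has_sum
      fock_eval l (append_word \<beta> x)) UNIV"
    by (rule fock_eval_has_sum[OF assms])
  show "((\<lambda>w. Rep_ell2 (append_word \<beta> x) w * scalar_word (($) l) w) has_sum
      fock_eval l x * scalar_word (($) l) \<beta>) UNIV"
    by (rule has_sum_append_word[where \<beta> = \<beta>, THEN iffD2,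
          OF _ _ has_sum_cmult_left[OF fock_eval_has_sum[OF assms, of x], of "scalar_word (($) l) \<beta>"]])
      (auto simp: Rep_append_word scalar_word_append)
qed

text \<open>A letter is bubbled to the front by adjacent swaps. The prefix \<delta> carries the part
  on which the words already agree through the induction.\<close>

lemma adjacent_swaps_imp_symmetric:
  fixes x :: "'n list \<Rightarrow> 'b"
  assumes swap: "\<And>\<alpha> i j \<beta>. x (\<alpha> @ i # j # \<beta>) = x (\<alpha> @ j # i # \<beta>)"
    and "count_list u = count_list v"
  shows "x u = x v"
proof -
  have move: "x (\<delta> @ \<alpha> @ a # \<beta>) = x (\<delta> @ a # \<alpha> @ \<beta>)" for \<delta> \<alpha> a \<beta>
  proof (induction \<alpha> arbitrary: \<delta>)
    case (Cons b \<alpha>)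
    have "x (\<delta> @ (b # \<alpha>) @ a # \<beta>) = x ((\<delta> @ [b]) @ \<alpha> @ a # \<beta>)"
      by simp
    also have "\<dots> = x ((\<delta> @ [b]) @ a # \<alpha> @ \<beta>)"
      by (rule Cons)
    also have "\<dots> = x (\<delta> @ a # (b # \<alpha>) @ \<beta>)"
      using swap[of \<delta> b a "\<alpha> @ \<beta>"] by simp
    finally show ?case .
  qed simp
  have "x (\<delta> @ u) = x (\<delta> @ v)" if "mset u = mset v" for \<delta>
    using that
  proof (induction u arbitrary: \<delta> v)
    case (Cons a u)
    then have "a \<in> set v"
      by (metis list.set_intros(1) set_mset_mset)
    then obtain v1 v2 where v: "v = v1 @ a # v2"
      by (meson split_list)
    then have "x ((\<delta> @ [a]) @ u) = x ((\<delta> @ [a]) @ v1 @ v2)"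
      using Cons.prems by (intro Cons.IH) simp
    then show ?case
      using move[of \<delta> v1 a v2] by (simp add: v)
  qed simp
  moreover have "mset u = mset v"
    using assms(2) by (auto simp: multiset_eq_iff count_mset)
  ultimately show ?thesis
    by (metis append_Nil)
qed

text \<open>Uniqueness of the derivative at an interior point yields the calculus rules for
  \<open>fock_deriv\<close> without computing with the resolvent.\<close>

lemma fock_deriv_eqI:
  assumes l: "norm l < 1" and "\<And>m. norm m < 1 \<Longrightarrow> fock_eval m x = \<phi> m"
    and "(\<phi> has_derivative D) (at l)"
  shows "fock_deriv l h x = D h"
proof -
  have "((\<lambda>m. fock_eval m x) has_derivative D) (at l)"
    by (rule has_derivative_transform_within_open[OF assms(3), of "ball 0 1"])
      (use l assms(2) in auto)
  then show ?thesis
    using has_derivative_unique[OF fock_eval_has_derivative[OF l]] by metis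
qed

text \<open>The common core of the three kinds of models: \<open>G i\<close> holds the coefficients
  of Z_i, and \<open>Y\<close> is f(M), whose action on basis vectors makes it the tuple of left
  creation operators. Both modes of convergence are carried along, since either may be the one
  granted by the model property.\<close>

locale fock_model = clinear_tuple M
  for f :: "'n::finite \<Rightarrow> 'n ncseries" and G :: "'n \<Rightarrow> 'n list ell2"
    and M :: "'n \<Rightarrow> 'n list ell2 \<Rightarrow>\<^sub>L 'n list ell2" +
  fixes Y :: "'n \<Rightarrow> 'n list ell2 \<Rightarrow>\<^sub>L 'n list ell2"
  assumes M_unit: "M i (ell2_unit \<beta>) = append_word \<beta> (G i)"
    and Y_unit: "Y j (ell2_unit \<beta>) = ell2_unit (j # \<beta>)"
    and Y_value: "sot_value f M Y \<or> rad_value f M Y"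
begin

text \<open>The point g(l), named after g being the compositional inverse of f.\<close>

definition inv_point :: "complex^'n \<Rightarrow> complex^'n"
  where "inv_point l = (\<chi> i. fock_eval l (G i))"

lemma fock_eval_M:
  assumes "norm l < 1"
  shows "fock_eval l (M i x) = inv_point l $ i * fock_eval l x"
proof (rule bounded_clinear_ell2_eqI)
  show "bounded_linear (\<lambda>x. fock_eval l (M i x))"
    by (intro bounded_linear_compose[OF bounded_linear_fock_eval] blinfun.bounded_linear_right)
  show "bounded_linear (\<lambda>x. inv_point l $ i * fock_eval l x)"
    by (intro bounded_linear_const_mult bounded_linear_fock_eval)
  show "fock_eval l (M i (c *\<^sub>C x)) = c *\<^sub>C fock_eval l (M i x)" for c x
    using clinear[of i] by (simp add: clinear_op_def fock_eval_scaleC scaleC_complex_def)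
  show "inv_point l $ i * fock_eval l (c *\<^sub>C x) = c *\<^sub>C (inv_point l $ i * fock_eval l x)" for c x
    by (simp add: fock_eval_scaleC scaleC_complex_def)
  show "fock_eval l (M i (ell2_unit \<beta>)) = inv_point l $ i * fock_eval l (ell2_unit \<beta>)" for \<beta>
    by (simp add: M_unit fock_eval_append_word fock_eval_unit assms inv_point_def)
qed

lemma fock_eval_op_word:
  assumes "norm l < 1"
  shows "fock_eval l (blinfun_apply (op_word M \<alpha>) x) = scalar_word (($) (inv_point l)) \<alpha> * fock_eval l x"
  by (induction \<alpha>) (simp_all add: fock_eval_M[OF assms])

lemma fock_eval_nc_hom:
  assumes "norm l < 1"
  shows "fock_eval l (nc_hom c M k x) = scalar_hom c (($) (inv_point l)) k * fock_eval l x"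
  by (simp add: nc_hom_def scalar_hom_def blinfun.sum_left fock_eval_sum scaleC_op.rep_eq
      fock_eval_scaleC fock_eval_op_word[OF assms] sum_distrib_right mult.assoc)

lemma fock_eval_empty: "norm l < 1 \<Longrightarrow> fock_eval l (ell2_unit []) = 1"
  by (simp add: fock_eval_unit)

lemma fock_eval_Y: "norm l < 1 \<Longrightarrow> fock_eval l (Y j (ell2_unit [])) = l $ j"
  by (simp add: Y_unit fock_eval_unit)

lemma bounded_linear_fock_eval_op: "bounded_linear (\<lambda>T. fock_eval l (blinfun_apply T x))"
  by (intro bounded_linear_compose[OF bounded_linear_fock_eval] blinfun.bounded_linear_left)

text \<open>This is f(g(l)) = l. Applying the series of f at M to the vacuum vector
  \<open>ell2_unit []\<close> and pairing with a Szego vector turns it into the scalar series at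
  g(l), and the mode of convergence carries over.\<close>

lemma inv_point_value:
  assumes l: "norm l < 1"
  shows "sot_value f (point_op (inv_point l)) (point_op l) \<or>
    rad_value f (point_op (inv_point l)) (point_op l)"
  using Y_value
proof
  assume sot: "sot_value f M Y"
  have "scalar_hom (f j) (($) (inv_point l)) sums (l $ j)" for j
  proof -
    have "((\<lambda>N. (\<Sum>k<N. nc_hom (f j) M k) (ell2_unit [])) \<longlongrightarrow> Y j (ell2_unit [])) sequentially"
      using sot by (intro limitin_sot_apply) (simp add: sot_value_def)
    from bounded_linear.tendsto[OF bounded_linear_fock_eval this, of l] show ?thesis
      by (simp add: sums_def blinfun.sum_left fock_eval_sum fock_eval_nc_hom l fock_eval_empty fock_eval_Y)
  qed
  then have "sot_value f (point_op (inv_point l)) (point_op l)"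
    unfolding point_op_def sot_value_point by (intro exI[of _ "($) l"]) simp
  then show ?thesis ..
next
  assume rad: "rad_value f M Y"
  then obtain \<delta> where \<delta>: "0 < \<delta>" "\<delta> < 1"
    "\<And>r j. r \<in> {\<delta><..<1} \<Longrightarrow> summable (\<lambda>k. nc_hom (f j) (\<lambda>i. r *\<^sub>R M i) k)"
    by (auto simp: rad_value_def)
  have hom: "fock_eval l (nc_hom c (\<lambda>i. r *\<^sub>R M i) k (ell2_unit [])) =
      complex_of_real r ^ k * scalar_hom c (($) (inv_point l)) k" for c r k
    by (simp add: nc_hom_scaleR blinfun.scaleR_left scaleR_scaleC fock_eval_scaleC
        fock_eval_nc_hom l fock_eval_empty)
  have summ: "summable (\<lambda>k. complex_of_real r ^ k * scalar_hom (f j) (($) (inv_point l)) k)"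
    if "r \<in> {\<delta><..<1}" for r j
    using bounded_linear.summable[OF bounded_linear_fock_eval_op \<delta>(3)[OF that], of l _ "ell2_unit []"]
    by (simp add: hom)
  have lim: "((\<lambda>r. \<Sum>k. complex_of_real r ^ k * scalar_hom (f j) (($) (inv_point l)) k) \<longlongrightarrow> l $ j)
      (at_left 1)" for j
  proof -
    have "((\<lambda>r. nc_eval (f j) (\<lambda>i. r *\<^sub>R M i) (ell2_unit [])) \<longlongrightarrow> Y j (ell2_unit [])) (at_left 1)"
      using rad by (intro limitin_sot_apply) (simp add: rad_value_def)
    from bounded_linear.tendsto[OF bounded_linear_fock_eval this, of l]
    have "((\<lambda>r. fock_eval l (nc_eval (f j) (\<lambda>i. r *\<^sub>R M i) (ell2_unit []))) \<longlongrightarrow> l $ j) (at_left 1)"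
      by (simp add: fock_eval_Y l)
    moreover have "\<forall>\<^sub>F r in at_left 1. fock_eval l (nc_eval (f j) (\<lambda>i. r *\<^sub>R M i) (ell2_unit [])) =
        (\<Sum>k. complex_of_real r ^ k * scalar_hom (f j) (($) (inv_point l)) k)"
      using eventually_at_left_real[OF \<delta>(2)]
    proof eventually_elim
      case (elim r)
      show ?case
        unfolding nc_eval_def
        by (simp add: bounded_linear.suminf[OF bounded_linear_fock_eval_op \<delta>(3)[OF elim]] hom)
    qed
    ultimately show ?thesis
      by (rule Lim_transform_eventually)
  qed
  have "rad_value f (point_op (inv_point l)) (point_op l)"
    unfolding point_op_def rad_value_point
  proof (intro conjI)
    show "\<exists>\<delta>\<in>{0<..<1}. \<forall>r\<in>{\<delta><..<1}. \<forall>j.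
        summable (\<lambda>k. complex_of_real r ^ k * scalar_hom (f j) (($) (inv_point l)) k)"
      using \<delta>(1,2) summ by (intro bexI[of _ \<delta>] ballI allI) auto
    show "\<exists>y. (\<lambda>i. scaleC_op (l $ i)) = (\<lambda>j. scaleC_op (y j)) \<and>
        (\<forall>j. ((\<lambda>r. \<Sum>k. complex_of_real r ^ k * scalar_hom (f j) (($) (inv_point l)) k) \<longlongrightarrow> y j)
          (at_left 1))"
      using lim by (intro exI[of _ "($) l"]) simp
  qed
  then show ?thesis ..
qed

section \<open>The scalar domain as the image of the ball\<close>

lemma sot_value_inverse:
  assumes l: "norm l < 1"
  shows "sot_value (\<lambda>i. Rep_ell2 (G i)) (point_op l) (point_op (inv_point l))"
  unfolding point_op_def sot_value_point
  using fock_eval_sums[OF l]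
  by (intro exI[of _ "($) (inv_point l)"]) (simp add: inv_point_def scalar_hom_def[abs_def])

lemma tuple_value_inv_point:
  "norm l < 1 \<Longrightarrow> tuple_value f (point_op (inv_point l)) = point_op l"
  using tuple_value_point[of f "($) (inv_point l)" "point_op l"] inv_point_value[of l]
  by (simp add: point_op_def[abs_def])

lemma point_value_inv_point:
  "norm l < 1 \<Longrightarrow> point_value f (inv_point l) = ($) l"
  by (simp add: fun_eq_iff point_value_def tuple_value_inv_point)
    (simp add: point_op_def scaleC_op_apply_1)

lemma inv_point_in_domain:
  assumes l: "norm l < 1"
  shows "inv_point l \<in> scalar_domain f (\<lambda>i. Rep_ell2 (G i))"
proof -
  have "clinear_op (point_op z i)" for z i
    by (simp add: point_op_def clinear_op_scaleC_op)
  then have "point_op (inv_point l) \<in> conv_SOT f \<union> conv_rad f"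
    using inv_point_value[OF l] by (auto simp: conv_SOT_def conv_rad_def)
  then show ?thesis
    using sot_value_inverse[OF l] l
    by (simp add: scalar_domain_def nc_domain_def inverts_def tuple_value_inv_point row_norm_point)
qed

lemma scalar_domain_eq: "scalar_domain f (\<lambda>i. Rep_ell2 (G i)) = inv_point ` ball 0 1"
proof (intro equalityI subsetI)
  fix z assume "z \<in> scalar_domain f (\<lambda>i. Rep_ell2 (G i))"
  then have conv: "point_op z \<in> conv_SOT f \<union> conv_rad f"
    and inv: "sot_value (\<lambda>i. Rep_ell2 (G i)) (tuple_value f (point_op z)) (point_op z) \<or>
      rad_value (\<lambda>i. Rep_ell2 (G i)) (tuple_value f (point_op z)) (point_op z)"
    and less: "row_norm (tuple_value f (point_op z)) < 1"
    by (auto simp: scalar_domain_def nc_domain_def inverts_def)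
  obtain Z where Z: "sot_value f (point_op z) Z \<or> rad_value f (point_op z) Z"
    using conv by (auto simp: conv_SOT_def conv_rad_def)
  then obtain y where y: "Z = (\<lambda>j. scaleC_op (y j))"
    unfolding point_op_def sot_value_point rad_value_point by blast
  have val: "tuple_value f (point_op z) = Z"
    using tuple_value_point[of f "($) z" Z] Z by (simp add: point_op_def[abs_def])
  define l where "l = vec_lambda y"
  have Zl: "Z = point_op l"
    by (simp add: y l_def point_op_def[abs_def])
  have l: "norm l < 1"
    using less by (simp add: val Zl row_norm_point)
  have pl: "(\<lambda>i. scaleC_op (l $ i)) = point_op l"
    by (simp add: point_op_def[abs_def])
  \<comment> \<open>Both are values of g at \<open>l\<close>: the left one because \<open>z\<close>
    lies in the domain, in whichever mode, the right one by absolute convergence. Uniqueness of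
    values identifies them.\<close>
  have "point_op z = point_op (inv_point l)"
    by (rule point_value_unique[of "\<lambda>i. Rep_ell2 (G i)" "($) l", unfolded pl, OF inv[unfolded val Zl]])
      (rule disjI1[OF sot_value_inverse[OF l]])
  then have "z = inv_point l"
    by (simp add: point_op_def fun_eq_iff vec_eq_iff)
  then show "z \<in> inv_point ` ball 0 1"
    using l by auto
qed (use inv_point_in_domain in auto)

text \<open>In the radial mode two limits are nested, a norm limit of partial sums for each r and
  then r tending to 1. Membership of \<open>Y\<close> in the Hardy algebra and injectivity of the
  derivative of g both come from here, with different sets \<open>C\<close>.\<close>

lemma sot_closed_contains_Y:
  assumes C: "closedin strong_operator_topology C" and P: "op_polynomials M \<subseteq> C"
  shows "Y j \<in> C"
proof -
  have hom: "nc_hom c M k \<in> op_polynomials M" for c k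
    unfolding nc_hom_def by (rule op_polynomials_finite_sum) (rule finite_words_length)
  have homr: "nc_hom c (\<lambda>i. r *\<^sub>R M i) k \<in> op_polynomials M" for c r k
  proof -
    have "nc_hom c (\<lambda>i. r *\<^sub>R M i) k = scaleC_op (complex_of_real (r ^ k)) o\<^sub>L nc_hom c M k"
      by (rule blinfun_eqI) (simp add: nc_hom_scaleR blinfun.scaleR_left scaleC_op.rep_eq scaleR_scaleC)
    then show ?thesis
      using op_polynomials_scale[OF hom] by simp
  qed
  show ?thesis
    using Y_value
  proof
    assume "sot_value f M Y"
    then have "limitin strong_operator_topology (\<lambda>N. \<Sum>k<N. nc_hom (f j) M k) (Y j) sequentially"
      by (simp add: sot_value_def)
    then show ?thesis
      by (rule limitin_closedin[OF _ C])
        (use P in \<open>auto intro!: always_eventually subsetD[OF P] op_polynomials_sum hom\<close>)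
  next
    assume rad: "rad_value f M Y"
    then obtain \<delta> where \<delta>: "\<delta> < 1"
      "\<And>r j. r \<in> {\<delta><..<1} \<Longrightarrow> summable (\<lambda>k. nc_hom (f j) (\<lambda>i. r *\<^sub>R M i) k)"
      by (auto simp: rad_value_def)
    have "nc_eval (f j) (\<lambda>i. r *\<^sub>R M i) \<in> C" if r: "r \<in> {\<delta><..<1}" for r
    proof (rule limitin_closedin[OF limitin_sot_of_norm C])
      show "(\<lambda>N. \<Sum>k<N. nc_hom (f j) (\<lambda>i. r *\<^sub>R M i) k) \<longlonglongrightarrow> nc_eval (f j) (\<lambda>i. r *\<^sub>R M i)"
        unfolding nc_eval_def using summable_LIMSEQ[OF \<delta>(2)[OF r]] .
    qed (auto intro!: always_eventually subsetD[OF P] op_polynomials_sum homr)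
    then have "\<forall>\<^sub>F r in at_left 1. nc_eval (f j) (\<lambda>i. r *\<^sub>R M i) \<in> C"
      using eventually_at_left_real[OF \<delta>(1)] by (rule eventually_mono[rotated])
    moreover have "limitin strong_operator_topology (\<lambda>r. nc_eval (f j) (\<lambda>i. r *\<^sub>R M i)) (Y j) (at_left 1)"
      using rad by (simp add: rad_value_def)
    ultimately show ?thesis
      by (intro limitin_closedin[OF _ C]) (auto simp: trivial_limit_at_left_real)
  qed
qed

lemma Y_in_hardy: "Y j \<in> hardy_algebra M"
  by (rule sot_closed_contains_Y[OF closedin_sot_of_wot[OF hardy_algebra_closed]
        op_polynomials_subset_hardy])


subsection \<open>The commutator ideal\<close>

text \<open>Polynomials in M act on evaluations at \<open>l\<close> as scalars. With
  \<open>x\<close> fixed the identity is linear in the operator and involves only matrix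
  coefficients, so it persists in the WOT closure.\<close>

lemma fock_eval_hardy:
  assumes l: "norm l < 1" and S: "S \<in> hardy_algebra M"
  shows "fock_eval l (S x) = fock_eval l (S (ell2_unit [])) * fock_eval l x"
proof -
  have "S \<in> {T. fock_eval l x * fock_eval l (blinfun_apply T (ell2_unit [])) - fock_eval l (blinfun_apply T x) = 0}"
  proof (rule hardy_algebra_minimal[OF S])
    show "closedin weak_operator_topology
        {T. fock_eval l x * fock_eval l (blinfun_apply T (ell2_unit [])) - fock_eval l (blinfun_apply T x) = 0}"
      unfolding fock_eval_def
      by (intro closedin_eq_0 continuous_map_diff continuous_map_scale continuous_map_wot_cinner) simp
    show "op_polynomials M \<subseteq> {T. fock_eval l x * fock_eval l (blinfun_apply T (ell2_unit [])) - fock_eval l (blinfun_apply T x) = 0}"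
    proof
      fix p assume "p \<in> op_polynomials M"
      then show "p \<in> {T. fock_eval l x * fock_eval l (blinfun_apply T (ell2_unit [])) - fock_eval l (blinfun_apply T x) = 0}"
      proof (induction rule: op_polynomials_induct)
        case zero
        show ?case
          by (simp add: fock_eval_def)
      next
        case (add S T)
        then show ?case
          by (simp add: blinfun.add_left fock_eval_add algebra_simps)
      next
        case (word c \<alpha>)
        show ?case
          by (simp add: scaleC_op.rep_eq fock_eval_scaleC fock_eval_op_word[OF l] fock_eval_empty[OF l])
      qed
    qed
  qed
  then show ?thesis
    by (simp add: mult.commute)
qed

text \<open>The operators annihilated by evaluation at \<open>l\<close> form a WOT-closed ideal
  containing the commutators, so the hull lies inside. Quantifying over all \<open>x\<close> makes
  the set stable under multiplication on the right.\<close>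

lemma fock_eval_commutator_ideal:
  assumes l: "norm l < 1" and "T \<in> commutator_ideal M"
  shows "fock_eval l (T x) = 0"
proof -
  define I where "I = hardy_algebra M \<inter> (\<Inter>x. {T. fock_eval l (blinfun_apply T x) = 0})"
  have "closedin weak_operator_topology {T. fock_eval l (blinfun_apply T x) = 0}" for x
    unfolding fock_eval_def by (intro closedin_eq_0 continuous_map_wot_cinner) simp
  then have closed: "closedin weak_operator_topology I"
    unfolding I_def by (intro closedin_Int hardy_algebra_closed closedin_INT) auto
  \<comment> \<open>Stability on the left, where the multiplier acts on evaluations as a
    scalar.\<close>
  have left: "fock_eval l (S (T x)) = 0" if "S \<in> hardy_algebra M" "fock_eval l (T x) = 0" for S T x
    using fock_eval_hardy[OF l that(1), of "T x"] that(2) by simp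
  have "wot_closed_ideal (hardy_algebra M) I"
    unfolding wot_closed_ideal_def
    by (intro conjI ballI allI closed)
      (auto simp: I_def hardy_zero hardy_add hardy_scale hardy_compose blinfun.add_left
        fock_eval_add scaleC_op.rep_eq fock_eval_scaleC left linear_0[OF bounded_linear.linear[OF bounded_linear_fock_eval]])
  moreover have "{(M i o\<^sub>L M j) - (M j o\<^sub>L M i) | i j. True} \<subseteq> I"
    by (auto simp: I_def hardy_diff hardy_compose hardy_gen blinfun.diff_left fock_eval_diff
        fock_eval_M[OF l])
  ultimately have "commutator_ideal M \<subseteq> I"
    unfolding commutator_ideal_def by (intro hull_minimal)
  then show ?thesis
    using assms(2) by (auto simp: I_def)
qed

lemma Y_word_unit: "blinfun_apply (op_word Y \<alpha>) (ell2_unit \<beta>) = ell2_unit (\<alpha> @ \<beta>)"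
  by (induction \<alpha>) (simp_all add: Y_unit)

lemma Y_word_hardy: "op_word Y \<alpha> \<in> hardy_algebra M"
  by (induction \<alpha>) (simp_all add: hardy_id hardy_compose Y_in_hardy)

text \<open>Applied to the vacuum vector, this operator gives the difference of two basis vectors
  whose words differ by one adjacent swap. As the ideal is generated by commutators of
  \<open>M\<close>, those of \<open>Y\<close> are reached through membership of \<open>Y\<close> in
  the Hardy algebra.\<close>

lemma swap_in_commutator_ideal:
  "op_word Y \<alpha> o\<^sub>L (((Y i o\<^sub>L Y j) - (Y j o\<^sub>L Y i)) o\<^sub>L op_word Y \<beta>) \<in> commutator_ideal M"
  unfolding commutator_ideal_def hull_def
proof (rule InterI, elim CollectE conjE)
  fix J
  assume J: "wot_closed_ideal (hardy_algebra M) J"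
    and sub: "{(M i o\<^sub>L M j) - (M j o\<^sub>L M i) | i j. True} \<subseteq> J"
  then have gens: "(M i o\<^sub>L M j) - (M j o\<^sub>L M i) \<in> J" for i j
    by blast
  show "op_word Y \<alpha> o\<^sub>L (((Y i o\<^sub>L Y j) - (Y j o\<^sub>L Y i)) o\<^sub>L op_word Y \<beta>) \<in> J"
    by (intro ideal_facts[OF J gens] Y_word_hardy commutator_in_ideal[OF J gens] Y_in_hardy)
qed

text \<open>The swap operators force symmetry of any vector orthogonal to J_c(1). Conversely J_c(1)
  is orthogonal to every Szego vector, and these span the symmetric families.\<close>

lemma model_subspace_eq: "model_subspace M = symmetric_families"
proof (intro equalityI subsetI)
  fix x assume "x \<in> model_subspace M"
  then have orth: "cinner x (blinfun_apply T (ell2_unit [])) = 0" if "T \<in> commutator_ideal M" for T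
    using that closure_subset[of "(\<lambda>A. blinfun_apply A (ell2_unit [])) ` commutator_ideal M"]
    by (auto simp: model_subspace_def orthogonal_complement_def)
  have "Rep_ell2 x (\<alpha> @ i # j # \<beta>) = Rep_ell2 x (\<alpha> @ j # i # \<beta>)" for \<alpha> i j \<beta>
    using orth[OF swap_in_commutator_ideal[of \<alpha> i j \<beta>]]
    by (simp add: Y_word_unit Y_unit blinfun.diff_left blinfun.diff_right cinner_diff_right
        cinner_ell2_unit_right)
  then show "x \<in> symmetric_families"
    unfolding symmetric_families_def mem_Collect_eq
    by (intro allI impI) (rule adjacent_swaps_imp_symmetric)
next
  fix x :: "'n list ell2" assume x: "x \<in> symmetric_families"
  define N where "N = (\<lambda>A. blinfun_apply A (ell2_unit [])) ` commutator_ideal M"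
  have "closure N \<subseteq> {y. cinner y x = 0}"
  proof (rule closure_minimal[OF _ closed_cinner_eq_0], rule subsetI)
    fix y assume "y \<in> N"
    then obtain A where A: "A \<in> commutator_ideal M" "y = A (ell2_unit [])"
      by (auto simp: N_def)
    have "closure (cspan (szego_vector ` ball 0 1)) \<subseteq> {v. cinner v y = 0}"
    proof (rule closure_cspan_subset)
      show "szego_vector ` ball 0 1 \<subseteq> {v. cinner v y = 0}"
        using fock_eval_commutator_ideal[OF _ A(1), of _ "ell2_unit []"]
        by (auto simp: A(2) fock_eval_def cinner_eq_0_sym)
      show "complex_vector.subspace {v. cinner v y = 0}"
        by (rule complex_vector.subspaceI) (auto simp: cinner_add_left cinner_scaleC_left)
    qed (rule closed_cinner_eq_0)
    then have "cinner x y = 0"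
      using x closure_span_szego by blast
    then show "y \<in> {y. cinner y x = 0}"
      using cinner_eq_0_sym by blast
  qed
  then show "x \<in> model_subspace M"
    using cinner_eq_0_sym unfolding model_subspace_def orthogonal_complement_def N_def by blast
qed


subsection \<open>The inverse of the scalar parametrisation\<close>

definition inv_deriv :: "complex^'n \<Rightarrow> complex^'n \<Rightarrow> complex^'n"
  where "inv_deriv l h = (\<chi> i. fock_deriv l h (G i))"

lemma inv_point_has_derivative:
  assumes "norm l < 1"
  shows "(inv_point has_derivative inv_deriv l) (at l)"
proof -
  have vec: "vec_lambda y = (\<Sum>i\<in>UNIV. axis i (y i))" for y :: "'n \<Rightarrow> complex"
    by (simp add: vec_eq_iff axis_def if_distrib cong: if_cong)
  have norm_axis: "norm (axis i c :: complex^'n) = norm c" for i c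
  proof -
    have "(norm (axis i c :: complex^'n))\<^sup>2 = (\<Sum>j\<in>UNIV. if j = i then (norm c)\<^sup>2 else 0)"
      unfolding norm_vec_sum by (rule sum.cong) (auto simp: axis_def)
    then show ?thesis
      by simp
  qed
  have "bounded_linear (axis i :: complex \<Rightarrow> complex^'n)" for i
    by (rule bounded_linear_intro[where K = 1])
      (simp_all add: norm_axis, simp_all add: vec_eq_iff axis_def)
  then have "((\<lambda>l. axis i (fock_eval l (G i))) has_derivative (\<lambda>h. axis i (fock_deriv l h (G i)))) (at l)" for i
    by (rule bounded_linear.has_derivative[OF _ fock_eval_has_derivative[OF assms]])
  then show ?thesis
    unfolding inv_point_def[abs_def] inv_deriv_def[abs_def] vec by (intro has_derivative_sum)
qed

text \<open>A product rule. In a direction killed by \<open>inv_deriv l\<close> the second term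
  drops out, so vanishing propagates along words in \<open>M\<close>.\<close>

lemma fock_deriv_M:
  assumes l: "norm l < 1"
  shows "fock_deriv l h (M i x) = inv_point l $ i * fock_deriv l h x + inv_deriv l h $ i * fock_eval l x"
proof -
  have "fock_deriv l h (M i x) =
      fock_eval l (G i) * fock_deriv l h x + fock_deriv l h (G i) * fock_eval l x"
    by (rule fock_deriv_eqI[OF l, where \<phi> = "\<lambda>m. fock_eval m (G i) * fock_eval m x"])
      (simp add: fock_eval_M inv_point_def,
        rule has_derivative_mult[OF fock_eval_has_derivative[OF l] fock_eval_has_derivative[OF l]])
  then show ?thesis
    by (simp add: inv_point_def inv_deriv_def)
qed

text \<open>
  A direction killed by the derivative of \<open>inv_point\<close> is killed by that of every
  \<open>l \<mapsto> fock_eval l (p(M) 1)\<close>, hence, in the limit, by that of the coordinates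
  \<open>l \<mapsto> fock_eval l (f\<^sub>j(M) 1)\<close>.
\<close>

lemma inv_deriv_eq_0:
  assumes l: "norm l < 1" and h: "inv_deriv l h = 0"
  shows "h = 0"
proof -
  let ?e = "ell2_unit [] :: 'n list ell2"
  interpret D: bounded_linear "fock_deriv l h"
    by (rule bounded_linear_fock_deriv[OF l])
  have e: "fock_deriv l h ?e = 0"
    by (rule fock_deriv_eqI[OF l, where \<phi> = "\<lambda>_. 1"]) (simp_all add: fock_eval_empty)
  have scale: "fock_deriv l h (c *\<^sub>C x) = c * fock_deriv l h x" for c x
    by (rule fock_deriv_eqI[OF l, where \<phi> = "\<lambda>m. c * fock_eval m x"])
      (auto simp: fock_eval_scaleC intro!: has_derivative_mult_right fock_eval_has_derivative l)
  \<comment> \<open>The set is SOT-closed because \<open>fock_deriv l h\<close> is bounded in its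
    vector argument; this is what lets the vanishing pass from polynomials to
    \<open>Y j\<close>.\<close>
  define C where "C = {T. fock_deriv l h (blinfun_apply T ?e) = 0}"
  have "continuous_map euclidean euclidean (fock_deriv l h)"
    by (simp add: linear_continuous_on D.bounded_linear_axioms)
  from continuous_map_compose[OF strong_operator_topology_continuous_evaluation this]
  have "closedin strong_operator_topology C"
    unfolding C_def by (intro closedin_eq_0) (simp_all add: o_def strong_operator_topology_topspace)
  moreover have "op_polynomials M \<subseteq> C"
  proof
    fix p assume "p \<in> op_polynomials M"
    then show "p \<in> C"
    proof (induction rule: op_polynomials_induct)
      case (word c \<alpha>)
      have "fock_deriv l h (blinfun_apply (op_word M \<alpha>) ?e) = 0"
        by (induction \<alpha>) (simp_all add: e fock_deriv_M[OF l] h)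
      then show ?case
        by (simp add: C_def scaleC_op.rep_eq scale)
    qed (simp_all add: C_def blinfun.add_left D.add D.zero)
  qed
  ultimately have "Y j \<in> C" for j
    by (rule sot_closed_contains_Y)
  moreover have "fock_deriv l h (Y j ?e) = h $ j" for j
    by (rule fock_deriv_eqI[OF l, where \<phi> = "\<lambda>m. m $ j"])
      (simp_all add: fock_eval_Y bounded_linear.has_derivative[OF bounded_linear_vec_nth has_derivative_ident])
  ultimately show ?thesis
    by (simp add: C_def vec_eq_iff)
qed

text \<open>An injective endomorphism of a finite-dimensional space is invertible, and the strong
  inverse function theorem needs beyond this only continuity of g on the ball and f(g(l)) = l there.
  It differentiates f at g(l) from all directions, with no openness of the domain to be shown
  first.\<close>

lemma inv_point_inverse_has_derivative:
  assumes l: "norm l < 1"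
  obtains D where "((\<lambda>z. vec_lambda (point_value f z)) has_derivative D) (at (inv_point l))"
    and "\<And>c v. D (c *s v) = c *s D v"
proof -
  have der: "(inv_point has_derivative inv_deriv l) (at l)"
    by (rule inv_point_has_derivative[OF l])
  then have lin: "linear (inv_deriv l)"
    by (rule has_derivative_linear)
  have inj: "inj (inv_deriv l)"
    unfolding linear_injective_0[OF lin] using inv_deriv_eq_0[OF l] by blast
  then have surj: "surj (inv_deriv l)"
    by (rule linear_inj_imp_surj[OF lin])
  define D where "D = inv (inv_deriv l)"
  have DD: "inv_deriv l (D v) = v" for v
    unfolding D_def by (rule surj_f_inv_f[OF surj])
  have "((\<lambda>z. vec_lambda (point_value f z)) has_derivative D) (at (inv_point l))"
  proof (rule has_derivative_inverse_strong[where f = inv_point and S = "ball 0 1" and x = l])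
    show "continuous_on (ball 0 1) inv_point"
      using inv_point_has_derivative has_derivative_continuous
      by (fastforce intro!: continuous_at_imp_continuous_on)
    show "inv_deriv l \<circ> D = id"
      by (simp add: fun_eq_iff DD)
  qed (use l der in \<open>auto simp: point_value_inv_point vec_lambda_eta\<close>)
  moreover have "D (c *s v) = c *s D v" for c v
  proof (rule injD[OF inj])
    have "inv_deriv l (c *s w) = c *s inv_deriv l w" for w
      by (simp add: inv_deriv_def vec_eq_iff fock_deriv_scale)
    then show "inv_deriv l (D (c *s v)) = inv_deriv l (c *s D v)"
      by (simp add: DD)
  qed
  ultimately show ?thesis
    using that by blast
qed

end


section \<open>Noncommutative power series\<close>

lemma nc_mult_Nil: "nc_mult p q [] = p [] * q []"
  by (simp add: nc_mult_def)

lemma nc_mult_Cons: "nc_mult p q (a # w) = p [] * q (a # w) + nc_mult (\<lambda>u. p (a # u)) q w"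
  by (simp add: nc_mult_def sum.atMost_Suc_shift del: sum.atMost_Suc)

lemma nc_mult_add_left: "nc_mult (\<lambda>w. p w + p' w) q w = nc_mult p q w + nc_mult p' q w"
  by (simp add: nc_mult_def distrib_right sum.distrib)

lemma nc_mult_scale_left: "nc_mult (\<lambda>w. c * p w) q w = c * nc_mult p q w"
  by (simp add: nc_mult_def sum_distrib_left mult.assoc)

lemma nc_mult_sum_left: "nc_mult (\<lambda>w. \<Sum>a\<in>A. c a * p a w) q w = (\<Sum>a\<in>A. c a * nc_mult (p a) q w)"
  unfolding nc_mult_def sum_distrib_right sum_distrib_left
  by (subst sum.swap) (simp add: mult.assoc)

lemma nc_mult_sum_right: "nc_mult p (\<lambda>w. \<Sum>a\<in>A. c a * q a w) w = (\<Sum>a\<in>A. c a * nc_mult p (q a) w)"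
  unfolding nc_mult_def sum_distrib_left
  by (subst sum.swap) (simp add: mult_ac)

lemma nc_mult_assoc: "nc_mult (nc_mult p q) r = nc_mult p (nc_mult q r)"
proof
  show "nc_mult (nc_mult p q) r w = nc_mult p (nc_mult q r) w" for w
  proof (induction w arbitrary: p)
    case (Cons a w)
    then show ?case
      by (simp add: nc_mult_Cons nc_mult_Nil nc_mult_add_left nc_mult_scale_left algebra_simps)
  qed (simp add: nc_mult_Nil)
qed

lemma nc_mult_one_left: "nc_mult nc_one q = q"
proof
  show "nc_mult nc_one q w = q w" for w
  proof (cases w)
    case (Cons a v)
    have "nc_mult (\<lambda>u. nc_one (a # u)) q v = 0"
      by (simp add: nc_mult_def nc_one_def)
    then show ?thesis
      by (simp add: Cons nc_mult_Cons nc_one_def)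
  qed (simp add: nc_mult_Nil nc_one_def)
qed

lemma nc_word_Nil [simp]: "nc_word f [] = nc_one"
  by (simp add: nc_word_def)

lemma nc_word_Cons [simp]: "nc_word f (i # \<alpha>) = nc_mult (f i) (nc_word f \<alpha>)"
  by (simp add: nc_word_def)

lemma nc_word_append: "nc_word f (\<alpha> @ \<beta>) = nc_mult (nc_word f \<alpha>) (nc_word f \<beta>)"
  by (induction \<alpha>) (simp_all add: nc_mult_one_left nc_mult_assoc)

lemma nc_comp_eq_sum:
  assumes "finite A" "\<And>\<alpha>. \<alpha> \<notin> A \<Longrightarrow> a \<alpha> * nc_word f \<alpha> w = 0"
  shows "nc_comp a f w = (\<Sum>\<alpha>\<in>A. a \<alpha> * nc_word f \<alpha> w)"
  unfolding nc_comp_def by (rule sum.mono_neutral_left) (use assms in auto)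

text \<open>A sum over an infinite set has the default value 0. Under this condition
  \<open>nc_comp\<close> is a genuine finite sum for each coefficient, hence additive.\<close>

definition locally_finite :: "'n ncseries \<Rightarrow> ('n \<Rightarrow> 'n ncseries) \<Rightarrow> bool"
  where "locally_finite a f \<longleftrightarrow> (\<forall>w. finite {\<alpha>. a \<alpha> * nc_word f \<alpha> w \<noteq> 0})"

lemma locally_finite_polynomial: "nc_polynomial a \<Longrightarrow> locally_finite a f"
  unfolding locally_finite_def nc_polynomial_def by (auto elim!: finite_subset[rotated])

lemma nc_comp_diff:
  assumes "locally_finite a f" "locally_finite b f"
  shows "nc_comp (\<lambda>\<alpha>. a \<alpha> - b \<alpha>) f w = nc_comp a f w - nc_comp b f w"
proof -
  let ?A = "{\<alpha>. a \<alpha> * nc_word f \<alpha> w \<noteq> 0} \<union> {\<alpha>. b \<alpha> * nc_word f \<alpha> w \<noteq> 0}"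
  have fin: "finite ?A"
    using assms by (simp add: locally_finite_def)
  have "nc_comp (\<lambda>\<alpha>. a \<alpha> - b \<alpha>) f w = (\<Sum>\<alpha>\<in>?A. (a \<alpha> - b \<alpha>) * nc_word f \<alpha> w)"
    by (rule nc_comp_eq_sum[OF fin]) (auto simp: left_diff_distrib)
  moreover have "nc_comp a f w = (\<Sum>\<alpha>\<in>?A. a \<alpha> * nc_word f \<alpha> w)"
    by (rule nc_comp_eq_sum[OF fin]) auto
  moreover have "nc_comp b f w = (\<Sum>\<alpha>\<in>?A. b \<alpha> * nc_word f \<alpha> w)"
    by (rule nc_comp_eq_sum[OF fin]) auto
  ultimately show ?thesis
    by (simp add: left_diff_distrib sum_subtractf)
qed

lemma Rep_append_word_mult: "Rep_ell2 (append_word \<beta> x) = nc_mult (Rep_ell2 x) (Rep_ell2 (ell2_unit \<beta>))"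
proof
  fix w
  show "Rep_ell2 (append_word \<beta> x) w = nc_mult (Rep_ell2 x) (Rep_ell2 (ell2_unit \<beta>)) w"
  proof (cases "w \<in> range (\<lambda>\<alpha>. \<alpha> @ \<beta>)")
    case True
    then obtain \<alpha> where w: "w = \<alpha> @ \<beta>"
      by blast
    have "nc_mult (Rep_ell2 x) (Rep_ell2 (ell2_unit \<beta>)) w =
        (\<Sum>k\<in>{length \<alpha>}. Rep_ell2 x (take k w) * Rep_ell2 (ell2_unit \<beta>) (drop k w))"
      unfolding nc_mult_def
    proof (rule sum.mono_neutral_right)
      show "\<forall>k\<in>{..length w} - {length \<alpha>}.
          Rep_ell2 x (take k w) * Rep_ell2 (ell2_unit \<beta>) (drop k w) = 0"
      proof
        fix k assume k: "k \<in> {..length w} - {length \<alpha>}"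
        then have "length (drop k w) \<noteq> length \<beta>"
          by (auto simp: w)
        then have "drop k w \<noteq> \<beta>"
          by blast
        then show "Rep_ell2 x (take k w) * Rep_ell2 (ell2_unit \<beta>) (drop k w) = 0"
          by (simp add: ell2_unit.rep_eq)
      qed
    qed (auto simp: w)
    then show ?thesis
      by (simp add: w Rep_append_word ell2_unit.rep_eq)
  next
    case False
    then have "drop k w \<noteq> \<beta>" for k
      by (metis append_take_drop_id rangeI)
    then show ?thesis
      using False by (simp add: nc_mult_def Rep_append_word ell2_unit.rep_eq)
  qed
qed

lemma nc_comp_append_word:
  assumes "locally_finite (Rep_ell2 x) f"
  shows "nc_comp (Rep_ell2 (append_word \<beta> x)) f = nc_mult (nc_comp (Rep_ell2 x) f) (nc_word f \<beta>)"
proof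
  fix w
  \<comment> \<open>All words that contribute to some prefix of \<open>w\<close>: one finite index
    set serving every cut, so that the two summations can be interchanged.\<close>
  define A where "A = (\<Union>k\<in>{..length w}. {\<alpha>. Rep_ell2 x \<alpha> * nc_word f \<alpha> (take k w) \<noteq> 0})"
  have fin: "finite A"
    using assms by (auto simp: A_def locally_finite_def)
  have out: "Rep_ell2 x \<alpha> * nc_word f \<alpha> (take k w) = 0" if "\<alpha> \<notin> A" "k \<le> length w" for \<alpha> k
    using that by (auto simp: A_def)
  have word: "Rep_ell2 x \<alpha> * nc_word f (\<alpha> @ \<beta>) w =
      (\<Sum>k\<le>length w. Rep_ell2 x \<alpha> * nc_word f \<alpha> (take k w) * nc_word f \<beta> (drop k w))" for \<alpha>
    by (simp add: nc_word_append nc_mult_def sum_distrib_left mult.assoc)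
  have "nc_comp (Rep_ell2 (append_word \<beta> x)) f w =
      (\<Sum>\<gamma>\<in>(\<lambda>\<alpha>. \<alpha> @ \<beta>) ` A. Rep_ell2 (append_word \<beta> x) \<gamma> * nc_word f \<gamma> w)"
  proof (rule nc_comp_eq_sum)
    fix \<gamma> assume \<gamma>: "\<gamma> \<notin> (\<lambda>\<alpha>. \<alpha> @ \<beta>) ` A"
    show "Rep_ell2 (append_word \<beta> x) \<gamma> * nc_word f \<gamma> w = 0"
    proof (cases "\<gamma> \<in> range (\<lambda>\<alpha>. \<alpha> @ \<beta>)")
      case True
      then obtain \<alpha> where "\<gamma> = \<alpha> @ \<beta>" "\<alpha> \<notin> A"
        using \<gamma> by blast
      then have "Rep_ell2 x \<alpha> * nc_word f (\<alpha> @ \<beta>) w = 0"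
        unfolding word using out[OF \<open>\<alpha> \<notin> A\<close>] by (intro sum.neutral ballI) (metis atMost_iff mult_zero_left)
      then show ?thesis
        by (simp add: \<open>\<gamma> = \<alpha> @ \<beta>\<close> Rep_append_word)
    qed (simp add: Rep_append_word)
  qed (simp add: fin)
  also have "\<dots> = (\<Sum>\<alpha>\<in>A. Rep_ell2 x \<alpha> * nc_word f (\<alpha> @ \<beta>) w)"
    by (subst sum.reindex) (auto simp: inj_on_def Rep_append_word)
  also have "\<dots> = (\<Sum>k\<le>length w. \<Sum>\<alpha>\<in>A. Rep_ell2 x \<alpha> * nc_word f \<alpha> (take k w) * nc_word f \<beta> (drop k w))"
    unfolding word by (rule sum.swap)
  also have "\<dots> = nc_mult (nc_comp (Rep_ell2 x) f) (nc_word f \<beta>) w"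
    unfolding nc_mult_def
  proof (rule sum.cong)
    fix k assume "k \<in> {..length w}"
    then have "nc_comp (Rep_ell2 x) f (take k w) = (\<Sum>\<alpha>\<in>A. Rep_ell2 x \<alpha> * nc_word f \<alpha> (take k w))"
      by (intro nc_comp_eq_sum fin out) auto
    then show "(\<Sum>\<alpha>\<in>A. Rep_ell2 x \<alpha> * nc_word f \<alpha> (take k w) * nc_word f \<beta> (drop k w)) =
        nc_comp (Rep_ell2 x) f (take k w) * nc_word f \<beta> (drop k w)"
      by (simp add: sum_distrib_right)
  qed simp
  finally show "nc_comp (Rep_ell2 (append_word \<beta> x)) f w =
      nc_mult (nc_comp (Rep_ell2 x) f) (nc_word f \<beta>) w" .
qed


subsection \<open>Uniqueness of coefficients: formal series\<close>

lemma nc_word_short: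
  assumes "\<And>i. f i [] = 0"
  shows "length w < length \<alpha> \<Longrightarrow> nc_word f \<alpha> w = 0"
proof (induction \<alpha> arbitrary: w)
  case (Cons i \<alpha>)
  have "f i (take k w) * nc_word f \<alpha> (drop k w) = 0" if "k \<le> length w" for k
  proof (cases k)
    case (Suc j)
    then have "length (drop k w) < length \<alpha>"
      using Cons.prems that by simp
    then show ?thesis
      using Cons.IH by simp
  qed (simp add: assms)
  then show ?case
    unfolding nc_word_Cons nc_mult_def by (intro sum.neutral ballI) simp
qed simp

text \<open>In the lowest possible degree every factor contributes exactly one letter: a longer
  piece of the first factor leaves fewer letters than \<open>\<alpha>\<close> has factors.\<close>

lemma nc_word_Cons_leading:
  assumes "\<And>i. f i [] = 0" "length w = length \<alpha>"
  shows "nc_word f (i # \<alpha>) (b # w) = f i [b] * nc_word f \<alpha> w"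
proof -
  have "nc_mult (\<lambda>u. f i (b # u)) (nc_word f \<alpha>) w =
      (\<Sum>k\<in>{0}. f i (b # take k w) * nc_word f \<alpha> (drop k w))"
    unfolding nc_mult_def
    by (rule sum.mono_neutral_right) (auto intro!: nc_word_short[of f, OF assms(1)] simp: assms(2))
  then show ?thesis
    by (simp add: nc_mult_Cons assms(1))
qed

lemma locally_finite_formal:
  fixes f :: "'n::finite \<Rightarrow> 'n ncseries"
  assumes "\<And>i. f i [] = 0"
  shows "locally_finite a f"
  unfolding locally_finite_def
proof
  fix w :: "'n list"
  have "{\<alpha>. a \<alpha> * nc_word f \<alpha> w \<noteq> 0} \<subseteq> (\<Union>m\<in>{..length w}. {\<alpha>. length \<alpha> = m})"
    using nc_word_short[of f, OF assms] by (auto simp: not_less[symmetric])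
  then show "finite {\<alpha>. a \<alpha> * nc_word f \<alpha> w \<noteq> 0}"
    by (rule finite_subset) (simp add: finite_words_length)
qed

text \<open>In leading degree the words \<open>f\<^sub>\<alpha>\<close> form a tensor power of the Jacobian matrix.\<close>

lemma leading_words_independent:
  fixes f :: "'n::finite \<Rightarrow> 'n ncseries"
  assumes f0: "\<And>i. f i [] = 0" and det: "det (\<chi> i j. f i [j]) \<noteq> 0"
    and "\<And>w. length w = m \<Longrightarrow> (\<Sum>\<alpha> | length \<alpha> = m. b \<alpha> * nc_word f \<alpha> w) = 0"
    and "length \<alpha> = m"
  shows "b \<alpha> = 0"
  using assms(3,4)
proof (induction m arbitrary: b \<alpha>)
  case 0
  then show ?case
    using "0.prems"(1)[of "[]"] by (simp add: nc_one_def)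
next
  case (Suc m)
  define J :: "complex^'n^'n" where "J = (\<chi> i j. f i [j])"
  obtain J' where J': "J ** J' = mat 1"
    using det unfolding J_def[symmetric] invertible_det_nz[symmetric] invertible_def by blast
  have zero: "(\<Sum>\<beta> | length \<beta> = m. b (i # \<beta>) * nc_word f \<beta> w) = 0" if w: "length w = m" for i w
  proof -
    \<comment> \<open>For fixed \<open>w\<close> the relation in the first letter \<open>c\<close>
      says that this row vector is annihilated by the Jacobian. Inverting the latter leaves the same
      problem for words of length \<open>m\<close>.\<close>
    define v :: "complex^'n" where "v = (\<chi> i. \<Sum>\<beta> | length \<beta> = m. b (i # \<beta>) * nc_word f \<beta> w)"
    have "v v* J = 0"
    proof (rule vec_eq_iff[THEN iffD2], rule allI)
      fix c
      have "0 = (\<Sum>\<alpha> | length \<alpha> = Suc m. b \<alpha> * nc_word f \<alpha> (c # w))"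
        using Suc.prems(1)[of "c # w"] w by simp
      also have "\<dots> = (\<Sum>i\<in>UNIV. \<Sum>\<beta> | length \<beta> = m. b (i # \<beta>) * (f i [c] * nc_word f \<beta> w))"
        unfolding sum_words_Suc
        by (intro sum.cong refl) (use nc_word_Cons_leading[of f, OF f0] w in auto)
      also have "\<dots> = (v v* J) $ c"
        by (simp add: vector_matrix_mult_def v_def J_def sum_distrib_left mult_ac)
      finally show "(v v* J) $ c = 0 $ c"
        by simp
    qed
    then have "v v* (J ** J') = 0"
      by (simp flip: vector_matrix_mul_assoc)
    then have "v = 0"
      by (simp add: J')
    then show ?thesis
      by (simp add: v_def vec_eq_iff)
  qed
  obtain i \<beta> where \<alpha>: "\<alpha> = i # \<beta>" "length \<beta> = m"
    using Suc.prems(2) by (auto simp: length_Suc_conv)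
  show ?case
    unfolding \<alpha>(1) by (rule Suc.IH[OF zero \<alpha>(2)])
qed

text \<open>On words of the length of \<open>\<alpha>\<close> the shorter indices vanish by
  induction and the longer ones start in higher degree, so only the leading parts remain.\<close>

lemma nc_comp_formal_eq_0:
  fixes f :: "'n::finite \<Rightarrow> 'n ncseries"
  assumes f0: "\<And>i. f i [] = 0" and det: "det (\<chi> i j. f i [j]) \<noteq> 0"
    and "\<And>w. nc_comp d f w = 0"
  shows "d \<alpha> = 0"
proof (induction "length \<alpha>" arbitrary: \<alpha> rule: less_induct)
  case less
  show ?case
  proof (rule leading_words_independent[of f, OF f0 det _ refl])
    fix w :: "'n list" assume w: "length w = length \<alpha>"
    have "d \<beta> * nc_word f \<beta> w = 0" if "\<beta> \<notin> {\<beta>. length \<beta> = length \<alpha>}" for \<beta>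
    proof (cases "length \<beta> < length \<alpha>")
      case True
      then show ?thesis
        using less by simp
    next
      case False
      then have "length w < length \<beta>"
        using that w by simp
      then show ?thesis
        using nc_word_short[of f, OF f0] by simp
    qed
    then have "nc_comp d f w = (\<Sum>\<beta> | length \<beta> = length \<alpha>. d \<beta> * nc_word f \<beta> w)"
      by (intro nc_comp_eq_sum finite_words_length)
    then show "(\<Sum>\<beta> | length \<beta> = length \<alpha>. d \<beta> * nc_word f \<beta> w) = 0"
      by (simp add: assms(3))
  qed
qed


subsection \<open>Uniqueness of coefficients: polynomials\<close>

lemma splits_eq: "{(u, v). u @ v = w} = (\<lambda>k. (take k w, drop k w)) ` {..length w}"
proof (intro equalityI subsetI)
  fix p assume "p \<in> {(u, v). u @ v = w}"
  then obtain u v where "p = (u, v)" "w = u @ v"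
    by auto
  then show "p \<in> (\<lambda>k. (take k w, drop k w)) ` {..length w}"
    by (intro image_eqI[of _ _ "length u"]) auto
qed auto

lemma nc_mult_splits: "nc_mult p q w = (\<Sum>(u, v) | u @ v = w. p u * q v)"
proof -
  have "inj_on (\<lambda>k. (take k w, drop k w)) {..length w}"
  proof (rule inj_onI)
    fix j k assume jk: "j \<in> {..length w}" "k \<in> {..length w}"
      and "(take j w, drop j w) = (take k w, drop k w)"
    then have "length (take j w) = length (take k w)"
      by (simp only: prod.inject)
    then show "j = k"
      using jk by simp
  qed
  then show ?thesis
    by (simp add: nc_mult_def splits_eq sum.reindex)
qed

lemma nc_mult_finite:
  assumes "finite A" "finite B" "\<And>u. u \<notin> A \<Longrightarrow> p u = 0" "\<And>v. v \<notin> B \<Longrightarrow> q v = 0"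
  shows "nc_mult p q w = (\<Sum>(u, v)\<in>A \<times> B. if w = u @ v then p u * q v else 0)"
proof -
  have fin: "finite {(u, v). u @ v = w}"
    unfolding splits_eq by simp
  have "nc_mult p q w = (\<Sum>(u, v)\<in>{(u, v). u @ v = w} \<inter> A \<times> B. p u * q v)"
    unfolding nc_mult_splits
    by (rule sum.mono_neutral_right) (use fin in simp, blast, use assms(3,4) in fastforce)
  also have "\<dots> = (\<Sum>(u, v)\<in>{(u, v). u @ v = w} \<inter> A \<times> B. if w = u @ v then p u * q v else 0)"
    by (rule sum.cong) auto
  also have "\<dots> = (\<Sum>(u, v)\<in>A \<times> B. if w = u @ v then p u * q v else 0)"
    by (rule sum.mono_neutral_left) (use assms(1,2) in \<open>auto split: if_splits\<close>)
  finally show ?thesis .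
qed

lemma nc_comp_finite_sum:
  assumes "finite I"
  shows "nc_comp (\<lambda>\<gamma>. \<Sum>i\<in>I. if \<gamma> = h i then c i else 0) g w = (\<Sum>i\<in>I. c i * nc_word g (h i) w)"
proof -
  have "nc_comp (\<lambda>\<gamma>. \<Sum>i\<in>I. if \<gamma> = h i then c i else 0) g w =
      (\<Sum>\<gamma>\<in>h ` I. (\<Sum>i\<in>I. if \<gamma> = h i then c i else 0) * nc_word g \<gamma> w)"
    by (rule nc_comp_eq_sum) (use assms in \<open>auto intro!: sum.neutral\<close>)
  also have "\<dots> = (\<Sum>i\<in>I. \<Sum>\<gamma>\<in>h ` I. if \<gamma> = h i then c i * nc_word g \<gamma> w else 0)"
    unfolding sum_distrib_right by (subst sum.swap) (intro sum.cong refl, simp)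
  also have "\<dots> = (\<Sum>i\<in>I. c i * nc_word g (h i) w)"
    using assms by (intro sum.cong refl) (simp add: sum.delta)
  finally show ?thesis .
qed

lemma nc_comp_linear:
  assumes "finite I" "\<And>i. i \<in> I \<Longrightarrow> nc_polynomial (p i)"
  shows "nc_comp (\<lambda>\<gamma>. \<Sum>i\<in>I. c i * p i \<gamma>) g w = (\<Sum>i\<in>I. c i * nc_comp (p i) g w)"
proof -
  define A where "A = (\<Union>i\<in>I. {\<gamma>. p i \<gamma> \<noteq> 0})"
  have fin: "finite A"
    using assms by (auto simp: A_def nc_polynomial_def)
  have out: "p i \<gamma> = 0" if "i \<in> I" "\<gamma> \<notin> A" for i \<gamma>
    using that by (auto simp: A_def)
  have "nc_comp (\<lambda>\<gamma>. \<Sum>i\<in>I. c i * p i \<gamma>) g w = (\<Sum>\<gamma>\<in>A. (\<Sum>i\<in>I. c i * p i \<gamma>) * nc_word g \<gamma> w)"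
    by (rule nc_comp_eq_sum[OF fin]) (simp add: out)
  also have "\<dots> = (\<Sum>i\<in>I. c i * (\<Sum>\<gamma>\<in>A. p i \<gamma> * nc_word g \<gamma> w))"
    unfolding sum_distrib_right sum_distrib_left by (subst sum.swap) (simp add: mult.assoc)
  also have "\<dots> = (\<Sum>i\<in>I. c i * nc_comp (p i) g w)"
    by (intro sum.cong refl arg_cong2[of _ _ _ _ "(*)"] nc_comp_eq_sum[symmetric] fin) (simp add: out)
  finally show ?thesis .
qed

lemma nc_comp_mult:
  assumes "nc_polynomial p" "nc_polynomial q"
  shows "nc_comp (nc_mult p q) g = nc_mult (nc_comp p g) (nc_comp q g)"
proof
  fix w
  define A B where "A = {\<alpha>. p \<alpha> \<noteq> 0}" and "B = {\<alpha>. q \<alpha> \<noteq> 0}"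
  have fin: "finite A" "finite B"
    using assms by (simp_all add: A_def B_def nc_polynomial_def)
  have "nc_mult p q = (\<lambda>\<gamma>. \<Sum>i\<in>A \<times> B. if \<gamma> = fst i @ snd i then p (fst i) * q (snd i) else 0)"
    by (rule ext, subst nc_mult_finite[OF fin]) (auto simp: A_def B_def case_prod_unfold)
  then have "nc_comp (nc_mult p q) g w =
      (\<Sum>i\<in>A \<times> B. p (fst i) * q (snd i) * nc_word g (fst i @ snd i) w)"
    using fin by (simp add: nc_comp_finite_sum)
  also have "\<dots> = (\<Sum>\<alpha>\<in>A. \<Sum>\<beta>\<in>B. p \<alpha> * (q \<beta> * nc_mult (nc_word g \<alpha>) (nc_word g \<beta>) w))"
    by (simp add: sum.cartesian_product case_prod_unfold nc_word_append mult.assoc)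
  also have "\<dots> = nc_mult (\<lambda>w. \<Sum>\<alpha>\<in>A. p \<alpha> * nc_word g \<alpha> w) (\<lambda>w. \<Sum>\<beta>\<in>B. q \<beta> * nc_word g \<beta> w) w"
    by (simp add: nc_mult_sum_left nc_mult_sum_right sum_distrib_left)
  also have "(\<lambda>w. \<Sum>\<alpha>\<in>A. p \<alpha> * nc_word g \<alpha> w) = nc_comp p g"
    by (rule ext, rule nc_comp_eq_sum[symmetric]) (use fin in \<open>auto simp: A_def\<close>)
  also have "(\<lambda>w. \<Sum>\<beta>\<in>B. q \<beta> * nc_word g \<beta> w) = nc_comp q g"
    by (rule ext, rule nc_comp_eq_sum[symmetric]) (use fin in \<open>auto simp: B_def\<close>)
  finally show "nc_comp (nc_mult p q) g w = nc_mult (nc_comp p g) (nc_comp q g) w" .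
qed

lemma nc_polynomial_mult:
  assumes "nc_polynomial p" "nc_polynomial q"
  shows "nc_polynomial (nc_mult p q)"
proof -
  let ?S = "(\<lambda>(u, v). u @ v) ` ({\<alpha>. p \<alpha> \<noteq> 0} \<times> {\<alpha>. q \<alpha> \<noteq> 0})"
  have "{\<gamma>. nc_mult p q \<gamma> \<noteq> 0} \<subseteq> ?S"
  proof
    fix \<gamma> assume "\<gamma> \<in> {\<gamma>. nc_mult p q \<gamma> \<noteq> 0}"
    then obtain k where "p (take k \<gamma>) * q (drop k \<gamma>) \<noteq> 0"
      unfolding nc_mult_def by (auto elim: sum.not_neutral_contains_not_neutral)
    then show "\<gamma> \<in> ?S"
      by (intro image_eqI[of _ _ "(take k \<gamma>, drop k \<gamma>)"]) auto
  qed
  moreover have "finite ?S"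
    using assms by (auto simp: nc_polynomial_def)
  ultimately show ?thesis
    unfolding nc_polynomial_def by (rule finite_subset)
qed

lemma Rep_ell2_unit_Nil: "Rep_ell2 (ell2_unit []) = nc_one"
  by (auto simp: ell2_unit.rep_eq nc_one_def)

lemma Rep_ell2_unit_single: "Rep_ell2 (ell2_unit [i]) = nc_var i"
  by (auto simp: ell2_unit.rep_eq nc_var_def)

lemma Rep_ell2_unit_append:
  "Rep_ell2 (ell2_unit (\<alpha> @ \<beta>)) = nc_mult (Rep_ell2 (ell2_unit \<alpha>)) (Rep_ell2 (ell2_unit \<beta>))"
  using Rep_append_word_mult[of \<beta> "ell2_unit \<alpha>"] by (simp add: append_word_unit)

lemma nc_polynomial_unit: "nc_polynomial (Rep_ell2 (ell2_unit \<alpha>))"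
  by (simp add: nc_polynomial_def ell2_unit.rep_eq)

lemma nc_polynomial_word: "(\<And>i. nc_polynomial (f i)) \<Longrightarrow> nc_polynomial (nc_word f \<alpha>)"
  by (induction \<alpha>) (simp_all add: nc_polynomial_mult nc_polynomial_unit flip: Rep_ell2_unit_Nil)

lemma nc_comp_one: "nc_comp nc_one g = nc_one"
proof
  fix w
  have "nc_comp nc_one g w = (\<Sum>\<alpha>\<in>{[]}. nc_one \<alpha> * nc_word g \<alpha> w)"
    by (rule nc_comp_eq_sum) (auto simp: nc_one_def)
  then show "nc_comp nc_one g w = nc_one w"
    by (simp add: nc_one_def)
qed

lemma nc_comp_word_inverse:
  assumes "\<And>i. nc_polynomial (f i)" "\<And>i. nc_comp (f i) g = nc_var i"
  shows "nc_comp (nc_word f \<alpha>) g = Rep_ell2 (ell2_unit \<alpha>)"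
proof (induction \<alpha>)
  case (Cons i \<alpha>)
  then show ?case
    using Rep_ell2_unit_append[of "[i]" \<alpha>]
    by (simp add: nc_comp_mult nc_polynomial_word assms Rep_ell2_unit_single)
qed (simp add: nc_comp_one Rep_ell2_unit_Nil)

text \<open>Substituting the inverse tuple turns each f_\<alpha> back into the word \<alpha>, so the
  coefficients can be read off.\<close>

lemma nc_comp_polynomial_eq_0:
  assumes f: "\<And>i. nc_polynomial (f i)" and g: "\<And>i. nc_comp (f i) g = nc_var i"
    and d: "nc_polynomial d" "\<And>w. nc_comp d f w = 0"
  shows "d \<alpha> = 0"
proof -
  define A where "A = {\<alpha>. d \<alpha> \<noteq> 0}"
  have fin: "finite A"
    using d(1) by (simp add: A_def nc_polynomial_def)
  have "(\<lambda>w. \<Sum>\<beta>\<in>A. d \<beta> * nc_word f \<beta> w) = nc_comp d f"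
    by (rule ext, rule nc_comp_eq_sum[symmetric]) (use fin in \<open>auto simp: A_def\<close>)
  then have "nc_comp (\<lambda>w. \<Sum>\<beta>\<in>A. d \<beta> * nc_word f \<beta> w) g \<alpha> = nc_comp (\<lambda>_. 0) g \<alpha>"
    using d(2) by (simp add: fun_eq_iff)
  also have "\<dots> = 0"
    by (simp add: nc_comp_def)
  finally have "(\<Sum>\<beta>\<in>A. d \<beta> * nc_comp (nc_word f \<beta>) g \<alpha>) = 0"
    using fin by (simp add: nc_comp_linear nc_polynomial_word f)
  moreover have "(\<Sum>\<beta>\<in>A. d \<beta> * nc_comp (nc_word f \<beta>) g \<alpha>) = d \<alpha>"
    using fin by (auto simp: nc_comp_word_inverse[OF f g] ell2_unit.rep_eq A_def if_distrib
        sum.delta cong: if_cong)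
  ultimately show ?thesis
    by simp
qed


section \<open>Free holomorphic functions\<close>

lemma bounded_linear_row: "bounded_linear (\<lambda>h::'a::complex_inner^'n. \<Sum>i\<in>UNIV. blinfun_apply (X i) (h $ i))"
  by (intro bounded_linear_sum bounded_linear_compose[OF blinfun.bounded_linear_right]
      bounded_linear_vec_nth)

lemma row_norm_nonneg: "0 \<le> row_norm X"
  unfolding row_norm_def by (rule onorm_pos_le[OF bounded_linear_row])

lemma row_norm_bound:
  fixes X :: "'n::finite \<Rightarrow> 'a::complex_inner \<Rightarrow>\<^sub>L 'a"
  shows "(norm (\<Sum>i\<in>UNIV. X i (v i)))\<^sup>2 \<le> (row_norm X)\<^sup>2 * (\<Sum>i\<in>UNIV. (norm (v i))\<^sup>2)"
proof -
  define h :: "'a^'n" where "h = (\<chi> i. v i)"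
  have "norm (\<Sum>i\<in>UNIV. X i (h $ i)) \<le> row_norm X * norm h"
    unfolding row_norm_def by (rule onorm[OF bounded_linear_row])
  then have "(norm (\<Sum>i\<in>UNIV. X i (v i)))\<^sup>2 \<le> (row_norm X * norm h)\<^sup>2"
    by (intro power_mono) (simp_all add: h_def)
  then show ?thesis
    by (simp add: power_mult_distrib norm_vec_sum[of h]) (simp add: h_def)
qed

text \<open>The row of all words of length k is a k-fold product of the row \<open>X\<close>. Each
  word is given its own vector because the induction peels off first letters.\<close>

lemma words_norm_bound:
  fixes X :: "'n::finite \<Rightarrow> 'a::complex_inner \<Rightarrow>\<^sub>L 'a"
  shows "(norm (\<Sum>\<alpha> | length \<alpha> = k. blinfun_apply (op_word X \<alpha>) (h \<alpha>)))\<^sup>2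
    \<le> ((row_norm X)\<^sup>2) ^ k * (\<Sum>\<alpha> | length \<alpha> = k. (norm (h \<alpha>))\<^sup>2)"
proof (induction k arbitrary: h)
  case (Suc k)
  let ?v = "\<lambda>i. \<Sum>\<beta> | length \<beta> = k. blinfun_apply (op_word X \<beta>) (h (i # \<beta>))"
  have "(\<Sum>\<alpha> | length \<alpha> = Suc k. blinfun_apply (op_word X \<alpha>) (h \<alpha>)) = (\<Sum>i\<in>UNIV. X i (?v i))"
    by (simp add: sum_words_Suc blinfun.sum_right)
  then have "(norm (\<Sum>\<alpha> | length \<alpha> = Suc k. blinfun_apply (op_word X \<alpha>) (h \<alpha>)))\<^sup>2
      \<le> (row_norm X)\<^sup>2 * (\<Sum>i\<in>UNIV. (norm (?v i))\<^sup>2)"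
    using row_norm_bound[of X ?v] by simp
  also have "\<dots> \<le> (row_norm X)\<^sup>2 *
      (\<Sum>i\<in>UNIV. ((row_norm X)\<^sup>2) ^ k * (\<Sum>\<beta> | length \<beta> = k. (norm (h (i # \<beta>)))\<^sup>2))"
    by (intro mult_left_mono sum_mono Suc) simp
  also have "\<dots> = ((row_norm X)\<^sup>2) ^ Suc k * (\<Sum>\<alpha> | length \<alpha> = Suc k. (norm (h \<alpha>))\<^sup>2)"
    by (simp add: sum_words_Suc sum_distrib_left mult.assoc)
  finally show ?case .
qed simp

lemma norm_nc_hom_le:
  fixes X :: "'n::finite \<Rightarrow> 'a::complex_inner \<Rightarrow>\<^sub>L 'a"
  assumes "\<And>i. clinear_op (X i)"
  shows "norm (nc_hom c X k) \<le> sqrt (\<Sum>\<alpha> | length \<alpha> = k. (cmod (c \<alpha>))\<^sup>2) * row_norm X ^ k"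
proof (rule norm_blinfun_bound)
  let ?s = "\<Sum>\<alpha> | length \<alpha> = k. (cmod (c \<alpha>))\<^sup>2"
  show "0 \<le> sqrt ?s * row_norm X ^ k"
    by (simp add: row_norm_nonneg sum_nonneg)
  fix x
  have "nc_hom c X k x = (\<Sum>\<alpha> | length \<alpha> = k. blinfun_apply (op_word X \<alpha>) (c \<alpha> *\<^sub>C x))"
    using clinear_op_word[of X, OF assms]
    by (simp add: nc_hom_def blinfun.sum_left scaleC_op.rep_eq clinear_op_def)
  then have "(norm (nc_hom c X k x))\<^sup>2 \<le> ((row_norm X)\<^sup>2) ^ k * (\<Sum>\<alpha> | length \<alpha> = k. (norm (c \<alpha> *\<^sub>C x))\<^sup>2)"
    using words_norm_bound[where X = X and k = k and h = "\<lambda>\<alpha>. c \<alpha> *\<^sub>C x"] by simp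
  also have "\<dots> = (row_norm X ^ k)\<^sup>2 * ?s * (norm x)\<^sup>2"
    by (simp add: norm_scaleC power_mult_distrib sum_distrib_right mult.assoc flip: power_mult)
      (simp add: mult.commute)
  also have "\<dots> = (sqrt ?s * row_norm X ^ k * norm x)\<^sup>2"
    by (simp add: power_mult_distrib sum_nonneg)
  finally show "norm (nc_hom c X k x) \<le> sqrt ?s * row_norm X ^ k * norm x"
    by (rule power2_le_imp_le) (simp add: row_norm_nonneg sum_nonneg)
qed

text \<open>The Cauchy-Hadamard argument: a radius r strictly between \<rho> and \<gamma> dominates
  the terms by a geometric series of ratio \<rho>/r.\<close>

lemma free_holomorphic_summable:
  fixes p :: "'n::finite ncseries"
  assumes "free_holomorphic \<gamma> p" "0 \<le> \<rho>" "\<rho> < \<gamma>"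
  shows "summable (\<lambda>k. sqrt (\<Sum>\<alpha> | length \<alpha> = k. (cmod (p \<alpha>))\<^sup>2) * \<rho> ^ k)"
proof -
  define s where "s = (\<lambda>k. \<Sum>\<alpha> | length \<alpha> = k. (cmod (p \<alpha>))\<^sup>2)"
  have s0: "0 \<le> s k" for k
    by (simp add: s_def sum_nonneg)
  define L where "L = limsup (\<lambda>k. ereal (root (2 * k) (s k)))"
  have L: "ereal \<gamma> \<le> inverse L"
    using assms(1) by (simp add: free_holomorphic_def nc_radius_def L_def s_def)
  obtain r where r: "\<rho> < r" "r < \<gamma>"
    using dense assms(3) by blast
  then have r0: "0 < r"
    using assms(2) by linarith
  have "L < ereal (1 / r)"
  proof (rule ccontr)
    assume "\<not> ?thesis"
    then have "ereal (1 / r) \<le> L"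
      by simp
    then have "inverse L \<le> inverse (ereal (1 / r))"
      using r0 by (intro ereal_inverse_antimono) simp_all
    also have "\<dots> = ereal r"
      using r0 by simp
    finally show False
      using L r(2) by (metis ereal_less_eq(3) not_le order.trans)
  qed
  then have "\<forall>\<^sub>F k in sequentially. ereal (root (2 * k) (s k)) < ereal (1 / r)"
    unfolding L_def by (rule Limsup_lessD)
  then have "\<forall>\<^sub>F k in sequentially. norm (sqrt (s k) * \<rho> ^ k) \<le> (\<rho> / r) ^ k"
    \<comment> \<open>\<open>root 0\<close> is 0 by convention, so the index 0 is excluded before
      powers are taken.\<close>
    using eventually_gt_at_top[of 0]
  proof eventually_elim
    case (elim k)
    have "s k = (root (2 * k) (s k)) ^ (2 * k)"
      using elim s0 by simp
    also have "\<dots> \<le> (1 / r) ^ (2 * k)"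
      using elim s0 by (intro power_mono) (auto simp: real_root_ge_zero)
    finally have "s k \<le> ((1 / r) ^ k)\<^sup>2"
      by (simp add: power_even_eq)
    then have "sqrt (s k) \<le> (1 / r) ^ k"
      using r0 by (intro real_le_lsqrt) simp_all
    then have "sqrt (s k) * \<rho> ^ k \<le> (1 / r) ^ k * \<rho> ^ k"
      using assms(2) by (intro mult_right_mono) auto
    then show ?case
      using assms(2) s0[of k] by (simp add: power_divide)
  qed
  moreover have "summable (\<lambda>k. (\<rho> / r) ^ k)"
    using assms(2) r r0 by (intro summable_geometric) simp
  ultimately show ?thesis
    unfolding s_def by (rule summable_comparison_test_ev)
qed

lemma free_holomorphic_ell2: "free_holomorphic 1 (Rep_ell2 x)"
  for x :: "'n::finite list ell2"
proof -
  define s where "s = (\<lambda>k. \<Sum>\<alpha> | length \<alpha> = k. (cmod (Rep_ell2 x \<alpha>))\<^sup>2)"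
  have s0: "0 \<le> s k" for k
    by (simp add: s_def sum_nonneg)
  \<comment> \<open>The summand 1 keeps the bound positive for \<open>x = 0\<close>, as the
    convergence of its roots to 1 requires.\<close>
  define C where "C = 1 + (norm x)\<^sup>2"
  have sC: "s k \<le> C" for k
    using ell2_sum_le_norm[OF finite_words_length[of k], of x] by (simp add: s_def C_def)
  define L where "L = limsup (\<lambda>k. ereal (root (2 * k) (s k)))"
  have C0: "0 < C"
    by (simp add: C_def add_pos_nonneg)
  have "(\<lambda>k. root (2 * k) C) \<longlonglongrightarrow> 1"
    by (rule filterlim_compose[OF LIMSEQ_root_const[OF C0]])
      (rule filterlim_subseq, simp add: strict_mono_def)
  then have "(\<lambda>k. ereal (root (2 * k) C)) \<longlonglongrightarrow> ereal 1"
    by simp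
  then have "limsup (\<lambda>k. ereal (root (2 * k) C)) = ereal 1"
    by (intro lim_imp_Limsup) simp_all
  moreover have "L \<le> limsup (\<lambda>k. ereal (root (2 * k) C))"
    unfolding L_def
  proof (intro Limsup_mono always_eventually allI)
    fix k show "ereal (root (2 * k) (s k)) \<le> ereal (root (2 * k) C)"
      using sC[of k] by (cases "k = 0") (simp_all add: real_root_le_mono)
  qed
  ultimately have "L \<le> ereal 1"
    by simp
  moreover have "0 \<le> L"
    unfolding L_def
    by (intro le_Limsup always_eventually allI) (simp_all add: real_root_ge_zero s0)
  ultimately have "inverse (ereal 1) \<le> inverse L"
    by (intro ereal_inverse_antimono)
  then show ?thesis
    by (simp add: free_holomorphic_def nc_radius_def L_def s_def one_ereal_def)
qed

lemma free_holomorphic_one: "free_holomorphic \<gamma> (nc_one :: 'n::finite ncseries)"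
proof -
  have "root (2 * k) (\<Sum>\<alpha> | length \<alpha> = k. (cmod ((nc_one :: 'n ncseries) \<alpha>))\<^sup>2) = 0" for k
  proof (cases "k = 0")
    case False
    then have "(\<Sum>\<alpha> | length \<alpha> = k. (cmod ((nc_one :: 'n ncseries) \<alpha>))\<^sup>2) = 0"
      by (intro sum.neutral) (auto simp: nc_one_def)
    then show ?thesis
      by simp
  qed simp
  then show ?thesis
    by (simp add: free_holomorphic_def nc_radius_def Limsup_const)
qed

lemma summable_norm_nc_hom:
  fixes X :: "'n::finite \<Rightarrow> 'a::chilbert_space \<Rightarrow>\<^sub>L 'a"
  assumes "free_holomorphic \<gamma> p" "X \<in> op_ball \<gamma>"
  shows "summable (\<lambda>k. norm (nc_hom p X k))"
proof (rule summable_comparison_test'[of _ 0])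
  show "summable (\<lambda>k. sqrt (\<Sum>\<alpha> | length \<alpha> = k. (cmod (p \<alpha>))\<^sup>2) * row_norm X ^ k)"
    using assms by (intro free_holomorphic_summable[OF assms(1)] row_norm_nonneg) (simp add: op_ball_def)
  show "norm (norm (nc_hom p X k)) \<le> sqrt (\<Sum>\<alpha> | length \<alpha> = k. (cmod (p \<alpha>))\<^sup>2) * row_norm X ^ k" for k
    using norm_nc_hom_le[of X p k] assms(2) by (simp add: op_ball_def)
qed

lemma nc_eval_sums:
  fixes X :: "'n::finite \<Rightarrow> 'a::chilbert_space \<Rightarrow>\<^sub>L 'a"
  assumes "free_holomorphic \<gamma> p" "X \<in> op_ball \<gamma>"
  shows "(\<lambda>k. nc_hom p X k) sums nc_eval p X"
  unfolding nc_eval_def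
  by (rule summable_sums[OF summable_norm_cancel[OF summable_norm_nc_hom[OF assms]]])

lemma nc_eval_diff:
  fixes X :: "'n::finite \<Rightarrow> 'a::chilbert_space \<Rightarrow>\<^sub>L 'a"
  assumes "free_holomorphic \<gamma> p" "free_holomorphic \<gamma> q" "X \<in> op_ball \<gamma>"
  shows "nc_eval (\<lambda>\<alpha>. p \<alpha> - q \<alpha>) X = nc_eval p X - nc_eval q X"
proof -
  have "nc_hom (\<lambda>\<alpha>. p \<alpha> - q \<alpha>) X k = nc_hom p X k - nc_hom q X k" for k
    unfolding nc_hom_def sum_subtractf[symmetric]
    by (intro sum.cong refl blinfun_eqI)
      (simp add: scaleC_op.rep_eq blinfun.diff_left complex_vector.scale_left_diff_distrib)
  then have "(\<lambda>k. nc_hom (\<lambda>\<alpha>. p \<alpha> - q \<alpha>) X k) sums (nc_eval p X - nc_eval q X)"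
    using sums_diff[OF nc_eval_sums[OF assms(1,3)] nc_eval_sums[OF assms(2,3)]] by simp
  then show ?thesis
    unfolding nc_eval_def[of "\<lambda>\<alpha>. p \<alpha> - q \<alpha>"] by (rule sums_unique[symmetric])
qed

section \<open>Products of free holomorphic functions\<close>

lemma cauchy_product_compose:
  fixes A B :: "nat \<Rightarrow> 'a::chilbert_space \<Rightarrow>\<^sub>L 'a"
  assumes "summable (\<lambda>k. norm (A k))" "summable (\<lambda>k. norm (B k))"
  shows "(\<lambda>k. \<Sum>j\<le>k. A j o\<^sub>L B (k - j)) sums ((\<Sum>k. A k) o\<^sub>L (\<Sum>k. B k))"
proof -
  have has: "(A has_sum (\<Sum>k. A k)) UNIV" "(B has_sum (\<Sum>k. B k)) UNIV"
    using assms by (auto intro!: norm_summable_imp_has_sum summable_sums[OF summable_norm_cancel])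
  have nh: "((\<lambda>k. norm (B k)) has_sum (\<Sum>k. norm (B k))) UNIV"
    using assms by (intro norm_summable_imp_has_sum summable_sums) simp_all
  have ns: "(\<lambda>k. norm (A k)) summable_on UNIV"
    using assms(1) by (simp add: summable_on_UNIV_nonneg_real_iff)
  define h where "h = (\<lambda>(j, m). A j o\<^sub>L B m)"
  have "(\<lambda>(j, m). norm (A j) * norm (B m)) summable_on (UNIV \<times> UNIV)"
  proof (rule summable_on_SigmaI)
    show "((\<lambda>m. case (j, m) of (j, m) \<Rightarrow> norm (A j) * norm (B m)) has_sum norm (A j) * (\<Sum>k. norm (B k))) UNIV"
      for j using has_sum_cmult_right[OF nh, of "norm (A j)"] by simp
    show "(\<lambda>j. norm (A j) * (\<Sum>k. norm (B k))) summable_on UNIV"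
      by (rule summable_on_cmult_left[OF ns])
  qed simp
  then have "(\<lambda>p. norm (h p)) summable_on (UNIV \<times> UNIV)"
    by (rule summable_on_comparison_test) (auto simp: h_def norm_blinfun_compose)
  then have "h summable_on UNIV"
    using abs_summable_summable by (metis UNIV_Times_UNIV)
  then obtain s where s: "(h has_sum s) UNIV"
    by (auto simp: summable_on_def)
  \<comment> \<open>Absolute summability over all pairs allows one sum to be taken in two ways: by
    rows here, which gives the composition of the sums, and by antidiagonals below.\<close>
  have "((\<lambda>j. A j o\<^sub>L (\<Sum>k. B k)) has_sum s) UNIV"
  proof (rule has_sum_SigmaD)
    show "(h has_sum s) (SIGMA j:UNIV. UNIV)"
      using s by simp
    show "((\<lambda>m. h (j, m)) has_sum (A j o\<^sub>L (\<Sum>k. B k))) UNIV" for j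
      using has_sum_bounded_linear[OF bounded_bilinear.bounded_linear_right[OF bounded_bilinear_blinfun_compose] has(2), of "A j"]
      by (simp add: h_def)
  qed
  moreover have "((\<lambda>j. A j o\<^sub>L (\<Sum>k. B k)) has_sum ((\<Sum>k. A k) o\<^sub>L (\<Sum>k. B k))) UNIV"
    by (rule has_sum_bounded_linear[OF bounded_bilinear.bounded_linear_left[OF bounded_bilinear_blinfun_compose] has(1)])
  ultimately have s_eq: "s = (\<Sum>k. A k) o\<^sub>L (\<Sum>k. B k)"
    by (rule has_sum_unique)
  have fib: "{p. fst p + snd p = k} = (\<lambda>j. (j, k - j)) ` {..k}" for k :: nat
    by (auto simp: image_iff)
  have "((\<lambda>k. \<Sum>p | fst p + snd p = k. h p) has_sum s) UNIV"
    by (rule has_sum_fibers[OF s]) (simp add: fib)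
  moreover have "(\<Sum>p | fst p + snd p = k. h p) = (\<Sum>j\<le>k. A j o\<^sub>L B (k - j))" for k
    unfolding fib by (subst sum.reindex) (auto simp: inj_on_def h_def)
  ultimately show ?thesis
    by (intro has_sum_imp_sums) (simp add: s_eq)
qed

lemma sum_words_split:
  fixes F :: "'n::finite list \<Rightarrow> 'n list \<Rightarrow> 'b::comm_monoid_add"
  assumes "j \<le> k"
  shows "(\<Sum>w | length w = k. F (take j w) (drop j w)) =
    (\<Sum>u | length u = j. \<Sum>v | length v = k - j. F u v)"
proof -
  have "(\<Sum>w | length w = k. F (take j w) (drop j w)) =
      (\<Sum>(u, v)\<in>{u. length u = j} \<times> {v. length v = k - j}. F u v)"
    by (rule sum.reindex_bij_witness[where i = "\<lambda>(u, v). u @ v" and j = "\<lambda>w. (take j w, drop j w)"])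
      (use assms in auto)
  then show ?thesis
    by (simp add: sum.cartesian_product)
qed

lemma nc_hom_mult:
  fixes X :: "'n::finite \<Rightarrow> 'a::chilbert_space \<Rightarrow>\<^sub>L 'a"
  assumes X: "\<And>i. clinear_op (X i)"
  shows "nc_hom (nc_mult p q) X k = (\<Sum>j\<le>k. nc_hom p X j o\<^sub>L nc_hom q X (k - j))"
proof (rule blinfun_eqI)
  fix x
  let ?F = "\<lambda>u v. (p u * q v) *\<^sub>C op_word X u (op_word X v x)"
  have "nc_hom (nc_mult p q) X k x = (\<Sum>w | length w = k. \<Sum>j\<le>k. ?F (take j w) (drop j w))"
    unfolding nc_hom_def blinfun.sum_left
  proof (rule sum.cong)
    fix w :: "'n list" assume "w \<in> {w. length w = k}"
    moreover have "op_word X w x = op_word X (take j w) (op_word X (drop j w) x)" for j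
      using op_word_append[of X "take j w" "drop j w"] by simp
    ultimately show "(scaleC_op (nc_mult p q w) o\<^sub>L op_word X w) x = (\<Sum>j\<le>k. ?F (take j w) (drop j w))"
      by (simp add: nc_mult_def scaleC_op.rep_eq complex_vector.scale_sum_left)
  qed simp
  also have "\<dots> = (\<Sum>j\<le>k. \<Sum>w | length w = k. ?F (take j w) (drop j w))"
    by (rule sum.swap)
  also have "\<dots> = (\<Sum>j\<le>k. \<Sum>u | length u = j. \<Sum>v | length v = k - j. ?F u v)"
    by (rule sum.cong[OF refl], rule sum_words_split[where F = ?F]) simp
  also have "\<dots> = (\<Sum>j\<le>k. \<Sum>v | length v = k - j. \<Sum>u | length u = j. ?F u v)"
    by (intro sum.cong refl sum.swap)
  also have "\<dots> = (\<Sum>j\<le>k. (nc_hom p X j o\<^sub>L nc_hom q X (k - j)) x)"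
    using clinear_op_word[of X, OF X]
    by (simp add: nc_hom_def blinfun.sum_left blinfun.sum_right scaleC_op.rep_eq clinear_op_def
        complex_vector.scale_sum_right scaleC_scaleC)
  finally show "nc_hom (nc_mult p q) X k x = (\<Sum>j\<le>k. nc_hom p X j o\<^sub>L nc_hom q X (k - j)) x"
    by (simp add: blinfun.sum_left)
qed

lemma nc_eval_mult:
  fixes X :: "'n::finite \<Rightarrow> 'a::chilbert_space \<Rightarrow>\<^sub>L 'a"
  assumes "free_holomorphic \<gamma> p" "free_holomorphic \<gamma> q" "X \<in> op_ball \<gamma>"
  shows "nc_eval (nc_mult p q) X = nc_eval p X o\<^sub>L nc_eval q X"
proof -
  have "\<And>i. clinear_op (X i)"
    using assms(3) by (simp add: op_ball_def)
  then have "(\<lambda>k. nc_hom (nc_mult p q) X k) sums (nc_eval p X o\<^sub>L nc_eval q X)"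
    unfolding nc_eval_def
    using cauchy_product_compose[OF summable_norm_nc_hom[OF assms(1,3)] summable_norm_nc_hom[OF assms(2,3)]]
    by (simp add: nc_hom_mult)
  then show ?thesis
    unfolding nc_eval_def[of "nc_mult p q"] by (rule sums_unique[symmetric])
qed

lemma nc_eval_unit: "nc_eval (Rep_ell2 (ell2_unit \<beta>)) X = op_word X \<beta>"
  for X :: "'n::finite \<Rightarrow> 'a::chilbert_space \<Rightarrow>\<^sub>L 'a"
proof -
  have hom: "nc_hom (Rep_ell2 (ell2_unit \<beta>)) X k = (if k = length \<beta> then op_word X \<beta> else 0)" for k
  proof -
    have "nc_hom (Rep_ell2 (ell2_unit \<beta>)) X k =
        (\<Sum>\<alpha> | length \<alpha> = k. if \<alpha> = \<beta> then op_word X \<beta> else 0)"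
      unfolding nc_hom_def
      by (rule sum.cong) (auto simp: ell2_unit.rep_eq scaleC_op_one scaleC_op_zero)
    then show ?thesis
      by (simp add: finite_words_length)
  qed
  have "(\<lambda>k. nc_hom (Rep_ell2 (ell2_unit \<beta>)) X k) sums op_word X \<beta>"
    unfolding hom using sums_single[of "length \<beta>" "\<lambda>_. op_word X \<beta>"] by (simp cong: if_cong)
  then show ?thesis
    unfolding nc_eval_def by (rule sums_unique[symmetric])
qed


section \<open>The three kinds of models\<close>

text \<open>The witness \<open>b\<close> in the third assumption is supplied by the existence of
  \<open>M\<close>. In the free holomorphic case it carries the information that the product with
  Z_i is again free holomorphic.\<close>

lemma hardy_M_unit:
  assumes unit: "\<And>\<beta>. hardy_element \<kappa> f (nc_word f \<beta>) (ell2_unit \<beta>)"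
    and uniq: "\<And>p a b. hardy_element \<kappa> f p a \<Longrightarrow> hardy_element \<kappa> f p b \<Longrightarrow> a = b"
    and append: "\<And>i \<beta> a b. hardy_element \<kappa> f (nc_var i) a \<Longrightarrow>
      hardy_element \<kappa> f (nc_mult (nc_var i) (nc_word f \<beta>)) b \<Longrightarrow>
      hardy_element \<kappa> f (nc_mult (nc_var i) (nc_word f \<beta>)) (append_word \<beta> a)"
    and "universal_model \<kappa> f M" "hardy_element \<kappa> f (nc_var i) a"
  shows "M i (ell2_unit \<beta>) = append_word \<beta> a"
proof -
  have "hardy_element \<kappa> f (nc_mult (nc_var i) (nc_word f \<beta>)) (M i (ell2_unit \<beta>))"
    using assms(4) unit by (auto simp: universal_model_def left_mult_def)
  then show ?thesis
    using append[OF assms(5)] uniq by blast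
qed

lemma fock_model_of_condition:
  fixes f :: "'n::finite \<Rightarrow> 'n ncseries"
  assumes unit: "\<And>\<beta>. hardy_element \<kappa> f (nc_word f \<beta>) (ell2_unit \<beta>)"
    and uniq: "\<And>p a b. hardy_element \<kappa> f p a \<Longrightarrow> hardy_element \<kappa> f p b \<Longrightarrow> a = b"
    and append: "\<And>i \<beta> a b. hardy_element \<kappa> f (nc_var i) a \<Longrightarrow>
      hardy_element \<kappa> f (nc_mult (nc_var i) (nc_word f \<beta>)) b \<Longrightarrow>
      hardy_element \<kappa> f (nc_mult (nc_var i) (nc_word f \<beta>)) (append_word \<beta> a)"
    and M: "universal_model \<kappa> f M" and G: "\<And>i. hardy_element \<kappa> f (nc_var i) (G i)"
    and "model_condition \<kappa> f"
  shows "\<exists>Y. fock_model f G M Y"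
proof -
  obtain M' Y where M': "universal_model \<kappa> f M'" and val: "sot_value f M' Y \<or> rad_value f M' Y"
    and Y: "\<And>j. left_mult \<kappa> f (f j) (Y j)"
    using assms(6) by (auto simp: model_condition_def)
  have unit_M: "M i (ell2_unit \<beta>) = append_word \<beta> (G i)" for i \<beta>
    by (rule hardy_M_unit[where \<kappa> = \<kappa> and f = f];
        (rule unit | erule (1) uniq | erule (1) append | rule M | rule G))
  have unit_M': "M' i (ell2_unit \<beta>) = append_word \<beta> (G i)" for i \<beta>
    by (rule hardy_M_unit[where \<kappa> = \<kappa> and f = f];
        (rule unit | erule (1) uniq | erule (1) append | rule M' | rule G))
  have cl: "clinear_op (M i)" "clinear_op (M' i)" for i
    using M M' by (auto simp: universal_model_def left_mult_def)
  \<comment> \<open>The model condition speaks of some universal model. Its action on basis vectors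
    is forced by uniqueness of coefficients, so it is the given one.\<close>
  have "M' = M"
  proof
    show "M' i = M i" for i
      by (rule clinear_op_ell2_eqI) (use cl in \<open>auto simp: clinear_op_def unit_M unit_M'\<close>)
  qed
  have "fock_model f G M Y"
  proof
    show "Y j (ell2_unit \<beta>) = ell2_unit (j # \<beta>)" for j \<beta>
    proof (rule uniq)
      show "hardy_element \<kappa> f (nc_word f (j # \<beta>)) (Y j (ell2_unit \<beta>))"
        using Y unit by (auto simp: left_mult_def)
    qed (rule unit)
  qed (use cl unit_M val \<open>M' = M\<close> in auto)
  then show ?thesis
    by blast
qed

lemma fock_model_formal:
  fixes f :: "'n::finite \<Rightarrow> 'n ncseries"
  assumes f: "model_property Formal f" and M: "universal_model Formal f M"
    and G: "\<And>i. hardy_element Formal f (nc_var i) (G i)"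
  shows "\<exists>Y. fock_model f G M Y"
proof (rule fock_model_of_condition[where \<kappa> = Formal])
  have f0: "f i [] = 0" and det: "det (\<chi> i j. f i [j]) \<noteq> 0" for i
    using f by auto
  note lf = locally_finite_formal[of f, OF f0]
  show "hardy_element Formal f (nc_word f \<beta>) (ell2_unit \<beta>)" for \<beta>
    by (rule hardy_element_unit) simp
  show "a = b" if "hardy_element Formal f p a" "hardy_element Formal f p b" for p a b
  proof (rule ell2_eqI)
    fix \<alpha>
    have "nc_comp (\<lambda>\<alpha>. Rep_ell2 a \<alpha> - Rep_ell2 b \<alpha>) f w = 0" for w
      using that by (simp add: nc_comp_diff[OF lf lf])
    then show "Rep_ell2 a \<alpha> = Rep_ell2 b \<alpha>"
      using nc_comp_formal_eq_0[of f "\<lambda>\<alpha>. Rep_ell2 a \<alpha> - Rep_ell2 b \<alpha>" \<alpha>, OF f0 det] by simp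
  qed
  show "hardy_element Formal f (nc_mult (nc_var i) (nc_word f \<beta>)) (append_word \<beta> a)"
    if "hardy_element Formal f (nc_var i) a" for i \<beta> a
    using that by (simp add: nc_comp_append_word[OF lf])
  show "model_condition Formal f"
    using f by simp
qed (use M G in auto)

text \<open>Each coefficient of both sides is a bounded functional of \<open>x\<close>, so basis
  vectors decide. It turns words in M into convolution with words in the g_i.\<close>

lemma Rep_M_eq_mult:
  assumes "clinear_op T" "\<And>\<beta>. T (ell2_unit \<beta>) = append_word \<beta> a"
  shows "Rep_ell2 (T x) = nc_mult (Rep_ell2 a) (Rep_ell2 x)"
proof
  fix w
  show "Rep_ell2 (T x) w = nc_mult (Rep_ell2 a) (Rep_ell2 x) w"
  proof (rule bounded_clinear_ell2_eqI)
    show "bounded_linear (\<lambda>x. Rep_ell2 (T x) w)"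
      by (intro bounded_linear_compose[OF bounded_linear_Rep_ell2] blinfun.bounded_linear_right)
    show "bounded_linear (\<lambda>x. nc_mult (Rep_ell2 a) (Rep_ell2 x) w)"
      unfolding nc_mult_def
      by (intro bounded_linear_sum bounded_linear_const_mult bounded_linear_Rep_ell2)
    show "Rep_ell2 (T (c *\<^sub>C x)) w = c *\<^sub>C Rep_ell2 (T x) w" for c x
      using assms(1) by (simp add: clinear_op_def scaleC_ell2.rep_eq scaleC_complex_def)
    show "nc_mult (Rep_ell2 a) (Rep_ell2 (c *\<^sub>C x)) w = c *\<^sub>C nc_mult (Rep_ell2 a) (Rep_ell2 x) w" for c x
      by (simp add: nc_mult_def scaleC_ell2.rep_eq scaleC_complex_def sum_distrib_left mult_ac)
    show "Rep_ell2 (T (ell2_unit \<beta>)) w = nc_mult (Rep_ell2 a) (Rep_ell2 (ell2_unit \<beta>)) w" for \<beta>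
      by (simp add: assms(2) Rep_append_word_mult)
  qed
qed

text \<open>The model property contains no convergence statement in this case, so f(M) is
  constructed: the finite sum f_j(M) acts as left convolution with f_j composed with g, which is the
  variable Z_j.\<close>

lemma fock_model_polynomial:
  fixes f :: "'n::finite \<Rightarrow> 'n ncseries"
  assumes f: "model_property Polynomial f" and M: "universal_model Polynomial f M"
    and G: "\<And>i. hardy_element Polynomial f (nc_var i) (G i)"
  shows "\<exists>Y. fock_model f G M Y"
proof -
  obtain g where pol: "\<And>i. nc_polynomial (f i)" "\<And>i. nc_polynomial (g i)"
    and fg: "\<And>i. nc_comp (f i) g = nc_var i" and gf: "\<And>i. nc_comp (g i) f = nc_var i"
    using f by auto
  have eq0: "a \<alpha> = b \<alpha>" if "nc_polynomial a" "nc_polynomial b" "nc_comp a f = nc_comp b f" for a b \<alpha>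
  proof -
    have sub: "{\<alpha>. a \<alpha> - b \<alpha> \<noteq> 0} \<subseteq> {\<alpha>. a \<alpha> \<noteq> 0} \<union> {\<alpha>. b \<alpha> \<noteq> 0}"
      by auto
    have "nc_polynomial (\<lambda>\<alpha>. a \<alpha> - b \<alpha>)"
      unfolding nc_polynomial_def
      by (rule finite_subset[OF sub]) (use that(1,2) in \<open>simp add: nc_polynomial_def\<close>)
    moreover have "nc_comp (\<lambda>\<alpha>. a \<alpha> - b \<alpha>) f w = 0" for w
      using that by (simp add: nc_comp_diff locally_finite_polynomial)
    ultimately show ?thesis
      using nc_comp_polynomial_eq_0[of f g "\<lambda>\<alpha>. a \<alpha> - b \<alpha>" \<alpha>] pol fg by simp
  qed
  have unit_M: "M i (ell2_unit \<beta>) = append_word \<beta> (G i)" for i \<beta>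
  proof (rule hardy_M_unit[where \<kappa> = Polynomial and f = f])
    show "hardy_element Polynomial f (nc_word f \<beta>) (ell2_unit \<beta>)" for \<beta>
      by (rule hardy_element_unit) simp
    show "a = b" if "hardy_element Polynomial f p a" "hardy_element Polynomial f p b" for p a b
      using that by (intro ell2_eqI eq0) auto
    show "hardy_element Polynomial f (nc_mult (nc_var i) (nc_word f \<beta>)) (append_word \<beta> a)"
      if "hardy_element Polynomial f (nc_var i) a" for i \<beta> a
      using that
      by (simp add: nc_comp_append_word locally_finite_polynomial)
        (simp add: Rep_append_word_mult nc_polynomial_mult nc_polynomial_unit)
  qed (use M G in auto)
  have cl: "clinear_op (M i)" for i
    using M by (auto simp: universal_model_def left_mult_def)
  have g: "Rep_ell2 (G i) = g i" for i
    using eq0[of "Rep_ell2 (G i)" "g i"] G[of i] pol(2) gf by (simp add: fun_eq_iff)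
  have word: "Rep_ell2 (blinfun_apply (op_word M \<alpha>) x) = nc_mult (nc_word g \<alpha>) (Rep_ell2 x)" for \<alpha> x
  proof (induction \<alpha>)
    case (Cons i \<alpha>)
    then show ?case
      using Rep_M_eq_mult[OF cl unit_M] by (simp add: g nc_mult_assoc)
  qed (simp add: nc_mult_one_left)
  define A where "A = (\<lambda>j. {\<alpha>. f j \<alpha> \<noteq> 0})"
  have fin: "finite (A j)" for j
    using pol(1) by (simp add: A_def nc_polynomial_def)
  define Y where "Y = (\<lambda>j. \<Sum>\<alpha>\<in>A j. scaleC_op (f j \<alpha>) o\<^sub>L op_word M \<alpha>)"
  have "fock_model f G M Y"
  proof
    show "Y j (ell2_unit \<beta>) = ell2_unit (j # \<beta>)" for j \<beta>
    proof (rule ell2_eqI)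
      fix w
      have "Rep_ell2 (Y j (ell2_unit \<beta>)) w =
          nc_mult (\<lambda>u. \<Sum>\<alpha>\<in>A j. f j \<alpha> * nc_word g \<alpha> u) (Rep_ell2 (ell2_unit \<beta>)) w"
        by (simp add: Y_def blinfun.sum_left Rep_ell2_sum scaleC_op.rep_eq scaleC_ell2.rep_eq word
            nc_mult_sum_left)
      also have "(\<lambda>u. \<Sum>\<alpha>\<in>A j. f j \<alpha> * nc_word g \<alpha> u) = nc_comp (f j) g"
        by (rule ext, rule nc_comp_eq_sum[symmetric]) (use fin in \<open>auto simp: A_def\<close>)
      finally show "Rep_ell2 (Y j (ell2_unit \<beta>)) w = Rep_ell2 (ell2_unit (j # \<beta>)) w"
        using Rep_ell2_unit_append[of "[j]" \<beta>] by (simp add: fg Rep_ell2_unit_single)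
    qed
    have "limitin strong_operator_topology (\<lambda>N. \<Sum>k<N. nc_hom (f j) M k) (Y j) sequentially" for j
    proof (rule limitin_sot_of_norm)
      \<comment> \<open>Beyond this degree all homogeneous parts vanish, so the partial sums are
        eventually equal to \<open>Y j\<close>.\<close>
      obtain m where m: "\<And>\<alpha>. \<alpha> \<in> A j \<Longrightarrow> length \<alpha> < m"
        using finite_nat_set_iff_bounded[of "length ` A j"] fin by auto
      have "(\<Sum>k<N. nc_hom (f j) M k) = Y j" if "m \<le> N" for N
      proof -
        have "(\<Sum>k<N. nc_hom (f j) M k) =
            (\<Sum>\<alpha>\<in>(\<Union>k\<in>{..<N}. {\<alpha>. length \<alpha> = k}). scaleC_op (f j \<alpha>) o\<^sub>L op_word M \<alpha>)"
          unfolding nc_hom_def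
          by (rule sum.UNION_disjoint[symmetric]) (auto simp: finite_words_length)
        also have "\<dots> = Y j"
          unfolding Y_def
          by (rule sum.mono_neutral_right)
            (use m that in \<open>fastforce simp: finite_words_length A_def scaleC_op_zero\<close>)+
        finally show ?thesis .
      qed
      then show "(\<lambda>N. \<Sum>k<N. nc_hom (f j) M k) \<longlonglongrightarrow> Y j"
        by (intro tendsto_eventually eventually_sequentiallyI[of m])
    qed
    then show "sot_value f M Y \<or> rad_value f M Y"
      by (simp add: sot_value_def)
  qed (use cl unit_M in auto)
  then show ?thesis
    by blast
qed

text \<open>Composition with f is faithful on free holomorphic functions of the unit ball, and
  square-summable families are among these; hence coefficients are unique.\<close>

lemma fock_model_free_holomorphic:
  fixes f :: "'n::finite \<Rightarrow> 'n ncseries"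
  assumes f: "model_property (Free_Holomorphic \<gamma>) f" and M: "universal_model (Free_Holomorphic \<gamma>) f M"
    and G: "\<And>i. hardy_element (Free_Holomorphic \<gamma>) f (nc_var i) (G i)"
  shows "\<exists>Y. fock_model f G M Y"
proof (rule fock_model_of_condition[where \<kappa> = "Free_Holomorphic \<gamma>"])
  let ?f = "\<lambda>X :: 'n \<Rightarrow> nat ell2 \<Rightarrow>\<^sub>L nat ell2. \<lambda>j. nc_eval (f j) X"
  have fh: "free_holomorphic \<gamma> (f i)" for i
    using f by simp
  have ball: "?f X \<in> op_ball 1" if "X \<in> op_ball \<gamma>" for X
    using f that by simp
  have faithful: "G = (\<lambda>_. 0)"
    if "free_holomorphic 1 G" "\<And>X. X \<in> op_ball \<gamma> \<Longrightarrow> nc_eval G (?f X) = 0" for G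
    using f that by (metis model_property.simps(3))
  show cond: "model_condition (Free_Holomorphic \<gamma>) f"
    using f by simp
  then obtain Y where Y: "\<And>j. left_mult (Free_Holomorphic \<gamma>) f (f j) (Y j)"
    by (auto simp: model_condition_def)
  show unit: "hardy_element (Free_Holomorphic \<gamma>) f (nc_word f \<beta>) (ell2_unit \<beta>)" for \<beta>
  proof (induction \<beta>)
    case Nil
    have "nc_eval (nc_one :: 'n ncseries) X = id_blinfun" for X :: "'n \<Rightarrow> nat ell2 \<Rightarrow>\<^sub>L nat ell2"
      using nc_eval_unit[of "[]" X] by (simp add: Rep_ell2_unit_Nil)
    then show ?case
      by (simp add: free_holomorphic_one Rep_ell2_unit_Nil)
  next
    case (Cons j \<beta>)
    \<comment> \<open>That the product with f_j is free holomorphic is read off from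
      \<open>Y j\<close> mapping the Hardy space to itself.\<close>
    have "hardy_element (Free_Holomorphic \<gamma>) f (nc_mult (f j) (nc_word f \<beta>)) (Y j (ell2_unit \<beta>))"
      using Y Cons by (auto simp: left_mult_def simp del: hardy_element.simps)
    then have "free_holomorphic \<gamma> (nc_mult (f j) (nc_word f \<beta>))"
      by simp
    moreover have "nc_eval (nc_mult (f j) (nc_word f \<beta>)) X = nc_eval (Rep_ell2 (ell2_unit (j # \<beta>))) (?f X)"
      if "X \<in> op_ball \<gamma>" for X :: "'n \<Rightarrow> nat ell2 \<Rightarrow>\<^sub>L nat ell2"
      using Cons that by (simp add: nc_eval_mult[OF fh _ that] nc_eval_unit)
    ultimately show ?case
      by simp
  qed
  show "a = b"
    if "hardy_element (Free_Holomorphic \<gamma>) f p a" "hardy_element (Free_Holomorphic \<gamma>) f p b" for p a b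
  proof -
    have "nc_eval (Rep_ell2 (a - b)) (?f X) = 0" if X: "X \<in> op_ball \<gamma>" for X
      using nc_eval_diff[OF free_holomorphic_ell2[of a] free_holomorphic_ell2[of b] ball[OF X]]
        that X \<open>hardy_element (Free_Holomorphic \<gamma>) f p a\<close> \<open>hardy_element (Free_Holomorphic \<gamma>) f p b\<close>
      by (simp add: minus_ell2.rep_eq[abs_def])
    then have "Rep_ell2 (a - b) = (\<lambda>_. 0)"
      by (intro faithful free_holomorphic_ell2)
    then show ?thesis
      by (intro ell2_eqI) (simp add: minus_ell2.rep_eq fun_eq_iff)
  qed
  show "hardy_element (Free_Holomorphic \<gamma>) f (nc_mult (nc_var i) (nc_word f \<beta>)) (append_word \<beta> a)"
    if a: "hardy_element (Free_Holomorphic \<gamma>) f (nc_var i) a"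
      and b: "hardy_element (Free_Holomorphic \<gamma>) f (nc_mult (nc_var i) (nc_word f \<beta>)) b" for i \<beta> a b
  proof -
    have "nc_eval (nc_mult (nc_var i) (nc_word f \<beta>)) X = nc_eval (Rep_ell2 (append_word \<beta> a)) (?f X)"
      if X: "X \<in> op_ball \<gamma>" for X
    proof -
      have "nc_eval (nc_mult (nc_var i) (nc_word f \<beta>)) X = nc_eval (nc_var i) X o\<^sub>L nc_eval (nc_word f \<beta>) X"
        using a unit[of \<beta>] by (intro nc_eval_mult[OF _ _ X]) simp_all
      also have "\<dots> = nc_eval (Rep_ell2 a) (?f X) o\<^sub>L nc_eval (Rep_ell2 (ell2_unit \<beta>)) (?f X)"
        using a unit[of \<beta>] X by simp
      also have "\<dots> = nc_eval (Rep_ell2 (append_word \<beta> a)) (?f X)"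
        unfolding Rep_append_word_mult
        by (rule nc_eval_mult[OF free_holomorphic_ell2 free_holomorphic_ell2 ball[OF X], symmetric])
      finally show ?thesis .
    qed
    then show ?thesis
      using b by simp
  qed
qed (use M G in auto)

lemma fock_model_exists:
  fixes f g :: "'n::finite \<Rightarrow> 'n ncseries"
  assumes "model_property \<kappa> f" "universal_model \<kappa> f M" "model_inverse \<kappa> f g"
  obtains G Y where "g = (\<lambda>i. Rep_ell2 (G i))" "fock_model f G M Y"
proof -
  obtain G where G: "\<And>i. hardy_element \<kappa> f (nc_var i) (G i)" "\<And>i. g i = Rep_ell2 (G i)"
    using assms(3) unfolding model_inverse_def by metis
  have "\<exists>Y. fock_model f G M Y"
    using assms(1,2) G(1) fock_model_polynomial fock_model_formal fock_model_free_holomorphic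
    by (cases \<kappa>) blast+
  then show ?thesis
    using that G(2) by blast
qed


section \<open>The symmetric Hardy space as a function space\<close>

context fock_model
begin

abbreviation "inv_series \<equiv> \<lambda>i. Rep_ell2 (G i)"

lemma point_gap_inv_point: "norm l < 1 \<Longrightarrow> point_gap f (inv_point l) = 1 - (norm l)\<^sup>2"
  by (simp add: point_gap_def point_value_inv_point norm_vec_sum)

lemma Gamma_vector_inv_point:
  assumes "norm l < 1"
  shows "Gamma_vector f (inv_point l) = sqrt (1 - (norm l)\<^sup>2) *\<^sub>R szego_vector l"
proof -
  have "(\<Sum>\<^sub>\<infinity>\<alpha>. scalar_word (\<lambda>i. cnj (l $ i)) \<alpha> *\<^sub>C ell2_unit \<alpha>) = szego_vector l"
    using ell2_has_sum[of "szego_vector l"]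
    by (intro infsumI) (simp add: Rep_szego_vector assms cnj_scalar_word)
  then show ?thesis
    by (simp add: Gamma_vector_def point_gap_inv_point point_value_inv_point assms)
qed

lemma gap_pos: "norm l < 1 \<Longrightarrow> 0 < 1 - (norm l)\<^sup>2"
  by (simp add: abs_square_less_1)

lemma Omega_vector_inv_point:
  assumes "norm l < 1"
  shows "Omega_vector f (inv_point l) = szego_vector l"
  using gap_pos[OF assms]
  by (simp add: Omega_vector_def Gamma_vector_inv_point point_gap_inv_point assms)

lemma cinner_Omega: "norm l < 1 \<Longrightarrow> cinner x (Omega_vector f (inv_point l)) = fock_eval l x"
  by (simp add: Omega_vector_inv_point fock_eval_def)

text \<open>Each Gamma vector is a positive multiple of a Szego vector, so the spans agree even
  before taking closures.\<close>

lemma closure_span_Gamma: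
  "closure (cspan (Gamma_vector f ` scalar_domain f inv_series)) = symmetric_families"
proof -
  have "cspan (Gamma_vector f ` scalar_domain f inv_series) = cspan (szego_vector ` ball 0 1)"
    unfolding complex_vector.span_eq
  proof (intro conjI subsetI)
    fix x assume "x \<in> Gamma_vector f ` scalar_domain f inv_series"
    then obtain l where "norm l < 1" "x = sqrt (1 - (norm l)\<^sup>2) *\<^sub>R szego_vector l"
      by (auto simp: scalar_domain_eq Gamma_vector_inv_point)
    then show "x \<in> cspan (szego_vector ` ball 0 1)"
      by (simp only: scaleR_scaleC) (intro complex_vector.span_scale complex_vector.span_base imageI, simp)
  next
    fix x :: "'n list ell2" assume "x \<in> szego_vector ` ball 0 1"
    then obtain l where l: "norm l < 1" "x = szego_vector l"
      by auto
    then have x: "x = (1 / sqrt (1 - (norm l)\<^sup>2)) *\<^sub>R Gamma_vector f (inv_point l)"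
      using gap_pos[of l] by (simp add: Gamma_vector_inv_point)
    show "x \<in> cspan (Gamma_vector f ` scalar_domain f inv_series)"
      unfolding x scaleR_scaleC
      by (intro complex_vector.span_scale complex_vector.span_base imageI inv_point_in_domain l(1))
  qed
  then show ?thesis
    by (simp add: closure_span_szego)
qed

section \<open>Elements of the symmetric Hardy space as holomorphic functions\<close>

lemma functional_representation_inv_point:
  "norm l < 1 \<Longrightarrow> functional_representation f inv_series x (inv_point l) = fock_eval l x"
  by (simp add: functional_representation_def inv_point_in_domain cinner_Omega)

lemma evaluation_has_sum:
  assumes "z \<in> scalar_domain f inv_series"
  shows "((\<lambda>k. sym_coeff x k * scalar_monomial (point_value f z) k) has_sum
    cinner x (Omega_vector f z)) UNIV"
proof -
  obtain l where "norm l < 1" "z = inv_point l"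
    using assms by (auto simp: scalar_domain_eq)
  then show ?thesis
    using fock_eval_sym_has_sum[of l x] by (simp add: cinner_Omega point_value_inv_point)
qed

text \<open>The chain rule for evaluation on the ball after f. The restricted function agrees with
  this composite on the domain, which is enough for a derivative within it.\<close>

lemma functional_representation_holomorphic:
  "several_holomorphic_on (functional_representation f inv_series x) (scalar_domain f inv_series)"
  unfolding several_holomorphic_on_def
proof
  fix z assume z: "z \<in> scalar_domain f inv_series"
  then obtain l where l: "norm l < 1" "z = inv_point l"
    by (auto simp: scalar_domain_eq)
  obtain D where D: "((\<lambda>z. vec_lambda (point_value f z)) has_derivative D) (at z)"
    "\<And>c v. D (c *s v) = c *s D v"
    using inv_point_inverse_has_derivative[OF l(1)] l(2) by metis
  have "vec_lambda (point_value f z) = l"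
    by (simp add: l point_value_inv_point vec_lambda_eta)
  then have "((\<lambda>m. fock_eval m x) has_derivative (\<lambda>h. fock_deriv l h x)) (at (vec_lambda (point_value f z)))"
    using fock_eval_has_derivative[OF l(1)] by simp
  from has_derivative_compose[OF D(1) this]
  have "((\<lambda>z. fock_eval (vec_lambda (point_value f z)) x) has_derivative (\<lambda>v. fock_deriv l (D v) x))
      (at z within scalar_domain f inv_series)"
    by (rule has_derivative_at_withinI)
  then have "(functional_representation f inv_series x has_derivative (\<lambda>v. fock_deriv l (D v) x))
      (at z within scalar_domain f inv_series)"
    by (rule has_derivative_transform[OF z, rotated])
      (auto simp: scalar_domain_eq functional_representation_inv_point point_value_inv_point vec_lambda_eta)
  then show "\<exists>D. (\<forall>c v. D (c *s v) = c * D v) \<and>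
      (functional_representation f inv_series x has_derivative D) (at z within scalar_domain f inv_series)"
    by (intro exI[of _ "\<lambda>v. fock_deriv l (D v) x"]) (simp add: D(2) fock_deriv_scale)
qed

lemma series_representation_sym_coeff:
  assumes "x \<in> symmetric_families"
  shows "series_representation f inv_series (functional_representation f inv_series x) (sym_coeff x)"
  unfolding series_representation_def
  using has_sum_imp_summable[OF symmetric_norm_has_sum[OF assms]] evaluation_has_sum
  by (simp add: functional_representation_def)

text \<open>Realising the coefficients by a vector reduces uniqueness of the series and surjectivity
  of the functional representation to statements about symmetric families.\<close>

lemma series_representation_obtain:
  assumes "series_representation f inv_series \<psi> c"
  obtains x where "x \<in> symmetric_families" "sym_coeff x = c"
    "\<And>l. norm l < 1 \<Longrightarrow> fock_eval l x = \<psi> (inv_point l)"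
proof -
  obtain x where x: "x \<in> symmetric_families" "sym_coeff x = c"
    using symmetric_family_exists[of c] assms by (auto simp: series_representation_def)
  have "fock_eval l x = \<psi> (inv_point l)" if l: "norm l < 1" for l
  proof (rule has_sum_unique)
    show "((\<lambda>k. c k * scalar_monomial (($) l) k) has_sum fock_eval l x) UNIV"
      using fock_eval_sym_has_sum[OF l, of x] by (simp add: x)
    have "((\<lambda>k. c k * scalar_monomial (point_value f (inv_point l)) k) has_sum \<psi> (inv_point l)) UNIV"
      using assms inv_point_in_domain[OF l] by (auto simp: series_representation_def)
    then show "((\<lambda>k. c k * scalar_monomial (($) l) k) has_sum \<psi> (inv_point l)) UNIV"
      by (simp add: point_value_inv_point l)
  qed
  with x show ?thesis
    using that by blast
qed

lemma symmetric_eqI: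
  assumes "x \<in> symmetric_families" "y \<in> symmetric_families"
    and "\<And>l. norm l < 1 \<Longrightarrow> fock_eval l x = fock_eval l y"
  shows "x = y"
proof -
  have "x - y = 0"
    by (rule symmetric_eq_0)
      (use assms in \<open>simp_all add: fock_eval_diff complex_vector.subspace_diff[OF subspace_symmetric_families]\<close>)
  then show ?thesis
    by simp
qed

lemma series_representation_unique:
  assumes "series_representation f inv_series \<psi> c" "series_representation f inv_series \<psi> c'"
  shows "c = c'"
proof -
  obtain x where x: "x \<in> symmetric_families" "sym_coeff x = c"
    "\<And>l. norm l < 1 \<Longrightarrow> fock_eval l x = \<psi> (inv_point l)"
    using series_representation_obtain[OF assms(1)] by blast
  obtain y where y: "y \<in> symmetric_families" "sym_coeff y = c'"
    "\<And>l. norm l < 1 \<Longrightarrow> fock_eval l y = \<psi> (inv_point l)"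
    using series_representation_obtain[OF assms(2)] by blast
  have "x = y"
    by (rule symmetric_eqI[OF x(1) y(1)]) (simp add: x(3) y(3))
  then show ?thesis
    using x(2) y(2) by simp
qed

lemma bij_betw_functional_representation:
  "bij_betw (functional_representation f inv_series) symmetric_families (domain_hardy f inv_series)"
proof (rule bij_betw_imageI)
  show "inj_on (functional_representation f inv_series) symmetric_families"
  proof (rule inj_onI)
    fix x y assume xy: "x \<in> symmetric_families" "y \<in> symmetric_families"
      and "functional_representation f inv_series x = functional_representation f inv_series y"
    then show "x = y"
      by (intro symmetric_eqI xy) (metis functional_representation_inv_point)
  qed
  show "functional_representation f inv_series ` symmetric_families = domain_hardy f inv_series"
  proof (intro equalityI subsetI)
    fix \<psi> assume "\<psi> \<in> functional_representation f inv_series ` symmetric_families"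
    then obtain x where x: "x \<in> symmetric_families" "\<psi> = functional_representation f inv_series x"
      by blast
    have "\<psi> \<in> extensional (scalar_domain f inv_series)"
      unfolding x(2) functional_representation_def by (rule restrict_extensional)
    then show "\<psi> \<in> domain_hardy f inv_series"
      using functional_representation_holomorphic series_representation_sym_coeff[OF x(1)]
      unfolding domain_hardy_def x(2) by blast
  next
    fix \<psi> assume \<psi>: "\<psi> \<in> domain_hardy f inv_series"
    then obtain c where c: "series_representation f inv_series \<psi> c"
      by (auto simp: domain_hardy_def)
    obtain x where x: "x \<in> symmetric_families" "\<And>l. norm l < 1 \<Longrightarrow> fock_eval l x = \<psi> (inv_point l)"
      using series_representation_obtain[OF c] by blast
    have "\<psi> = functional_representation f inv_series x"
    proof (rule extensionalityI[where A = "scalar_domain f inv_series"])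
      show "functional_representation f inv_series x \<in> extensional (scalar_domain f inv_series)"
        unfolding functional_representation_def by (rule restrict_extensional)
      show "\<psi> z = functional_representation f inv_series x z" if "z \<in> scalar_domain f inv_series" for z
        using that by (auto simp: scalar_domain_eq functional_representation_inv_point x(2))
    qed (use \<psi> in \<open>simp add: domain_hardy_def\<close>)
    then show "\<psi> \<in> functional_representation f inv_series ` symmetric_families"
      using x(1) by blast
  qed
qed

lemma domain_hardy_norm_eq:
  assumes "x \<in> symmetric_families"
  shows "domain_hardy_norm f inv_series (functional_representation f inv_series x) = norm x"
proof -
  have "(THE c. series_representation f inv_series (functional_representation f inv_series x) c) = sym_coeff x"
    using series_representation_sym_coeff[OF assms] series_representation_unique by blast
  then show ?thesis
    using infsumI[OF symmetric_norm_has_sum[OF assms]] by (simp add: domain_hardy_norm_def)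
qed

lemma sym_coeff_unique:
  fixes x :: "'n list ell2"
  assumes "((\<lambda>k. c k *\<^sub>C sym_vector k) has_sum x) UNIV" "x \<in> symmetric_families"
  shows "c = sym_coeff x"
proof
  fix k
  obtain \<alpha> :: "'n list" where \<alpha>: "count_list \<alpha> = k"
    using count_list_surj by blast
  have "c k / sym_card k = sym_coeff x k / sym_card k"
    using sym_has_sum_Rep[OF assms(1), of \<alpha>] sym_coeff_eq[OF assms(2), of \<alpha>] unfolding \<alpha> by (rule trans[OF sym])
  then show "c k = sym_coeff x k"
    using sym_card_pos[of k] by simp
qed

lemma point_bound:
  assumes "z \<in> scalar_domain f inv_series"
  shows "cmod (cinner x (Omega_vector f z)) \<le>
    norm x / sqrt (1 - (\<Sum>i\<in>UNIV. (cmod (point_value f z i))\<^sup>2))"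
proof -
  obtain l where "norm l < 1" "z = inv_point l"
    using assms by (auto simp: scalar_domain_eq)
  then show ?thesis
    using cmod_fock_eval_le[of l x] by (simp add: cinner_Omega point_value_inv_point norm_vec_sum)
qed

lemma cinner_Omega_Omega:
  assumes "z \<in> scalar_domain f inv_series" "w \<in> scalar_domain f inv_series"
  shows "cinner (Omega_vector f z) (Omega_vector f w) =
    1 / (1 - (\<Sum>i\<in>UNIV. point_value f w i * cnj (point_value f z i)))"
proof -
  obtain l m where "norm l < 1" "z = inv_point l" "norm m < 1" "w = inv_point m"
    using assms by (auto simp: scalar_domain_eq)
  then show ?thesis
    by (simp add: Omega_vector_inv_point point_value_inv_point cinner_szego_vector)
qed

end

text \<open>With this order of arguments the double sum is the squared norm of the combination of
  the vectors \<open>v y\<close> with coefficients \<open>c y\<close>.\<close>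

lemma positive_definite_gram: "positive_definite_kernel S (\<lambda>w z. cinner (v z) (v w))"
  for v :: "'b \<Rightarrow> 'a::complex_inner"
  unfolding positive_definite_kernel_def
proof (intro allI impI)
  fix F and c :: "'b \<Rightarrow> complex"
  have "(\<Sum>x\<in>F. \<Sum>y\<in>F. cnj (c x) * c y * cinner (v y) (v x)) =
      cinner (\<Sum>y\<in>F. c y *\<^sub>C v y) (\<Sum>x\<in>F. c x *\<^sub>C v x)"
    by (simp add: cinner_sum_left cinner_sum_right cinner_scaleC_left cinner_scaleC_right
        mult_ac sum_distrib_left)
  also have "\<dots> \<in> \<real>\<^sub>\<ge>\<^sub>0"
    by (simp add: cinner_self del: of_real_power)
  finally show "(\<Sum>x\<in>F. \<Sum>y\<in>F. cnj (c x) * c y * cinner (v y) (v x)) \<in> \<real>\<^sub>\<ge>\<^sub>0" .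
qed

theorem theorem6p5:
  fixes \<kappa> :: model_kind
    and f g :: "'n::finite \<Rightarrow> 'n ncseries"
    and M :: "'n \<Rightarrow> 'n list ell2 \<Rightarrow>\<^sub>L 'n list ell2"
  assumes "model_property \<kappa> f"
    and "universal_model \<kappa> f M"
    and "model_inverse \<kappa> f g"
  shows
    "(sym_hardy = closure (cspan (Gamma_vector f ` scalar_domain f g)) \<and>
      closure (cspan (Gamma_vector f ` scalar_domain f g)) = model_subspace M)
     \<and>
     (bij_betw (functional_representation f g) sym_hardy (domain_hardy f g) \<and>
      (\<forall>x\<in>sym_hardy. \<forall>y\<in>sym_hardy. \<forall>c. \<forall>z\<in>scalar_domain f g.
         functional_representation f g (x + c *\<^sub>C y) z =
           functional_representation f g x z + c * functional_representation f g y z) \<and>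
      (\<forall>\<psi>\<in>domain_hardy f g. \<exists>!c. series_representation f g \<psi> c) \<and>
      (\<forall>x\<in>sym_hardy. domain_hardy_norm f g (functional_representation f g x) = norm x) \<and>
      (\<forall>x\<in>(sym_hardy :: 'n list ell2 set). \<exists>c. ((\<lambda>k. c k *\<^sub>C sym_vector k) has_sum x) UNIV) \<and>
      (\<forall>x\<in>sym_hardy. \<forall>c. ((\<lambda>k. c k *\<^sub>C sym_vector k) has_sum x) UNIV \<longrightarrow>
         ((\<lambda>k. (cmod (c k))\<^sup>2 / sym_card k) has_sum (norm x)\<^sup>2) UNIV \<and>
         (\<forall>z\<in>scalar_domain f g.
           ((\<lambda>k. c k * scalar_monomial (point_value f z) k)
              has_sum cinner x (Omega_vector f z)) UNIV)) \<and>
      (\<forall>x\<in>sym_hardy. \<forall>z\<in>scalar_domain f g.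
         cmod (cinner x (Omega_vector f z)) \<le>
           norm x / sqrt (1 - (\<Sum>i\<in>UNIV. (cmod (point_value f z i))\<^sup>2))))
     \<and>
     ((\<forall>w\<in>scalar_domain f g. \<forall>z\<in>scalar_domain f g.
         cinner (Omega_vector f z) (Omega_vector f w) =
           1 / (1 - (\<Sum>i\<in>UNIV. point_value f w i * cnj (point_value f z i)))) \<and>
      positive_definite_kernel (scalar_domain f g)
        (\<lambda>w z. cinner (Omega_vector f z) (Omega_vector f w)))"
proof -
  obtain G Y where g: "g = (\<lambda>i. Rep_ell2 (G i))" and model: "fock_model f G M Y"
    using fock_model_exists[OF assms] by blast
  interpret fock_model f G M Y
    by (rule model)
  note sym = sym_hardy_eq[where 'n = 'n]
  have lin: "functional_representation f g (x + c *\<^sub>C y) z =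
      functional_representation f g x z + c * functional_representation f g y z"
    if "z \<in> scalar_domain f g" for x y c z
    using that by (simp add: functional_representation_def cinner_add_left cinner_scaleC_left)
  have unique: "\<exists>!c. series_representation f g \<psi> c" if "\<psi> \<in> domain_hardy f g" for \<psi>
    using that series_representation_unique unfolding g domain_hardy_def by blast
  have expand: "\<exists>c. ((\<lambda>k. c k *\<^sub>C sym_vector k) has_sum x) UNIV"
    if "x \<in> sym_hardy" for x :: "'n list ell2"
    using symmetric_has_sum that unfolding sym by blast
  \<comment> \<open>An arbitrary expansion in the \<open>sym_vector k\<close> is first identified
    with the one given by \<open>sym_coeff\<close>, for which norm and evaluation are known.\<close>
  have coeffs: "((\<lambda>k. (cmod (c k))\<^sup>2 / sym_card k) has_sum (norm x)\<^sup>2) UNIV \<and>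
      (\<forall>z\<in>scalar_domain f g.
        ((\<lambda>k. c k * scalar_monomial (point_value f z) k) has_sum cinner x (Omega_vector f z)) UNIV)"
    if "x \<in> sym_hardy" "((\<lambda>k. c k *\<^sub>C sym_vector k) has_sum x) UNIV" for x :: "'n list ell2" and c
    using that sym_coeff_unique[of c x] symmetric_norm_has_sum[of x] evaluation_has_sum[of _ x]
    unfolding sym g by blast
  show ?thesis
    using closure_span_Gamma model_subspace_eq bij_betw_functional_representation lin unique
      domain_hardy_norm_eq expand coeffs point_bound cinner_Omega_Omega
      positive_definite_gram[of "scalar_domain f g" "Omega_vector f"]
    unfolding sym g by (intro conjI ballI allI impI) auto
qed

end
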